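(* Let $G=\langle S\rangle$ be a group such that the Cayley graph $\Gamma=\mathsf{Cay}(G,S)$ is a cubic graph of connectivity two. Then $G$ is isomorphic to one of the following groups, for some positive integers $n,m,k$ (whichever of these parameters appear): (i) $\mathbb Z_n * \mathbb Z_2$, presented as $\mathbb Z_n * \mathbb Z_2=\langle a,b\mid b^2,(ba)^n\rangle$ or as $\mathbb Z_n * \mathbb Z_2=\langle a,b,c\mid a^2,b^2,c^2,(bcba)^n\rangle$; (ii) $D_{2n} \underset{\mathbb Z_2}{*}(t)=\langle a,b\mid b^2,(ba^{-1}ba)^n\rangle$; (iii) $D_{2n} \underset{\mathbb Z_2}{*}D_{2m}=\langle a,b,c\mid a^2,b^2,c^2,(ba)^n,(bc)^m\rangle$, or $D_{4n} \underset{\mathbb Z_2}{*}D_{2m}=\langle a,b,c \mid a^2, b^2, c^2, (bc)^{2n}, (a(bc)^n)^m \rangle$, or $D_{2n} \underset{\mathbb Z_2}{*}D_{2m}=\langle a,b,c \mid a^2, b^2, c^2, (bc)^n,(a(bc)^kb)^m \rangle$; (iv) $\mathbb Z_{2n} \underset{\mathbb Z_2}{*} D_{2m}=\langle a,b \mid b^2, a^{2n}, (ba^n)^m \rangle$; (v) $D_{\infty} \underset{\mathbb Z_2}{*} D_{2m}=\langle a,b,c \mid a^2, b^2, c^2, (a(bc)^nb)^m \rangle$.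
   Context: $\mathsf{Cay}(G,S)$ has vertex set $G$ and edges $\{g,gs\}$ for $g\in G$, $s\in S$ (undirected simple graph). Cubic means $3$-regular; connectivity two means that the graph is $2$-connected but some set of two vertices separates it. $\mathbb Z_n$ is the cyclic group of order $n$; $D_{2n}=\langle a,b\mid b^2,a^n,(ba)^2\rangle$ is the dihedral group of order $2n$; $D_\infty=\langle a,b\mid b^2,(ba)^2\rangle$ is the infinite dihedral group. $A*B$ denotes the free product, $A\underset{C}{*}B$ denotes the free product of $A$ and $B$ with amalgamation over (isomorphic copies of) $C$, and $A\underset{C}{*}(t)$ denotes an HNN-extension of $A$ over the subgroup $C$ with stable letter $t$: $\langle A,t\mid tht^{-1}=\phi(h),\ h\in C\rangle$ for an isomorphism $\phi$ from $C$ onto a subgroup of $A$. *)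

theory Defs
  imports "HOL-Algebra.Elementary_Groups"
begin

text \<open>
  A simple graph is given by a vertex set \<open>V\<close> and a set \<open>E\<close> of two-element subsets of \<open>V\<close>.
\<close>

text \<open>
  The Cayley graph is a simple graph, so an identity element in \<open>S\<close> contributes no edge.
\<close>
definition cayley_edges :: "('a, 'm) monoid_scheme \<Rightarrow> 'a set \<Rightarrow> 'a set set" where
  "cayley_edges G S =
     {{g, g \<otimes>\<^bsub>G\<^esub> s} | g s. g \<in> carrier G \<and> s \<in> S \<and> g \<otimes>\<^bsub>G\<^esub> s \<noteq> g}"

definition cubic_graph :: "'v set \<Rightarrow> 'v set set \<Rightarrow> bool" where
  "cubic_graph V E \<longleftrightarrow> (\<forall>v\<in>V. card {e \<in> E. v \<in> e} = 3)"

text \<open>Connectedness of the subgraph of \<open>E\<close> induced on \<open>W\<close>.\<close>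
definition connected_on :: "'v set \<Rightarrow> 'v set set \<Rightarrow> bool" where
  "connected_on W E \<longleftrightarrow>
     (\<forall>u\<in>W. \<forall>v\<in>W. (u, v) \<in> {(x, y). x \<in> W \<and> y \<in> W \<and> {x, y} \<in> E}\<^sup>*)"

definition k_connected :: "nat \<Rightarrow> 'v set \<Rightarrow> 'v set set \<Rightarrow> bool" where
  "k_connected k V E \<longleftrightarrow>
     (finite V \<longrightarrow> card V > k) \<and>
     (\<forall>X\<subseteq>V. finite X \<and> card X < k \<longrightarrow> connected_on (V - X) E)"

definition separates :: "'v set \<Rightarrow> 'v set \<Rightarrow> 'v set set \<Rightarrow> bool" where
  "separates X V E \<longleftrightarrow> X \<subseteq> V \<and> \<not> connected_on (V - X) E"

definition connectivity_two :: "'v set \<Rightarrow> 'v set set \<Rightarrow> bool" where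
  "connectivity_two V E \<longleftrightarrow>
     k_connected 2 V E \<and> (\<exists>X. finite X \<and> card X = 2 \<and> separates X V E)"

text \<open>
  A word is a list of signed generators: \<open>(x, True)\<close> stands for \<open>x\<close> and \<open>(x, False)\<close> for its
  formal inverse.
\<close>
type_synonym 'x word = "('x \<times> bool) list"

definition words :: "'x set \<Rightarrow> 'x word set" where
  "words X = lists (X \<times> UNIV)"

definition winv :: "'x word \<Rightarrow> 'x word" where
  "winv w = rev (map (\<lambda>(x, e). (x, \<not> e)) w)"

definition wpow :: "'x word \<Rightarrow> nat \<Rightarrow> 'x word"  (infixr "\<^bold>^" 80) where
  "w \<^bold>^ n = concat (replicate n w)"

text \<open>
  Two words represent the same element of the group with generators \<open>X\<close> and relators \<open>R\<close> iff they
  are linked by finitely many insertions and deletions of relators and of the trivial relators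
  \<open>x x\<^sup>-\<^sup>1\<close>, \<open>x\<^sup>-\<^sup>1 x\<close>.
\<close>
inductive_set presentation_rel :: "'x set \<Rightarrow> 'x word set \<Rightarrow> ('x word \<times> 'x word) set"
  for X :: "'x set" and R :: "'x word set" where
  refl: "w \<in> words X \<Longrightarrow> (w, w) \<in> presentation_rel X R"
| sym: "(u, v) \<in> presentation_rel X R \<Longrightarrow> (v, u) \<in> presentation_rel X R"
| trans: "(u, v) \<in> presentation_rel X R \<Longrightarrow> (v, w) \<in> presentation_rel X R \<Longrightarrow>
          (u, w) \<in> presentation_rel X R"
| cancel: "u \<in> words X \<Longrightarrow> v \<in> words X \<Longrightarrow> x \<in> X \<Longrightarrow>
           (u @ [(x, e), (x, \<not> e)] @ v, u @ v) \<in> presentation_rel X R"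
| relator: "u \<in> words X \<Longrightarrow> v \<in> words X \<Longrightarrow> r \<in> R \<Longrightarrow>
            (u @ r @ v, u @ v) \<in> presentation_rel X R"

text \<open>
  The group given by generators and relators; the relators must be words over \<open>X\<close>
  (see \<open>group_presented\<close>).
\<close>
definition presented :: "'x set \<Rightarrow> 'x word set \<Rightarrow> 'x word set monoid" where
  "presented X R =
     \<lparr> carrier = words X // presentation_rel X R,
       mult = (\<lambda>U V. \<Union>u\<in>U. \<Union>v\<in>V. presentation_rel X R `` {u @ v}),
       one = presentation_rel X R `` {[]} \<rparr>"

lemma words_Nil [simp]: "[] \<in> words X"
  by (simp add: words_def)

lemma words_append [simp]: "u @ v \<in> words X \<longleftrightarrow> u \<in> words X \<and> v \<in> words X"
  by (simp add: words_def)

lemma winv_in_words [simp]: "winv w \<in> words X \<longleftrightarrow> w \<in> words X"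
  by (force simp: words_def winv_def)

lemma presentation_rel_words:
  assumes "(u, v) \<in> presentation_rel X R" "R \<subseteq> words X"
  shows "u \<in> words X \<and> v \<in> words X"
  using assms by (induction rule: presentation_rel.induct) (auto simp: words_def)

lemma equiv_presentation_rel:
  assumes "R \<subseteq> words X"
  shows "equiv (words X) (presentation_rel X R)"
proof (rule equivI)
  show "presentation_rel X R \<subseteq> words X \<times> words X"
    using presentation_rel_words[OF _ assms] by auto
  show "refl_on (words X) (presentation_rel X R)"
    by (rule refl_onI) (rule presentation_rel.refl)
  show "sym (presentation_rel X R)" by (rule symI) (rule presentation_rel.sym)
  show "trans (presentation_rel X R)" by (rule transI) (rule presentation_rel.trans)
qed

lemma presentation_rel_context:
  assumes "(u, v) \<in> presentation_rel X R" "p \<in> words X" "q \<in> words X"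
  shows "(p @ u @ q, p @ v @ q) \<in> presentation_rel X R"
  using assms(1)
proof (induction rule: presentation_rel.induct)
  case (cancel u v x e)
  then show ?case
    using presentation_rel.cancel[of "p @ u" X "v @ q" x e] assms(2,3) by simp
next
  case (relator u v r)
  then show ?case
    using presentation_rel.relator[of "p @ u" X "v @ q" r] assms(2,3) by simp
next
  case (refl w)
  then show ?case using assms(2,3) by (intro presentation_rel.refl) simp
next
  case (sym u v)
  then show ?case by (blast intro: presentation_rel.sym)
next
  case (trans u v w)
  then show ?case by (blast intro: presentation_rel.trans)
qed

lemma presentation_rel_append:
  assumes "(u, u') \<in> presentation_rel X R" "(v, v') \<in> presentation_rel X R" "R \<subseteq> words X"
  shows "(u @ v, u' @ v') \<in> presentation_rel X R"
proof -
  have "(u @ v, u' @ v) \<in> presentation_rel X R" "(u' @ v, u' @ v') \<in> presentation_rel X R"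
    using presentation_rel_context[OF assms(1), of "[]" v]
      presentation_rel_context[OF assms(2), of u' "[]"]
      presentation_rel_words[OF assms(1,3)] presentation_rel_words[OF assms(2,3)]
    by auto
  then show ?thesis by (rule presentation_rel.trans)
qed

lemma presentation_rel_winv:
  assumes "w \<in> words X"
  shows "(winv w @ w, []) \<in> presentation_rel X R"
  using assms
proof (induction w)
  case Nil
  then show ?case by (auto simp: winv_def intro: presentation_rel.refl)
next
  case (Cons y w)
  obtain x e where y: "y = (x, e)" by (cases y)
  have w: "w \<in> words X" "x \<in> X" using Cons.prems by (auto simp: words_def y)
  have "(winv w @ [(x, \<not> e), (x, \<not> \<not> e)] @ w, winv w @ w) \<in> presentation_rel X R"
    using w by (intro presentation_rel.cancel) auto
  moreover have "winv (y # w) @ y # w = winv w @ [(x, \<not> e), (x, \<not> \<not> e)] @ w"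
    by (simp add: winv_def y)
  ultimately show ?case using Cons.IH[OF w(1)] by (metis presentation_rel.trans)
qed

lemma presented_mult:
  assumes "R \<subseteq> words X" "u \<in> words X" "v \<in> words X"
  shows "presentation_rel X R `` {u} \<otimes>\<^bsub>presented X R\<^esub> presentation_rel X R `` {v}
       = presentation_rel X R `` {u @ v}"
proof -
  let ?r = "presentation_rel X R"
  have eq: "?r `` {u' @ v'} = ?r `` {u @ v}" if "(u, u') \<in> ?r" "(v, v') \<in> ?r" for u' v'
    by (rule equiv_class_eq[OF equiv_presentation_rel[OF assms(1)]
          presentation_rel_append[OF that assms(1)], symmetric])
  have "u \<in> ?r `` {u}" "v \<in> ?r `` {v}"
    using assms by (simp_all add: presentation_rel.refl)
  moreover have "?r `` {u' @ v'} = ?r `` {u @ v}" if "u' \<in> ?r `` {u}" "v' \<in> ?r `` {v}" for u' v'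
    using that by (intro eq) simp_all
  ultimately have "(\<Union>u'\<in>?r `` {u}. \<Union>v'\<in>?r `` {v}. ?r `` {u' @ v'}) = ?r `` {u @ v}"
    by blast
  then show ?thesis by (simp add: presented_def)
qed

lemma group_presented:
  assumes R: "R \<subseteq> words X"
  shows "group (presented X R)"
proof (rule groupI)
  let ?r = "presentation_rel X R"
  note m = presented_mult[OF R]
  have car: "carrier (presented X R) = words X // ?r"
    and one: "\<one>\<^bsub>presented X R\<^esub> = ?r `` {[]}" by (simp_all add: presented_def)
  show "\<one>\<^bsub>presented X R\<^esub> \<in> carrier (presented X R)"
    unfolding car one by (rule quotientI) simp
  fix x assume "x \<in> carrier (presented X R)"
  then obtain u where u: "u \<in> words X" "x = ?r `` {u}" unfolding car by (rule quotientE)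
  show "\<one>\<^bsub>presented X R\<^esub> \<otimes>\<^bsub>presented X R\<^esub> x = x"
    unfolding one u(2) using m[of "[]" u] u(1) by simp
  have "?r `` {winv u} \<otimes>\<^bsub>presented X R\<^esub> x = \<one>\<^bsub>presented X R\<^esub>"
    unfolding one u(2)
    using m[of "winv u" u] u(1)
      equiv_class_eq[OF equiv_presentation_rel[OF R] presentation_rel_winv[OF u(1)]]
    by simp
  moreover have "?r `` {winv u} \<in> carrier (presented X R)"
    unfolding car by (rule quotientI) (simp add: u)
  ultimately show "\<exists>y\<in>carrier (presented X R). y \<otimes>\<^bsub>presented X R\<^esub> x = \<one>\<^bsub>presented X R\<^esub>"
    by blast
  fix y assume "y \<in> carrier (presented X R)"
  then obtain v where v: "v \<in> words X" "y = ?r `` {v}" unfolding car by (rule quotientE)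
  show "x \<otimes>\<^bsub>presented X R\<^esub> y \<in> carrier (presented X R)"
    unfolding u(2) v(2) m[OF u(1) v(1)] car by (rule quotientI) (simp add: u v)
  fix z assume "z \<in> carrier (presented X R)"
  then obtain w where w: "w \<in> words X" "z = ?r `` {w}" unfolding car by (rule quotientE)
  show "x \<otimes>\<^bsub>presented X R\<^esub> y \<otimes>\<^bsub>presented X R\<^esub> z = x \<otimes>\<^bsub>presented X R\<^esub> (y \<otimes>\<^bsub>presented X R\<^esub> z)"
    unfolding u(2) v(2) w(2) using u(1) v(1) w(1) by (simp add: m)
qed

text \<open>The multiplication table of \<open>A\<close>, with the elements of \<open>A\<close> renamed by \<open>f\<close>.\<close>
definition table_relators :: "('a \<Rightarrow> 'x) \<Rightarrow> ('a, 'm) monoid_scheme \<Rightarrow> 'x word set" where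
  "table_relators f A =
     {[(f x, True), (f y, True), (f (x \<otimes>\<^bsub>A\<^esub> y), False)] | x y. x \<in> carrier A \<and> y \<in> carrier A}"

definition free_product ::
    "('a, 'm) monoid_scheme \<Rightarrow> ('b, 'n) monoid_scheme \<Rightarrow> ('a + 'b) word set monoid" where
  "free_product A B =
     presented (carrier A <+> carrier B) (table_relators Inl A \<union> table_relators Inr B)"

text \<open>Amalgamation identifies \<open>i h\<close> with \<open>j h\<close> for \<open>h\<close> in \<open>C\<close>.\<close>
definition amalgam ::
    "('a, 'm) monoid_scheme \<Rightarrow> ('b, 'n) monoid_scheme \<Rightarrow> ('c, 'k) monoid_scheme \<Rightarrow>
     ('c \<Rightarrow> 'a) \<Rightarrow> ('c \<Rightarrow> 'b) \<Rightarrow> ('a + 'b) word set monoid" where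
  "amalgam A B C i j =
     presented (carrier A <+> carrier B)
       (table_relators Inl A \<union> table_relators Inr B \<union>
        {[(Inl (i h), True), (Inr (j h), False)] | h. h \<in> carrier C})"

text \<open>
  The generator \<open>None\<close> is the stable letter \<open>t\<close>; the relators beyond the table of \<open>A\<close> say
  \<open>t h t\<^sup>-\<^sup>1 = \<phi> h\<close> for \<open>h\<close> in the subgroup \<open>H\<close>.
\<close>
definition hnn_extension ::
    "('a, 'm) monoid_scheme \<Rightarrow> 'a set \<Rightarrow> ('a \<Rightarrow> 'a) \<Rightarrow> 'a option word set monoid" where
  "hnn_extension A H \<phi> =
     presented (insert None (Some ` carrier A))
       (table_relators Some A \<union>
        {[(None, True), (Some h, True), (None, False), (Some (\<phi> h), False)] | h. h \<in> H})"

text \<open>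
  The notation for an amalgamated product or an HNN-extension names only the isomorphism type of
  the amalgamated subgroup; the embeddings are existentially quantified.
\<close>
definition is_amalgam ::
    "('g, 'l) monoid_scheme \<Rightarrow> ('a, 'm) monoid_scheme \<Rightarrow> ('c, 'k) monoid_scheme \<Rightarrow>
     ('b, 'n) monoid_scheme \<Rightarrow> bool" where
  "is_amalgam G A C B \<longleftrightarrow> (\<exists>i\<in>mon C A. \<exists>j\<in>mon C B. G \<cong> amalgam A B C i j)"

definition is_hnn_extension ::
    "('g, 'l) monoid_scheme \<Rightarrow> ('a, 'm) monoid_scheme \<Rightarrow> ('c, 'k) monoid_scheme \<Rightarrow> bool" where
  "is_hnn_extension G A C \<longleftrightarrow>
     (\<exists>H \<phi>. subgroup H A \<and> A\<lparr>carrier := H\<rparr> \<cong> C \<and> \<phi> \<in> mon (A\<lparr>carrier := H\<rparr>) A \<and>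
            G \<cong> hnn_extension A H \<phi>)"

datatype gen = GenA | GenB | GenC

abbreviation gen_a :: "gen word"  ("\<aa>") where "\<aa> \<equiv> [(GenA, True)]"
abbreviation gen_b :: "gen word"  ("\<bb>") where "\<bb> \<equiv> [(GenB, True)]"
abbreviation gen_c :: "gen word"  ("\<cc>") where "\<cc> \<equiv> [(GenC, True)]"

text \<open>\<open>dihedral n\<close> has order \<open>2 * n\<close> (for \<open>n > 0\<close>); in particular \<open>dihedral 1\<close> is cyclic of order 2.\<close>
definition dihedral :: "nat \<Rightarrow> gen word set monoid" where
  "dihedral n = presented {GenA, GenB} {\<bb> \<^bold>^ 2, \<aa> \<^bold>^ n, (\<bb> @ \<aa>) \<^bold>^ 2}"

definition dihedral_inf :: "gen word set monoid" where
  "dihedral_inf = presented {GenA, GenB} {\<bb> \<^bold>^ 2, (\<bb> @ \<aa>) \<^bold>^ 2}"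

abbreviation cyclic :: "nat \<Rightarrow> int monoid" where
  "cyclic n \<equiv> integer_mod_group n"

end

theory Submission
  imports Defs "HOL-Algebra.Multiplicative_Group"
begin

text \<open>
  Let \<open>T\<close> be the set of the three labels of the Cayley graph. The graph is bridgeless and has a
  \<open>2\<close>-edge-cut. Call two edges equivalent if they are equal or form a cut. The classes are finite, and
  a component of the graph minus a class meets exactly two edges of it. So a walk that enters the
  component at \<open>\<one>\<close> across the edge \<open>s\<close> leaves it across the same edge or at a fixed element
  \<open>exit_at s\<close>. A shortest word for some \<open>exit_at s\<close> uses only labels of edges that lie in no cut; this
  forces at most two of the three labels to be cut labels and determines all exits. Reducing a closed
  word along the visits to one edge class shows that \<open>G\<close> is presented by the relations among the
  uncut labels together with one relator for the round trip along each class of edges, and this gives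
  a group of one of the listed types.
\<close>


section \<open>Edge cuts of size two in bridgeless graphs\<close>

text \<open>No normal forms in free products, amalgamated products or HNN-extensions are used. Their
  universal properties give a homomorphism from a candidate group \<open>F\<close> to
  \<open>G\<close>, and its injectivity asks only that every word in the labels that is closed in
  \<open>G\<close> be trivial in \<open>F\<close>. The same criterion with \<open>F\<close> given by
  generators and relators yields the presentation, so each case verifies one list of relators for
  two candidates. Cubicity turns a separating pair of vertices into a cut of two edges, and it keeps
  two edges at one vertex from forming a cut, since the third would then be a bridge. The exponents
  in the relators are orders of round trips; they are positive because the classes are finite.
  Dihedral factors arise for two reasons: two uncut involutive labels generate an image of a
  dihedral group, and the exit of a single cut label is an involution, because exits are mutually
  inverse.\<close>

definition boundary :: "'v set set \<Rightarrow> 'v set \<Rightarrow> 'v set set" where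
  "boundary E A = {e \<in> E. e \<inter> A \<noteq> {} \<and> e - A \<noteq> {}}"

lemma boundary_edge: "{x, y} \<in> boundary E A \<longleftrightarrow> {x, y} \<in> E \<and> (x \<in> A \<longleftrightarrow> y \<notin> A)"
  by (auto simp: boundary_def)

definition component :: "'v set set \<Rightarrow> 'v \<Rightarrow> 'v set" where
  "component E x = {y. (x, y) \<in> {(u, v). {u, v} \<in> E}\<^sup>*}"

lemma component_self [simp]: "x \<in> component E x"
  by (simp add: component_def)

lemma component_step: "y \<in> component E x \<Longrightarrow> {y, z} \<in> E \<Longrightarrow> z \<in> component E x"
  by (auto simp: component_def intro: rtrancl.rtrancl_into_rtrancl)

lemma component_trans: "y \<in> component E x \<Longrightarrow> z \<in> component E y \<Longrightarrow> z \<in> component E x"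
  by (auto simp: component_def intro: rtrancl_trans)

text \<open>A walk that avoids \<open>C\<close> crosses no boundary edge of \<open>A\<close>, so it
  cannot change sides.\<close>

lemma component_same_side:
  assumes "y \<in> component (E - C) x" "boundary E A \<subseteq> C"
  shows "y \<in> A \<longleftrightarrow> x \<in> A"
proof -
  have "(x, y) \<in> {(u, v). {u, v} \<in> E - C}\<^sup>*" using assms(1) by (simp add: component_def)
  then show ?thesis
  proof (induction rule: rtrancl_induct)
    case (step y z)
    then have "{y, z} \<in> E" "{y, z} \<notin> boundary E A" using assms(2) by auto
    then show ?case using step.IH by (simp add: boundary_edge)
  qed simp
qed

text \<open>Connectedness and the absence of bridges are both phrased by boundaries of arbitrary
  sets, so that cuts can be added and compared without speaking of deleted vertices.\<close>

locale bridgeless_graph =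
  fixes V :: "'v set" and E :: "'v set set"
  assumes edge: "e \<in> E \<Longrightarrow> \<exists>x y. x \<in> V \<and> y \<in> V \<and> x \<noteq> y \<and> e = {x, y}"
    and connected: "boundary E A = {} \<Longrightarrow> V \<subseteq> A \<or> V \<inter> A = {}"
    and bridgeless: "boundary E A \<noteq> {e}"
begin

abbreviation \<delta> where "\<delta> \<equiv> boundary E"

lemma boundary_eqI:
  assumes "\<And>x y. {x, y} \<in> E \<Longrightarrow> x \<noteq> y \<Longrightarrow> (x \<in> A \<longleftrightarrow> y \<notin> A) \<longleftrightarrow> {x, y} \<in> F" "F \<subseteq> E"
  shows "\<delta> A = F"
proof -
  have "e \<in> \<delta> A \<longleftrightarrow> e \<in> F" if "e \<in> E" for e
    using edge[OF that] assms(1) that by (auto simp: boundary_edge)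
  then show ?thesis using assms(2) by (auto simp: boundary_def)
qed

lemma boundaryE:
  assumes "e \<in> \<delta> A"
  obtains u v where "e = {u, v}" "u \<in> A" "v \<notin> A" "e \<in> E"
proof -
  have e: "e \<in> E" using assms by (simp add: boundary_def)
  then obtain x y where xy: "e = {x, y}" using edge by blast
  show thesis
  proof (cases "x \<in> A")
    case True then show ?thesis using that[of x y] assms e unfolding xy boundary_edge by simp
  next
    case False then show ?thesis using that[of y x] assms e unfolding xy boundary_edge by (simp add: insert_commute)
  qed
qed

lemma boundary_subset: "\<delta> A \<subseteq> E" by (auto simp: boundary_def)

text \<open>An edge crosses a symmetric difference iff it crosses exactly one of the two sets. So
  the boundaries form a vector space over the field with two elements; several cuts below are
  obtained as sums of this kind.\<close>

lemma boundary_sym_diff: "\<delta> (sym_diff A B) = sym_diff (\<delta> A) (\<delta> B)"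
  using boundary_subset by (intro boundary_eqI) (auto simp: boundary_edge)

text \<open>Since \<open>A\<close> ranges over all sets of the type, the complement needs no
  intersection with \<open>V\<close>.\<close>

lemma boundary_compl: "\<delta> (- A) = \<delta> A"
  using boundary_subset by (intro boundary_eqI) (auto simp: boundary_edge)

definition cut_equiv :: "'v set \<Rightarrow> 'v set \<Rightarrow> bool"  (infix "\<approx>" 50) where
  "e \<approx> f \<longleftrightarrow> e \<in> E \<and> f \<in> E \<and> (e = f \<or> (\<exists>A. \<delta> A = {e, f}))"

lemma cut_equivI: "\<delta> A = {e, f} \<Longrightarrow> e \<approx> f"
  using boundary_subset[of A] by (auto simp: cut_equiv_def)

lemma cut_equiv_sym: "e \<approx> f \<Longrightarrow> f \<approx> e"
  by (auto simp: cut_equiv_def insert_commute)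

lemma cut_equiv_trans: assumes "e \<approx> f" "f \<approx> g" shows "e \<approx> g"
proof (cases "e = f \<or> f = g \<or> e = g")
  case True then show ?thesis using assms by (auto simp: cut_equiv_def)
next
  case False
  then obtain A B where "\<delta> A = {e, f}" "\<delta> B = {f, g}" using assms by (auto simp: cut_equiv_def)
  then have "\<delta> (sym_diff A B) = {e, g}" using False by (auto simp: boundary_sym_diff)
  then show ?thesis by (rule cut_equivI)
qed

definition cut_class :: "'v set \<Rightarrow> 'v set set" where
  "cut_class e = {f. e \<approx> f}"

lemma cut_class_self: "e \<in> E \<Longrightarrow> e \<in> cut_class e"
  by (simp add: cut_class_def cut_equiv_def)

lemma cut_class_eq: "e \<approx> f \<Longrightarrow> cut_class e = cut_class f"
  by (auto simp: cut_class_def intro: cut_equiv_trans cut_equiv_sym)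

lemma cut_class_subset: "cut_class e \<subseteq> E"
  by (auto simp: cut_class_def cut_equiv_def)

text \<open>As \<open>e\<close> is no bridge, its ends are joined by a path that avoids
  \<open>e\<close>. A cut \<open>{e, f}\<close> separates these ends and so contains an edge of the
  path, which can only be \<open>f\<close>. The class is therefore contained in the path together
  with \<open>e\<close>.\<close>

lemma finite_cut_class: assumes "e \<in> E" shows "finite (cut_class e)"
proof -
  obtain x y where e: "e = {x, y}" "x \<noteq> y" using edge[OF assms] by auto
  let ?K = "component (E - {e}) x"
  have "\<delta> ?K \<subseteq> {e}"
  proof
    fix f assume f: "f \<in> \<delta> ?K"
    then obtain u v where uv: "f = {u, v}" "u \<in> ?K" "v \<notin> ?K" "f \<in> E"
      by (rule boundaryE)
    then show "f \<in> {e}" using component_step[of u "E - {e}" x v] by auto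
  qed
  then have "\<delta> ?K = {}" using bridgeless[of ?K e] by blast
  then have "y \<in> ?K" using assms component_self[of x "E - {e}"] unfolding e by (metis boundary_edge empty_iff)
  then have "(x, y) \<in> {(u, v). {u, v} \<in> E - {e}}\<^sup>*" by (simp add: component_def)
  \<comment> \<open>Of the path only the finite set \<open>F\<close> of its edges is kept, with the
    property that every set containing \<open>x\<close> but not \<open>y\<close> has a boundary edge
    in \<open>F\<close>.\<close>
  then have "\<exists>F. finite F \<and> F \<subseteq> E - {e} \<and> (\<forall>A. x \<in> A \<and> y \<notin> A \<longrightarrow> \<delta> A \<inter> F \<noteq> {})"
  proof (induction rule: rtrancl_induct)
    case base then show ?case by auto
  next
    case (step y z)
    then obtain F where "finite F" "F \<subseteq> E - {e}" "\<forall>A. x \<in> A \<and> y \<notin> A \<longrightarrow> \<delta> A \<inter> F \<noteq> {}" by blast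
    then show ?case using step(2) by (intro exI[of _ "insert {y, z} F"]) (auto simp: boundary_edge)
  qed
  then obtain F where F: "finite F" "F \<subseteq> E - {e}" "\<And>A. x \<in> A \<Longrightarrow> y \<notin> A \<Longrightarrow> \<delta> A \<inter> F \<noteq> {}" by blast
  have "cut_class e \<subseteq> insert e F"
  proof
    fix f assume "f \<in> cut_class e"
    then consider "f = e" | A where "\<delta> A = {e, f}" by (auto simp: cut_class_def cut_equiv_def)
    then show "f \<in> insert e F"
    proof cases
      case 2
      then have "{x, y} \<in> \<delta> A" by (simp add: e)
      then consider "x \<in> A" "y \<notin> A" | "x \<in> - A" "y \<notin> - A" by (auto simp: boundary_edge)
      then have "\<delta> A \<inter> F \<noteq> {}" by cases (use F(3)[of A] F(3)[of "-A"] in \<open>auto simp: boundary_compl\<close>)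
      then show ?thesis using 2 F(2) by auto
    qed simp
  qed
  then show ?thesis using F(1) finite_subset by blast
qed

definition in_cut :: "'v set \<Rightarrow> bool" where
  "in_cut e \<longleftrightarrow> (\<exists>f. f \<noteq> e \<and> e \<approx> f)"

lemma in_cutI: "\<delta> A = {e, f} \<Longrightarrow> e \<noteq> f \<Longrightarrow> in_cut e"
  using cut_equivI by (auto simp: in_cut_def)

lemma in_cut_cong: "e \<approx> f \<Longrightarrow> in_cut e \<longleftrightarrow> in_cut f"
  unfolding in_cut_def by (metis cut_equiv_sym cut_equiv_trans)

abbreviation side :: "'v set \<Rightarrow> 'v \<Rightarrow> 'v set" where
  "side e x \<equiv> component (E - cut_class e) x"

lemma boundary_component: "\<delta> (component (E - C) x) \<subseteq> C"
proof
  fix f assume f: "f \<in> \<delta> (component (E - C) x)"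
  then obtain u v where uv: "f = {u, v}" "u \<in> component (E - C) x" "v \<notin> component (E - C) x" "f \<in> E"
    by (rule boundaryE)
  then show "f \<in> C" using component_step[of u "E - C" x v] by auto
qed

text \<open>Some cut \<open>{e, f}\<close> has its whole boundary in the class of \<open>e\<close>.
  Once the class is deleted no walk changes sides of this cut, whereas \<open>e\<close> joins its
  two sides.\<close>

lemma cut_class_separates:
  assumes "in_cut {x, y}"
  shows "y \<notin> side {x, y} x"
proof
  assume y: "y \<in> side {x, y} x"
  obtain f A where "f \<noteq> {x, y}" and A: "\<delta> A = {{x, y}, f}"
    using assms by (auto simp: in_cut_def cut_equiv_def)
  then have "\<delta> A \<subseteq> cut_class {x, y}" 
    using cut_equivI cut_class_self boundary_subset[of A] by (auto simp: cut_class_def cut_equiv_def)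
  then have "y \<in> A \<longleftrightarrow> x \<in> A" using component_same_side[OF y] by blast
  moreover have "{x, y} \<in> \<delta> A" using A by simp
  ultimately show False by (auto simp: boundary_edge)
qed

text \<open>Uncrossing: if three edges of the class left the component, then cuts \<open>A\<close>, \<open>B\<close> around it
  with boundaries \<open>{e, f}\<close> and \<open>{e, h}\<close> would have a union with the single boundary edge \<open>e\<close>.\<close>

lemma boundary_side:
  assumes cut: "in_cut {x, y}"
  obtains e' where "e' \<noteq> {x, y}" "\<delta> (side {x, y} x) = {{x, y}, e'}"
proof -
  define e where "e = {x, y}"
  let ?K = "side e x"
  have eE: "e \<in> E" using cut by (auto simp: in_cut_def cut_equiv_def e_def)
  have y: "y \<notin> ?K" unfolding e_def by (rule cut_class_separates[OF cut])
  have eK: "e \<in> \<delta> ?K" using eE y unfolding e_def by (auto simp: boundary_edge)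
  have around: "\<exists>A. \<delta> A = {e, f} \<and> ?K \<subseteq> A" if f: "f \<in> \<delta> ?K" "f \<noteq> e" for f
  proof -
    have "e \<approx> f" using f(1) boundary_component[of "cut_class e" x] by (auto simp: cut_class_def)
    then obtain A0 where A0: "\<delta> A0 = {e, f}" using f by (auto simp: cut_equiv_def)
    \<comment> \<open>Passing to the complement keeps the boundary, so the cut may be taken on the
      side that contains \<open>x\<close>.\<close>
    define A where "A = (if x \<in> A0 then A0 else - A0)"
    have A: "\<delta> A = {e, f}" "x \<in> A" using A0 by (auto simp: A_def boundary_compl)
    have sub: "\<delta> A \<subseteq> cut_class e" unfolding A(1) using \<open>e \<approx> f\<close> cut_class_self[OF eE] by (auto simp: cut_class_def)
    have "?K \<subseteq> A"
    proof
      fix z assume "z \<in> ?K"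
      from component_same_side[OF this sub] A(2) show "z \<in> A" by simp
    qed
    then show ?thesis using A(1) by (intro exI[of _ A] conjI)
  qed
  have two: "f = h" if fh: "f \<in> \<delta> ?K" "f \<noteq> e" "h \<in> \<delta> ?K" "h \<noteq> e" for f h
  proof (rule ccontr)
    assume ne: "f \<noteq> h"
    from around[OF fh(1,2)] obtain A where A: "\<delta> A = {e, f}" "?K \<subseteq> A" by (elim exE conjE)
    from around[OF fh(3,4)] obtain B where B: "\<delta> B = {e, h}" "?K \<subseteq> B" by (elim exE conjE)
    have "\<delta> (A \<union> B) = {e}"
    proof (rule boundary_eqI)
      fix u v assume uv: "{u, v} \<in> E" "u \<noteq> v"
      have 1: "{u, v} \<in> \<delta> A \<longleftrightarrow> {u, v} = e \<or> {u, v} = f" "{u, v} \<in> \<delta> B \<longleftrightarrow> {u, v} = e \<or> {u, v} = h"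
        unfolding A(1) B(1) by blast+
      have 2: "u \<in> A \<inter> B \<or> v \<in> A \<inter> B" if "{u, v} = e \<or> {u, v} = f \<or> {u, v} = h"
      proof -
        have "{u, v} \<in> \<delta> ?K" using that fh eK by metis
        then show ?thesis using A(2) B(2) unfolding boundary_edge by blast
      qed
      show "(u \<in> A \<union> B) = (v \<notin> A \<union> B) \<longleftrightarrow> {u, v} \<in> {e}"
        using 1 2 uv(1) fh(2,4) ne unfolding boundary_edge by blast
    qed (use eE in auto)
    then show False using bridgeless[of "A \<union> B" e] by simp
  qed
  obtain e' where e': "e' \<in> \<delta> ?K" "e' \<noteq> e"
  proof (rule ccontr)
    assume "\<not> thesis"
    then have "\<delta> ?K = {e}" using that eK by (intro subset_antisym subsetI) auto
    then show False using bridgeless[of ?K e] by simp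
  qed
  have "\<delta> ?K = {e, e'}"
  proof (intro subset_antisym subsetI)
    fix f assume "f \<in> \<delta> ?K"
    then show "f \<in> {e, e'}" using two[OF _ _ e'] by auto
  qed (use eK e'(1) in auto)
  then show thesis using that[of e'] e'(2) unfolding e_def by simp
qed

text \<open>Cuts of different classes do not cross. If \<open>A\<close> contained \<open>x\<close>
  but not \<open>x'\<close>, then \<open>e\<close> would be a boundary edge of both
  \<open>K \<inter> A\<close> and \<open>A - K\<close>, and their other boundary edges would be
  among \<open>f\<close> and \<open>f'\<close>. Since no boundary equals \<open>{e}\<close> or
  \<open>{e, f'}\<close>, both boundaries would contain \<open>f\<close>.\<close>

lemma ends_same_side:
  assumes K: "\<delta> K = {e, e'}" and e: "e = {x, y}" "x \<in> K" and e': "e' = {x', y'}" "x' \<in> K"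
    and A: "\<delta> A = {f, f'}" and f: "\<not> e \<approx> f" "\<not> e \<approx> f'" and ne: "e \<noteq> e'"
  shows "x \<in> A \<longleftrightarrow> x' \<in> A"
proof -
  have gen: False if A: "\<delta> A = {f, f'}" and x: "x \<in> A" "x' \<notin> A" for A
  proof -
    have y: "y \<notin> K" "y' \<notin> K" "e \<in> E" "e' \<in> E"
    proof -
      have "{x, y} \<in> \<delta> K" "{x', y'} \<in> \<delta> K" unfolding K e(1) e'(1) by blast+
      then show "y \<notin> K" "y' \<notin> K" "e \<in> E" "e' \<in> E"
        unfolding boundary_edge e(1) e'(1) using e(2) e'(2) by blast+
    qed
    have "e \<approx> e" using y(3) by (simp add: cut_equiv_def)
    moreover have "e \<approx> e'" using K by (rule cut_equivI)
    ultimately have nA: "e \<notin> \<delta> A" "e' \<notin> \<delta> A" using f unfolding A by auto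
    have yA: "y \<in> A" "y' \<notin> A" using nA x y(3,4) unfolding e(1) e'(1) by (simp_all add: boundary_edge)
    have sub: "\<delta> (K \<inter> A) \<subseteq> {e, f, f'}" "\<delta> (A - K) \<subseteq> {e, f, f'}"
    proof -
      have "g \<in> {e, f, f'}" if g: "g \<in> \<delta> (K \<inter> A) \<or> g \<in> \<delta> (A - K)" for g
      proof -
        obtain u v where uv: "g = {u, v}" "u \<noteq> v" using g edge[of g] by (auto simp: boundary_def)
        \<comment> \<open>A boundary edge of either piece that does not cross \<open>A\<close> joins
          two vertices of \<open>A\<close> across \<open>K\<close>. Of the two edges that leave
          \<open>K\<close> only \<open>e\<close> meets \<open>A\<close>.\<close>
        have "g \<in> \<delta> A \<or> g \<in> \<delta> K \<and> g \<inter> A \<noteq> {}"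
          using g by (auto simp: uv(1) boundary_edge)
        moreover have "e' \<inter> A = {}" using yA x e'(1) by simp
        ultimately show ?thesis unfolding A K by auto
      qed
      then show "\<delta> (K \<inter> A) \<subseteq> {e, f, f'}" "\<delta> (A - K) \<subseteq> {e, f, f'}" by blast+
    qed
    have ein: "e \<in> \<delta> (K \<inter> A)" "e \<in> \<delta> (A - K)"
      using e(2) x y yA unfolding e(1) by (simp_all add: boundary_edge)
    have "\<delta> B \<noteq> {e, g}" if "g \<in> {f, f'}" for B g using that f cut_equivI[of B e g] by blast
    then have full: "f \<in> \<delta> B" if "e \<in> \<delta> B" "\<delta> B \<subseteq> {e, f, f'}" for B
      using that bridgeless[of B e] by blast
    have ff: "f \<in> \<delta> (K \<inter> A)" "f \<in> \<delta> (A - K)" "f \<in> \<delta> A" using full[OF ein(1) sub(1)] full[OF ein(2) sub(2)] A by auto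
    then obtain u v where uv: "f = {u, v}" "u \<noteq> v" using edge[of f] by (auto simp: boundary_def)
    \<comment> \<open>The edge \<open>f\<close> crosses \<open>A\<close>, so it has a single end in
      \<open>A\<close>, and this end cannot lie both inside and outside \<open>K\<close>.\<close>
    show False using ff by (auto simp: uv(1) boundary_edge)
  qed
  show ?thesis
  proof (rule ccontr)
    assume "\<not> ?thesis"
    then consider "x \<in> A" "x' \<notin> A" | "x \<in> - A" "x' \<notin> - A" by auto
    then show False using gen[of A] gen[of "- A"] A by cases (auto simp: boundary_compl)
  qed
qed

end

section \<open>Cubic Cayley graphs with cut labels\<close>

lemma component_sym:
  assumes "y \<in> component E x" shows "x \<in> component E y"
proof -
  have "sym ({(u, v). {u, v} \<in> E}\<^sup>*)" by (intro sym_rtrancl symI) (simp add: insert_commute)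
  then show ?thesis using assms by (auto simp: component_def dest: symD)
qed

text \<open>The interpretation \<open>l\<close> is a parameter because one and the same word in the
  labels is evaluated in \<open>G\<close> and in a candidate group.\<close>

definition word_prod :: "('b, 'm) monoid_scheme \<Rightarrow> ('x \<Rightarrow> 'b) \<Rightarrow> 'x list \<Rightarrow> 'b" where
  "word_prod M l u = foldr (\<lambda>t y. l t \<otimes>\<^bsub>M\<^esub> y) u \<one>\<^bsub>M\<^esub>"

lemma word_prod_Nil [simp]: "word_prod M l [] = \<one>\<^bsub>M\<^esub>"
  and word_prod_Cons [simp]: "word_prod M l (t # u) = l t \<otimes>\<^bsub>M\<^esub> word_prod M l u"
  by (simp_all add: word_prod_def)

context group begin

lemma word_prod_closed [simp]: "l ` set u \<subseteq> carrier G \<Longrightarrow> word_prod G l u \<in> carrier G"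
  by (induction u) auto

lemma word_prod_append:
  "l ` set u \<subseteq> carrier G \<Longrightarrow> l ` set v \<subseteq> carrier G \<Longrightarrow>
   word_prod G l (u @ v) = word_prod G l u \<otimes> word_prod G l v"
  by (induction u) (auto simp: m_assoc)

lemma word_prod_rev_map:
  "(\<And>t. t \<in> set u \<Longrightarrow> l t \<in> carrier G \<and> l (h t) = inv l t) \<Longrightarrow>
   word_prod G l (rev (map h u)) \<otimes> word_prod G l u = \<one>"
proof (induction u)
  case (Cons t u)
  have c: "l ` set (rev (map h u)) \<subseteq> carrier G" "l ` set u \<subseteq> carrier G" using Cons.prems by auto
  have "word_prod G l (rev (map h (t # u))) \<otimes> word_prod G l (t # u)
    = word_prod G l (rev (map h u)) \<otimes> (inv l t \<otimes> (l t \<otimes> word_prod G l u))"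
    using Cons.prems c word_prod_append[OF c(1), of "[h t]"] by (simp add: m_assoc)
  also have "\<dots> = word_prod G l (rev (map h u)) \<otimes> word_prod G l u"
    using Cons.prems c by (simp flip: m_assoc)
  finally show ?case using Cons by simp
qed simp

end

text \<open>Recursion along the word keeps the walk itself and not merely the component of its end;
  walks are later cut at their first crossing and translated.\<close>

primrec avoids :: "('a, 'm) monoid_scheme \<Rightarrow> 'a set set \<Rightarrow> 'a \<Rightarrow> 'a list \<Rightarrow> bool" where
  "avoids G C g [] = True"
| "avoids G C g (t # u) = ({g, g \<otimes>\<^bsub>G\<^esub> t} \<notin> C \<and> avoids G C (g \<otimes>\<^bsub>G\<^esub> t) u)"

text \<open>Each vertex has exactly one edge for each label in the symmetric set \<open>T\<close>,
  so \<open>card T = 3\<close> expresses cubicity.\<close>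

locale cubic_cayley = group G for G (structure) +
  fixes T :: "'a set"
  assumes T_carrier: "T \<subseteq> carrier G" and one_notin_T: "\<one> \<notin> T"
    and inv_T: "t \<in> T \<Longrightarrow> inv t \<in> T" and card_T: "card T = 3"
    and graph: "bridgeless_graph (carrier G) (cayley_edges G T)"

sublocale cubic_cayley \<subseteq> bridgeless_graph "carrier G" "cayley_edges G T"
  by (rule graph)

context cubic_cayley
begin

notation cut_equiv (infix "\<approx>" 50)

abbreviation Ed where "Ed \<equiv> cayley_edges G T"
abbreviation ed :: "'a \<Rightarrow> 'a \<Rightarrow> 'a set" where "ed g t \<equiv> {g, g \<otimes> t}"
abbreviation pr :: "'a list \<Rightarrow> 'a" where "pr \<equiv> word_prod G (\<lambda>t. t)"
abbreviation av where "av \<equiv> avoids G"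

lemma T_in [simp, intro]: "t \<in> T \<Longrightarrow> t \<in> carrier G"
  using T_carrier by blast

lemma mult_T_ne: assumes "g \<in> carrier G" "t \<in> T" shows "g \<otimes> t \<noteq> g"
  using assms one_notin_T by auto

lemma ed_edge [simp]: "g \<in> carrier G \<Longrightarrow> t \<in> T \<Longrightarrow> ed g t \<in> Ed"
  unfolding cayley_edges_def using mult_T_ne by blast

lemma ed_inv: "g \<in> carrier G \<Longrightarrow> t \<in> T \<Longrightarrow> ed (g \<otimes> t) (inv t) = ed g t"
  by (simp add: m_assoc insert_commute)

lemma edgeD: assumes "{x, y} \<in> Ed" shows "x \<in> carrier G" "y \<in> carrier G" "\<exists>t\<in>T. y = x \<otimes> t"
proof -
  obtain g t where gt: "{x, y} = {g, g \<otimes> t}" "g \<in> carrier G" "t \<in> T"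
    using assms by (auto simp: cayley_edges_def)
  then have "x = g \<and> y = g \<otimes> t \<or> x = g \<otimes> t \<and> y = g" by (auto simp: doubleton_eq_iff)
  moreover have "g = (g \<otimes> t) \<otimes> inv t" using gt by (simp add: m_assoc)
  ultimately show "x \<in> carrier G" "y \<in> carrier G" "\<exists>t\<in>T. y = x \<otimes> t"
    using gt inv_T[of t] by auto
qed

lemma translate_edge: "g \<in> carrier G \<Longrightarrow> {x, y} \<in> Ed \<Longrightarrow> {g \<otimes> x, g \<otimes> y} \<in> Ed"
  using edgeD[of x y] by (force simp: m_assoc[symmetric])

lemma edge_carrier: "e \<in> Ed \<Longrightarrow> e \<subseteq> carrier G"
  using edge[of e] by auto

lemma translate_inj:
  assumes "g \<in> carrier G" "e \<subseteq> carrier G" "f \<subseteq> carrier G" "(\<otimes>) g ` e = (\<otimes>) g ` f"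
  shows "e = f"
  using inj_on_image_eq_iff[OF inj_on_cmult[OF assms(1)] assms(2,3)] assms(4) by simp

text \<open>Left multiplication is an automorphism of the Cayley graph. The translated cut is
  written as a preimage under multiplication by \<open>inv g\<close>, so that nothing has to be
  known about members of \<open>A\<close> outside the carrier.\<close>

lemma cut_equiv_translate:
  assumes g: "g \<in> carrier G" and ef: "e \<approx> f"
  shows "(\<otimes>) g ` e \<approx> (\<otimes>) g ` f"
proof -
  have E: "e \<in> Ed" "f \<in> Ed" using ef by (auto simp: cut_equiv_def)
  have tE: "(\<otimes>) g ` e \<in> Ed" if "e \<in> Ed" for e
    using edge[OF that] translate_edge[OF g] that by auto
  show ?thesis
  proof (cases "e = f")
    case True then show ?thesis using tE[OF E(1)] by (simp add: cut_equiv_def)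
  next
    case False
    then obtain A where A: "\<delta> A = {e, f}" using ef by (auto simp: cut_equiv_def)
    have "\<delta> {v. inv g \<otimes> v \<in> A} = {(\<otimes>) g ` e, (\<otimes>) g ` f}"
    proof (rule boundary_eqI)
      fix x y assume xy: "{x, y} \<in> Ed" "x \<noteq> y"
      then have c: "x \<in> carrier G" "y \<in> carrier G" using edgeD by auto
      let ?d = "{inv g \<otimes> x, inv g \<otimes> y}"
      have d: "?d \<in> Ed" using translate_edge[OF inv_closed[OF g] xy(1)] .
      have gd: "(\<otimes>) g ` ?d = {x, y}" using g c by (simp add: m_assoc[symmetric])
      have eq: "?d = h \<longleftrightarrow> {x, y} = (\<otimes>) g ` h" if "h \<in> Ed" for h
        using translate_inj[OF g edge_carrier[OF d] edge_carrier[OF that]] gd by auto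
      have "(x \<in> {v. inv g \<otimes> v \<in> A}) = (y \<notin> {v. inv g \<otimes> v \<in> A}) \<longleftrightarrow> ?d \<in> \<delta> A"
        using d by (simp add: boundary_edge)
      also have "\<dots> \<longleftrightarrow> {x, y} \<in> {(\<otimes>) g ` e, (\<otimes>) g ` f}"
        using eq[OF E(1)] eq[OF E(2)] by (simp add: A)
      finally show "(x \<in> {v. inv g \<otimes> v \<in> A}) = (y \<notin> {v. inv g \<otimes> v \<in> A}) \<longleftrightarrow>
        {x, y} \<in> {(\<otimes>) g ` e, (\<otimes>) g ` f}" .
    qed (use tE E in simp)
    then show ?thesis by (rule cut_equivI)
  qed
qed

lemma cut_equiv_ed_translate:
  assumes "g \<in> carrier G" "x \<in> carrier G" "y \<in> carrier G" "s \<in> T" "t \<in> T"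
  shows "ed (g \<otimes> x) s \<approx> ed (g \<otimes> y) t \<longleftrightarrow> ed x s \<approx> ed y t"
proof
  assume "ed (g \<otimes> x) s \<approx> ed (g \<otimes> y) t"
  from cut_equiv_translate[OF inv_closed[OF assms(1)] this]
  show "ed x s \<approx> ed y t" using assms by (simp add: m_assoc[symmetric])
next
  assume "ed x s \<approx> ed y t"
  from cut_equiv_translate[OF assms(1) this]
  show "ed (g \<otimes> x) s \<approx> ed (g \<otimes> y) t" using assms by (simp add: m_assoc)
qed

text \<open>By translation it is enough to look at the edges at \<open>\<one>\<close>: whether an
  edge lies in a cut depends on its label alone.\<close>

definition cut_label :: "'a \<Rightarrow> bool" where
  "cut_label s \<longleftrightarrow> s \<in> T \<and> in_cut (ed \<one> s)"

lemma cut_labelD [simp]: "cut_label s \<Longrightarrow> s \<in> T" unfolding cut_label_def by blast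

lemma in_cut_translate: assumes "g \<in> carrier G" "in_cut e" shows "in_cut ((\<otimes>) g ` e)"
proof -
  obtain f where f: "f \<noteq> e" "e \<approx> f" using assms(2) by (auto simp: in_cut_def)
  then have "e \<in> Ed" "f \<in> Ed" by (auto simp: cut_equiv_def)
  then have "(\<otimes>) g ` f \<noteq> (\<otimes>) g ` e"
    using translate_inj[OF assms(1), of f e] edge_carrier f(1) by blast
  then show ?thesis using cut_equiv_translate[OF assms(1) f(2)] unfolding in_cut_def by (intro exI conjI)
qed

lemma in_cut_ed: assumes g: "g \<in> carrier G" "s \<in> T" shows "in_cut (ed g s) \<longleftrightarrow> cut_label s"
proof
  assume "in_cut (ed g s)"
  from in_cut_translate[OF inv_closed[OF g(1)] this]
  have "in_cut (ed \<one> s)" using g by (simp add: m_assoc[symmetric])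
  then show "cut_label s" using g(2) unfolding cut_label_def by blast
next
  assume "cut_label s"
  then have "in_cut ((\<otimes>) g ` ed \<one> s)" by (intro in_cut_translate g(1)) (unfold cut_label_def, blast)
  then show "in_cut (ed g s)" using g by simp
qed

lemma cut_label_inv: assumes "cut_label s" shows "cut_label (inv s)"
proof -
  have "ed s (inv s) = ed \<one> s" using ed_inv[of \<one> s] assms by simp
  then show ?thesis using in_cut_ed[of s "inv s"] in_cut_ed[of \<one> s] assms inv_T by auto
qed

lemma left_cancel [simp]:
  "g \<in> carrier G \<Longrightarrow> x \<in> carrier G \<Longrightarrow> y \<in> carrier G \<Longrightarrow> g \<otimes> x = g \<otimes> y \<longleftrightarrow> x = y"
  using Units_l_cancel[of g x y] by simp

lemma ed_inj: "g \<in> carrier G \<Longrightarrow> s \<in> T \<Longrightarrow> t \<in> T \<Longrightarrow> ed g s = ed g t \<Longrightarrow> s = t"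
  by (auto simp: doubleton_eq_iff)

lemma boundary_singleton: assumes "g \<in> carrier G" shows "\<delta> {g} = ed g ` T"
proof (rule boundary_eqI)
  fix x y assume xy: "{x, y} \<in> Ed" "x \<noteq> y"
  have yx: "{y, x} \<in> Ed" using xy(1) by (simp add: insert_commute)
  show "(x \<in> {g}) = (y \<notin> {g}) \<longleftrightarrow> {x, y} \<in> ed g ` T"
  proof
    assume "(x \<in> {g}) = (y \<notin> {g})"
    then consider "x = g" | "y = g" by auto
    then show "{x, y} \<in> ed g ` T"
      using edgeD(3)[OF xy(1)] edgeD(3)[OF yx] by cases (auto simp: insert_commute)
  next
    assume "{x, y} \<in> ed g ` T"
    then show "(x \<in> {g}) = (y \<notin> {g})" using xy(2) by (auto simp: doubleton_eq_iff)
  qed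
qed (use assms in auto)

text \<open>Adding the star of \<open>g\<close> to a cut formed by two of its three edges leaves the
  third edge as the whole boundary of a set, that is, as a bridge.\<close>

lemma adjacent_not_equiv:
  assumes g: "g \<in> carrier G" and st: "s \<in> T" "t \<in> T" "s \<noteq> t"
  shows "\<not> ed g s \<approx> ed g t"
proof
  assume "ed g s \<approx> ed g t"
  then obtain A where A: "\<delta> A = {ed g s, ed g t}"
    using ed_inj[OF g st(1,2)] st(3) by (auto simp: cut_equiv_def)
  have "finite T" using card_T card.infinite by fastforce
  then have "card (T - {s, t}) = 1" using card_T st by (simp add: card_Diff_subset)
  then obtain r where r: "T - {s, t} = {r}" using card_1_singletonE by blast
  then have T: "T = {r, s, t}" "r \<noteq> s" "r \<noteq> t" using st by auto
  then have ne: "ed g r \<noteq> ed g s" "ed g r \<noteq> ed g t" using ed_inj[OF g, of r] by auto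
  have "\<delta> {g} = {ed g r, ed g s, ed g t}" using boundary_singleton[OF g] T(1) by simp
  then have "\<delta> (sym_diff A {g}) = {ed g r}"
    unfolding boundary_sym_diff A using ne by auto
  then show False using bridgeless by simp
qed

section \<open>Walks as words in the labels\<close>

lemma pr_closed [simp]: "set u \<subseteq> T \<Longrightarrow> pr u \<in> carrier G"
  by (intro word_prod_closed) auto

lemma pr_append [simp]: "set u \<subseteq> T \<Longrightarrow> set v \<subseteq> T \<Longrightarrow> pr (u @ v) = pr u \<otimes> pr v"
  by (intro word_prod_append) auto

lemma av_append:
  "g \<in> carrier G \<Longrightarrow> set u \<subseteq> T \<Longrightarrow> av C g (u @ v) \<longleftrightarrow> av C g u \<and> av C (g \<otimes> pr u) v"
  by (induction u arbitrary: g) (auto simp: m_assoc)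

lemma av_component:
  "g \<in> carrier G \<Longrightarrow> set u \<subseteq> T \<Longrightarrow> av C g u \<Longrightarrow> g \<otimes> pr u \<in> component (Ed - C) g"
proof (induction u arbitrary: g)
  case (Cons t u)
  then have "g \<otimes> t \<in> component (Ed - C) g" using component_step[OF component_self, of g "g \<otimes> t" "Ed - C"] by simp
  moreover have "(g \<otimes> t) \<otimes> pr u \<in> component (Ed - C) (g \<otimes> t)" using Cons by simp
  ultimately show ?case using Cons.prems component_trans[of "g \<otimes> t"] by (simp add: m_assoc)
qed simp

text \<open>The converse of \<open>av_component\<close>: the two lemmas translate between components
  after the deletion of edges and words read from a vertex.\<close>

lemma component_word:
  assumes "y \<in> component (Ed - C) x" "x \<in> carrier G"
  shows "\<exists>u. set u \<subseteq> T \<and> av C x u \<and> y = x \<otimes> pr u"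
proof -
  have "(x, y) \<in> {(u, v). {u, v} \<in> Ed - C}\<^sup>*" using assms(1) by (simp add: component_def)
  then show ?thesis
  proof (induction rule: rtrancl_induct)
    case base then show ?case using assms(2) by (intro exI[of _ "[]"]) auto
  next
    case (step y z)
    then obtain u where u: "set u \<subseteq> T" "av C x u" "y = x \<otimes> pr u" by blast
    obtain t where t: "t \<in> T" "z = y \<otimes> t" using edgeD(3)[of y z] step(2) by auto
    show ?case using u t step(2) assms(2)
      by (intro exI[of _ "u @ [t]"]) (auto simp: av_append m_assoc)
  qed
qed

lemma av_translate:
  assumes "g \<in> carrier G" "x \<in> carrier G" "s \<in> T"
  shows "y \<in> carrier G \<Longrightarrow> set u \<subseteq> T \<Longrightarrow>
    av (cut_class (ed (g \<otimes> x) s)) (g \<otimes> y) u \<longleftrightarrow> av (cut_class (ed x s)) y u"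
proof (induction u arbitrary: y)
  case (Cons t u)
  then have "t \<in> T" by simp
  then show ?case using Cons.IH[of "y \<otimes> t"] Cons.prems assms cut_equiv_ed_translate[OF assms(1,2) Cons.prems(1) assms(3), of t]
    by (simp add: m_assoc cut_class_def)
qed simp

lemma av_split:
  "\<not> av C g u \<Longrightarrow> g \<in> carrier G \<Longrightarrow> set u \<subseteq> T \<Longrightarrow>
   \<exists>u1 t u2. u = u1 @ t # u2 \<and> av C g u1 \<and> ed (g \<otimes> pr u1) t \<in> C"
proof (induction u arbitrary: g)
  case (Cons t u)
  show ?case
  proof (cases "ed g t \<in> C")
    case True then show ?thesis using Cons.prems by (intro exI[of _ "[]"]) auto
  next
    case False
    then obtain u1 t' u2 where "u = u1 @ t' # u2" "av C (g \<otimes> t) u1" "ed ((g \<otimes> t) \<otimes> pr u1) t' \<in> C"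
      using Cons.IH[of "g \<otimes> t"] Cons.prems by auto
    then show ?thesis using False Cons.prems
      by (intro exI[of _ "t # u1"] exI[of _ t'] exI[of _ u2]) (auto simp: m_assoc)
  qed
qed simp

section \<open>The two ends of a side\<close>

definition exit_spec :: "'a \<Rightarrow> 'a \<Rightarrow> 'a \<Rightarrow> bool" where
  "exit_spec s p q \<longleftrightarrow> p \<in> side (ed \<one> s) \<one> \<and> q \<in> T \<and> p \<otimes> q \<notin> side (ed \<one> s) \<one> \<and> ed p q \<noteq> ed \<one> s \<and>
     \<delta> (side (ed \<one> s) \<one>) = {ed \<one> s, ed p q}"

lemma side_carrier: assumes "x \<in> carrier G" "y \<in> component (Ed - C) x" shows "y \<in> carrier G"
  using component_word[OF assms(2,1)] assms(1) by auto

lemma exit_exists: assumes "cut_label s" shows "\<exists>p q. exit_spec s p q"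
proof -
  have c: "in_cut {\<one>, \<one> \<otimes> s}" using assms unfolding cut_label_def by blast
  obtain e' where e': "e' \<noteq> ed \<one> s" "\<delta> (side (ed \<one> s) \<one>) = {ed \<one> s, e'}" by (rule boundary_side[OF c])
  then have "e' \<in> \<delta> (side (ed \<one> s) \<one>)" by simp
  then obtain p y where py: "e' = {p, y}" "p \<in> side (ed \<one> s) \<one>" "y \<notin> side (ed \<one> s) \<one>" "e' \<in> Ed"
    by (rule boundaryE)
  then obtain q where "q \<in> T" "y = p \<otimes> q" using edgeD(3)[of p y] by auto
  then have "exit_spec s p q" using e' py by (simp add: exit_spec_def)
  then show ?thesis by blast
qed

text \<open>Walking from \<open>\<one>\<close> inside its side of the class of the edge \<open>s\<close>, the only other edge of that
  class is reached at \<open>exit_at s\<close>, where it has label \<open>exit_label s\<close>.\<close>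

definition exit_at :: "'a \<Rightarrow> 'a" where
  "exit_at s = (SOME p. \<exists>q. exit_spec s p q)"

definition exit_label :: "'a \<Rightarrow> 'a" where
  "exit_label s = (SOME q. exit_spec s (exit_at s) q)"

lemma exit_spec: "cut_label s \<Longrightarrow> exit_spec s (exit_at s) (exit_label s)"
  unfolding exit_label_def exit_at_def by (metis (mono_tags, lifting) exit_exists someI_ex)

lemma exit_at_closed [simp]: "cut_label s \<Longrightarrow> exit_at s \<in> carrier G"
  using exit_spec[of s] side_carrier[of \<one> "exit_at s"] unfolding exit_spec_def by blast

lemma exit_label_in [simp]: "cut_label s \<Longrightarrow> exit_label s \<in> T"
  using exit_spec[of s] by (simp add: exit_spec_def)

lemma exit_equiv: assumes "cut_label s" shows "ed \<one> s \<approx> ed (exit_at s) (exit_label s)"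
  using exit_spec[OF assms] cut_equivI unfolding exit_spec_def by blast

lemma cut_label_exit: "cut_label s \<Longrightarrow> cut_label (exit_label s)"
  using in_cut_cong[OF exit_equiv] in_cut_ed[of "exit_at s" "exit_label s"] in_cut_ed[of \<one> s] by simp

text \<open>Otherwise the two edges that leave the side would be distinct edges of one class at the
  vertex \<open>\<one>\<close>.\<close>

lemma exit_at_ne_one: assumes "cut_label s" shows "exit_at s \<noteq> \<one>"
proof
  assume 1: "exit_at s = \<one>"
  have "ed \<one> s \<approx> ed \<one> (exit_label s)" using exit_equiv[OF assms] unfolding 1 .
  then have "s = exit_label s" using adjacent_not_equiv[of \<one> s "exit_label s"] assms by auto
  then show False using exit_spec[OF assms] 1 by (simp add: exit_spec_def)
qed

lemma exit_word:
  assumes "cut_label s"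
  shows "\<exists>u. set u \<subseteq> T \<and> av (cut_class (ed \<one> s)) \<one> u \<and> pr u = exit_at s"
proof -
  have "exit_at s \<in> side (ed \<one> s) \<one>" using exit_spec[OF assms] by (simp add: exit_spec_def)
  from component_word[OF this] show ?thesis by auto
qed

text \<open>After the deletion of the class each of its edges has its ends in different components.
  So an edge of the class that is met from inside the side of \<open>\<one>\<close> leaves this
  side, and the side has only two boundary edges.\<close>

lemma return_one:
  assumes s: "cut_label s" and u: "set u \<subseteq> T" "av (cut_class (ed \<one> s)) \<one> u"
    and t: "t \<in> T" "ed (pr u) t \<in> cut_class (ed \<one> s)"
  shows "pr u = \<one> \<and> t = s \<or> pr u = exit_at s \<and> t = exit_label s"
proof -
  let ?K = "side (ed \<one> s) \<one>" let ?v = "pr u"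
  have sT: "s \<in> T" using s by simp
  have v: "?v \<in> carrier G" "?v \<in> ?K" using u av_component[of \<one> u] by simp_all
  have eq: "ed \<one> s \<approx> ed ?v t" using t(2) by (simp add: cut_class_def)
  have "in_cut {?v, ?v \<otimes> t}" using in_cut_cong[OF eq] s in_cut_ed[of \<one> s] by simp
  from cut_class_separates[OF this] have "?v \<otimes> t \<notin> side (ed \<one> s) ?v" using cut_class_eq[OF eq] by simp
  then have vt: "?v \<otimes> t \<notin> ?K" using component_trans[OF component_sym[OF v(2)]] by metis
  then have "ed ?v t \<in> \<delta> ?K" using v t by (simp add: boundary_edge)
  then have "ed ?v t = ed \<one> s \<or> ed ?v t = ed (exit_at s) (exit_label s)"
    using exit_spec[OF s] by (simp add: exit_spec_def)
  then show ?thesis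
  proof
    assume e: "ed ?v t = ed \<one> s"
    then have "?v = \<one>" using vt component_self[of \<one> "Ed - cut_class (ed \<one> s)"] by (metis doubleton_eq_iff)
    then show ?thesis using ed_inj[of \<one> t s] e t sT by simp
  next
    assume e: "ed ?v t = ed (exit_at s) (exit_label s)"
    have "exit_at s \<in> ?K" using exit_spec[OF s] by (simp add: exit_spec_def)
    then have "?v = exit_at s" using e vt by (metis doubleton_eq_iff)
    then show ?thesis using ed_inj[of "exit_at s" t "exit_label s"] e t s by simp
  qed
qed

lemma return_general:
  assumes s: "cut_label s" and x: "x \<in> carrier G" and u: "set u \<subseteq> T" "av (cut_class (ed x s)) x u"
    and t: "t \<in> T" "ed (x \<otimes> pr u) t \<in> cut_class (ed x s)"
  shows "pr u = \<one> \<and> t = s \<or> pr u = exit_at s \<and> t = exit_label s"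
proof (rule return_one[OF s u(1) _ t(1)])
  show "av (cut_class (ed \<one> s)) \<one> u" using av_translate[OF x one_closed _ one_closed u(1), of s] u(2) x s by simp
  show "ed (pr u) t \<in> cut_class (ed \<one> s)"
    using cut_equiv_ed_translate[of x \<one> "pr u" s t] x s t u(1) by (simp add: cut_class_def)
qed

text \<open>Read the walk through the side backwards: seen from the exit, the edge at
  \<open>\<one>\<close> is the other edge of the class. The walk back is not trivial because
  \<open>exit_at s\<close> differs from \<open>\<one>\<close>.\<close>

lemma exit_exit:
  assumes s: "cut_label s"
  shows "exit_label (exit_label s) = s" "exit_at (exit_label s) = inv (exit_at s)"
proof -
  let ?p = "exit_at s" and ?q = "exit_label s" and ?C = "cut_class (ed \<one> s)"
  have C: "?C = cut_class (ed ?p ?q)" by (rule cut_class_eq[OF exit_equiv[OF s]])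
  have "?p \<in> side (ed \<one> s) \<one>" using exit_spec[OF s] unfolding exit_spec_def by blast
  from component_word[OF component_sym[OF this]] obtain u
    where u: "set u \<subseteq> T" "av ?C ?p u" "\<one> = ?p \<otimes> pr u"
    using exit_at_closed[OF s] by blast
  have "pr u = \<one> \<and> s = ?q \<or> pr u = exit_at ?q \<and> s = exit_label ?q"
  proof (rule return_general)
    show "cut_label ?q" "?p \<in> carrier G" "set u \<subseteq> T" "s \<in> T" using s u cut_label_exit by simp_all
    show "av (cut_class (ed ?p ?q)) ?p u" using u(2) unfolding C .
    have "ed \<one> s \<in> ?C" by (rule cut_class_self[OF ed_edge[OF one_closed cut_labelD[OF s]]])
    then show "ed (?p \<otimes> pr u) s \<in> cut_class (ed ?p ?q)" unfolding u(3)[symmetric] C .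
  qed
  moreover have "pr u \<noteq> \<one>" using u(3) exit_at_ne_one[OF s] exit_at_closed[OF s] by (metis r_one)
  ultimately have *: "pr u = exit_at ?q" "s = exit_label ?q" by auto
  then show "exit_label ?q = s" by simp
  show "exit_at ?q = inv ?p"
    using inv_equality[OF inv_comm[OF u(3)[symmetric]]] u(1) s *(1) cut_label_exit[OF s] by simp
qed

text \<open>All powers of \<open>z\<close> carry the edge \<open>s\<close> into its own class. The
  class is finite and covers finitely many vertices, so two powers coincide. This is the source of
  the positive exponents in the presentations.\<close>

lemma finite_order:
  assumes z: "z \<in> carrier G" and s: "s \<in> T" and eq: "ed z s \<approx> ed \<one> s"
  shows "\<exists>n>0. z [^] (n::nat) = \<one>"
proof -
  have pow: "ed (z [^] (j::nat)) s \<approx> ed \<one> s" for j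
  proof (induction j)
    case 0
    have "ed \<one> s \<in> Ed" by (rule ed_edge[OF one_closed s])
    then show ?case by (simp add: cut_equiv_def)
  next
    case (Suc j)
    have "ed (z [^] j \<otimes> z) s \<approx> ed (z [^] j \<otimes> \<one>) s"
      using cut_equiv_ed_translate[of "z [^] j" z \<one> s s] z s eq by simp
    then show ?case using Suc.IH z by (auto intro: cut_equiv_trans)
  qed
  let ?C = "cut_class (ed \<one> s)"
  have "finite (\<Union> ?C)"
  proof (rule finite_Union)
    show "finite ?C" by (rule finite_cut_class[OF ed_edge[OF one_closed s]])
    show "finite e" if "e \<in> ?C" for e using edge[of e] that cut_class_subset by auto
  qed
  moreover have "range (\<lambda>j::nat. z [^] j) \<subseteq> \<Union> ?C"
  proof
    fix x assume "x \<in> range (\<lambda>j::nat. z [^] j)"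
    then obtain j :: nat where x: "x = z [^] j" by auto
    have "ed (z [^] j) s \<in> ?C" using cut_equiv_sym[OF pow[of j]] by (simp add: cut_class_def)
    then show "x \<in> \<Union> ?C" unfolding x by blast
  qed
  ultimately have "finite (range (\<lambda>j::nat. z [^] j))" by (rule rev_finite_subset)
  then have "\<not> inj (\<lambda>j::nat. z [^] j)" using finite_imageD infinite_UNIV_nat by blast
  then obtain i j :: nat where ij: "z [^] i = z [^] j" "i < j"
    by (auto simp: inj_def) (metis linorder_neqE_nat)
  have "z [^] j = z [^] i \<otimes> z [^] (j - i)" using ij(2) z by (simp add: nat_pow_mult)
  then have "z [^] (j - i) = \<one>" using ij(1) z by simp
  then show ?thesis using ij(2) by (intro exI[of _ "j - i"]) simp
qed

text \<open>At its far end the edge \<open>s\<close> carries the label \<open>inv s\<close>. The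
  side beyond it is therefore a translate of the side of \<open>inv s\<close>, and the class is met
  again with the exit label of \<open>inv s\<close>.\<close>

abbreviation next_label :: "'a \<Rightarrow> 'a" where "next_label s \<equiv> exit_label (inv s)"

lemma cut_label_next: "cut_label s \<Longrightarrow> cut_label (next_label s)"
  by (intro cut_label_exit cut_label_inv)

lemma cut_label_next_funpow: "cut_label s \<Longrightarrow> cut_label ((next_label ^^ k) s)"
  by (induction k) (auto intro: cut_label_next)

lemma next_edge:
  assumes "cut_label s"
  shows "ed (s \<otimes> exit_at (inv s)) (next_label s) \<approx> ed \<one> s"
proof -
  have i: "cut_label (inv s)" by (rule cut_label_inv[OF assms])
  have "ed (s \<otimes> \<one>) (inv s) \<approx> ed (s \<otimes> exit_at (inv s)) (next_label s)"
    using cut_equiv_ed_translate[of s \<one> "exit_at (inv s)" "inv s" "next_label s"]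
      exit_equiv[OF i] i assms cut_label_exit[OF i] by simp
  moreover have "ed (s \<otimes> \<one>) (inv s) = ed \<one> s" using ed_inv[of \<one> s] assms by simp
  ultimately show ?thesis using cut_equiv_sym by metis
qed

text \<open>A shortest word that leads to some \<open>exit_at s\<close> inside the side of \<open>s\<close> crosses no cut
  edge: a crossing would have to return through the same class, and the part in between would
  either be removable or be a shorter word of the same kind.\<close>

lemma exit_noncut:
  assumes s0: "cut_label s0"
  shows "\<exists>s u. cut_label s \<and> set u \<subseteq> T \<and> (\<forall>t\<in>set u. \<not> cut_label t) \<and> pr u = exit_at s"
proof -
  \<comment> \<open>The length is minimised over all cut labels at once, so that a subword belonging
    to another label can contradict minimality.\<close>
  define W where "W = (\<lambda>(s, u). cut_label s \<and> set u \<subseteq> T \<and> av (cut_class (ed \<one> s)) \<one> u \<and> pr u = exit_at s)"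
  have "\<exists>x. W x" using exit_word[OF s0] s0 unfolding W_def by blast
  then obtain x where "W x" and min: "\<And>y. W y \<Longrightarrow> length (snd x) \<le> length (snd y)"
    using ex_has_least_nat[of W _ "\<lambda>x. length (snd x)"] by blast
  obtain s u where x: "x = (s, u)" by (cases x)
  have s: "cut_label s" and u: "set u \<subseteq> T" "av (cut_class (ed \<one> s)) \<one> u" "pr u = exit_at s"
    using \<open>W x\<close> unfolding W_def x prod.case by blast+
  have min: "length u \<le> length v"
    if "cut_label r" "set v \<subseteq> T" "av (cut_class (ed \<one> r)) \<one> v" "pr v = exit_at r" for r v
    using min[of "(r, v)"] that unfolding W_def x prod.case snd_conv by blast
  have "\<forall>t\<in>set u. \<not> cut_label t"
  proof (rule ccontr)
    assume "\<not> ?thesis"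
    then obtain u0 r u' where split: "u = u0 @ r # u'" "cut_label r" "\<forall>t\<in>set u0. \<not> cut_label t"
      using split_list_first_prop[of u cut_label] by blast
    have T: "set u0 \<subseteq> T" "r \<in> T" "set u' \<subseteq> T" using u(1) split(1) by auto
    define v where "v = pr u0"
    let ?C = "cut_class (ed v r)" and ?D = "cut_class (ed \<one> s)"
    let ?K = "side (ed v r) v"
    have v: "v \<in> carrier G" using T by (simp add: v_def)
    have y: "v \<otimes> r \<in> carrier G" using v T by simp
    have avu: "av ?D \<one> u0" "ed v r \<notin> ?D" "av ?D (v \<otimes> r) u'"
      using u(2) T unfolding split(1) v_def by (simp_all add: av_append)
    have cutvr: "in_cut {v, v \<otimes> r}" using in_cut_ed[OF v T(2)] split(2) by simp
    have nc: "av ?C \<one> u0"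
    proof -
      have "av ?C g w" if "g \<in> carrier G" "set w \<subseteq> T" "\<forall>t\<in>set w. \<not> cut_label t" for g w
        using that
      proof (induction w arbitrary: g)
        case (Cons t w)
        have "\<not> in_cut (ed g t)" using in_cut_ed[of g t] Cons.prems by simp
        then have "\<not> ed v r \<approx> ed g t" using in_cut_cong[of "ed v r" "ed g t"] cutvr by blast
        then show ?case using Cons by (simp add: cut_class_def)
      qed simp
      then show ?thesis using T split(3) by blast
    qed
    have one: "\<one> \<in> ?K"
      using component_sym[OF av_component[OF one_closed T(1) nc]] T(1) by (simp add: v_def)
    obtain e' where e': "e' \<noteq> ed v r" "\<delta> ?K = {ed v r, e'}" by (rule boundary_side[OF cutvr])
    have vre: "ed v r \<approx> e'" using cut_equivI[OF e'(2)] .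
    have nD: "\<not> ed \<one> s \<approx> ed v r" using avu(2) by (simp add: cut_class_def)
    then have nD': "\<not> ed \<one> s \<approx> e'" using vre cut_equiv_sym cut_equiv_trans by metis
    \<comment> \<open>No cut of another class separates \<open>\<one>\<close> from
      \<open>exit_at s\<close>, the inner ends of the two edges that leave the side of
      \<open>s\<close>. Hence both lie in \<open>?K\<close>; the letter \<open>r\<close> has left
      \<open>?K\<close>, so the rest of the word must come back.\<close>
    have pK: "exit_at s \<in> ?K"
    proof -
      have sp: "exit_spec s (exit_at s) (exit_label s)" by (rule exit_spec[OF s])
      have "\<one> \<in> ?K \<longleftrightarrow> exit_at s \<in> ?K"
      proof (rule ends_same_side[OF _ HOL.refl _ HOL.refl _ e'(2) nD nD'])
        show "\<delta> (side (ed \<one> s) \<one>) = {ed \<one> s, ed (exit_at s) (exit_label s)}"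
          "exit_at s \<in> side (ed \<one> s) \<one>" "ed \<one> s \<noteq> ed (exit_at s) (exit_label s)"
          using sp unfolding exit_spec_def by metis+
      qed simp
      then show ?thesis using one by simp
    qed
    have yK: "v \<otimes> r \<notin> ?K" by (rule cut_class_separates[OF cutvr])
    have end_u: "(v \<otimes> r) \<otimes> pr u' = exit_at s"
      using u(3) T unfolding split(1) by (simp add: v_def m_assoc)
    have "\<not> av ?C (v \<otimes> r) u'"
    proof
      assume "av ?C (v \<otimes> r) u'"
      from av_component[OF y T(3) this] have "exit_at s \<in> component (Ed - ?C) (v \<otimes> r)" using end_u by simp
      then have "exit_at s \<in> ?K \<longleftrightarrow> v \<otimes> r \<in> ?K" by (rule component_same_side) (rule boundary_component)
      then show False using pK yK by simp
    qed
    from av_split[OF this y T(3)] obtain u1 t u2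
      where u': "u' = u1 @ t # u2" "av ?C (v \<otimes> r) u1" "ed ((v \<otimes> r) \<otimes> pr u1) t \<in> ?C" by blast
    have T': "set u1 \<subseteq> T" "t \<in> T" "set u2 \<subseteq> T" using T(3) u'(1) by auto
    have r': "cut_label (inv r)" using cut_label_inv[OF split(2)] .
    have C': "cut_class (ed (v \<otimes> r) (inv r)) = ?C" using ed_inv[OF v T(2)] by simp
    have "pr u1 = \<one> \<and> t = inv r \<or> pr u1 = exit_at (inv r) \<and> t = exit_label (inv r)"
      using return_general[OF r' y T'(1) _ T'(2)] u'(2,3) unfolding C' by blast
    then show False
    proof
      assume *: "pr u1 = \<one> \<and> t = inv r"
      have "av ?D ((v \<otimes> r) \<otimes> pr u1 \<otimes> t) u2" using avu(3) T' y unfolding u'(1) by (simp add: av_append)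
      then have "av ?D v u2" using * v T(2) by (simp add: m_assoc)
      then have "av ?D \<one> (u0 @ u2)" using avu(1) T by (simp add: av_append v_def)
      moreover have "pr (u0 @ u2) = exit_at s"
        using u(3) T T' * unfolding split(1) u'(1) by (simp add: m_assoc[symmetric])
      ultimately have "length u \<le> length (u0 @ u2)" using T T' by (intro min[OF s]) auto
      then show False unfolding split(1) u'(1) by simp
    next
      assume *: "pr u1 = exit_at (inv r) \<and> t = exit_label (inv r)"
      have "av (cut_class (ed ((v \<otimes> r) \<otimes> \<one>) (inv r))) ((v \<otimes> r) \<otimes> \<one>) u1" using u'(2) C' y by simp
      then have "av (cut_class (ed \<one> (inv r))) \<one> u1"
        using av_translate[OF y one_closed _ one_closed T'(1)] inv_T[OF T(2)] by blast
      then have "length u \<le> length u1" using * T' by (intro min[OF r']) auto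
      then show False unfolding split(1) u'(1) by simp
    qed
  qed
  then show ?thesis using s u by blast
qed

text \<open>Add the stars of \<open>\<one>\<close> and of \<open>b\<close> to the given cut. The
  stars share the edge between \<open>\<one>\<close> and \<open>b\<close>, which cancels, and the
  two edges of the cut cancel as well. What remains is one edge at \<open>\<one>\<close> and one at
  \<open>b\<close>, with the complementary labels.\<close>

lemma doubled_label:
  assumes T: "T = {b, s, s'}" "b \<noteq> s" "b \<noteq> s'" "s \<noteq> s'" and b: "b \<otimes> b = \<one>"
    and eq: "ed \<one> s \<approx> ed b q" and q: "q = s \<and> q' = s' \<or> q = s' \<and> q' = s"
  shows "ed \<one> s' \<approx> ed b q'"
proof -
  have c: "b \<in> carrier G" "s \<in> carrier G" "s' \<in> carrier G" "b \<noteq> \<one>" using T one_notin_T by auto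
  have one: "\<one> \<notin> ed b r" if "r \<in> {s, s'}" for r
    using that T c b by (metis insertE left_cancel empty_iff)
  have ne: "ed b r \<noteq> ed \<one> r'" if "r \<in> {s, s'}" for r r' using one[OF that] by blast
  have T3: "b \<in> T" "s \<in> T" "s' \<in> T" using T by auto
  have ne1: "ed \<one> b \<noteq> ed \<one> s" "ed \<one> b \<noteq> ed \<one> s'" "ed \<one> s \<noteq> ed \<one> s'"
    using ed_inj[OF one_closed] T3 T(2-4) by metis+
  have ne2: "ed b b \<noteq> ed b s" "ed b b \<noteq> ed b s'" "ed b s \<noteq> ed b s'"
    using ed_inj[OF c(1)] T3 T(2-4) by metis+
  have bb: "ed b b = ed \<one> b" using b c by (simp add: insert_commute)
  have "q \<in> {s, s'}" using q by auto
  then have "ed \<one> s \<noteq> ed b q" using ne[of q s] by metis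
  then obtain A where A: "\<delta> A = {ed \<one> s, ed b q}" using eq by (auto simp: cut_equiv_def)
  have 1: "\<delta> {\<one>} = {ed \<one> b, ed \<one> s, ed \<one> s'}" "\<delta> {b} = {ed \<one> b, ed b s, ed b s'}"
  proof -
    have *: "ed g ` T = {ed g b, ed g s, ed g s'}" for g
      unfolding T(1) by (simp only: image_insert image_empty)
    show "\<delta> {\<one>} = {ed \<one> b, ed \<one> s, ed \<one> s'}"
      unfolding boundary_singleton[OF one_closed] by (rule *)
    show "\<delta> {b} = {ed \<one> b, ed b s, ed b s'}"
      unfolding boundary_singleton[OF c(1)] using *[of b] unfolding bb .
  qed
  have n: "ed b s \<noteq> ed \<one> b" "ed b s \<noteq> ed \<one> s" "ed b s \<noteq> ed \<one> s'"
    "ed b s' \<noteq> ed \<one> b" "ed b s' \<noteq> ed \<one> s" "ed b s' \<noteq> ed \<one> s'" by (rule ne, simp)+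
  have gen: "sym_diff {e1, x} (sym_diff {e0, e1, e2} {e0, f1, f2}) = {e2, y}"
    if "e0 \<noteq> e1" "e0 \<noteq> e2" "e1 \<noteq> e2" "f1 \<noteq> e0" "f1 \<noteq> e1" "f1 \<noteq> e2" "f2 \<noteq> e0" "f2 \<noteq> e1" "f2 \<noteq> e2" "f1 \<noteq> f2"
      "x = f1 \<and> y = f2 \<or> x = f2 \<and> y = f1" for e0 e1 e2 f1 f2 x y :: "'a set"
    using that by (elim disjE) (simp_all add: insert_Diff_if insert_commute)
  have "\<delta> (sym_diff A (sym_diff {\<one>} {b})) = {ed \<one> s', ed b q'}"
    unfolding boundary_sym_diff A 1 by (rule gen[OF ne1 n ne2(3)]) (use q in metis)
  then show ?thesis by (rule cut_equivI)
qed

section \<open>Round trips along an edge class and closed words\<close>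

text \<open>This reads \<open>k\<close> steps along the class of \<open>s\<close>: a step crosses
  the current edge and passes through the side beyond it by the word that \<open>P\<close>
  chooses.\<close>

primrec round_trip :: "('a \<Rightarrow> 'a list) \<Rightarrow> nat \<Rightarrow> 'a \<Rightarrow> 'a list" where
  "round_trip P 0 s = []"
| "round_trip P (Suc k) s = s # P (inv s) @ round_trip P k (next_label s)"

text \<open>The recursion peels off the first step, but in the reduction of a closed word the trip
  grows at its end.\<close>

lemma round_trip_Suc:
  "round_trip P (Suc k) s = round_trip P k s @ (next_label ^^ k) s # P (inv ((next_label ^^ k) s))"
proof (induction k arbitrary: s)
  case (Suc k)
  have "(next_label ^^ k) (next_label s) = next_label ((next_label ^^ k) s)"
    using funpow_swap1[of next_label k s] by simp
  then show ?case by (subst round_trip.simps, subst Suc.IH) simp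
qed simp

definition noncut_words :: "('a \<Rightarrow> 'a list) \<Rightarrow> bool" where
  "noncut_words P \<longleftrightarrow> (\<forall>s. cut_label s \<longrightarrow>
     set (P s) \<subseteq> T \<and> (\<forall>t\<in>set (P s). \<not> cut_label t) \<and> pr (P s) = exit_at s)"

lemma noncut_wordsD:
  assumes "noncut_words P" "cut_label s"
  shows "set (P s) \<subseteq> T" "\<And>t. t \<in> set (P s) \<Longrightarrow> \<not> cut_label t" "pr (P s) = exit_at s"
  using assms by (auto simp: noncut_words_def)

lemma round_trip_T: "noncut_words P \<Longrightarrow> cut_label s \<Longrightarrow> set (round_trip P k s) \<subseteq> T"
proof (induction k arbitrary: s)
  case (Suc k)
  have "set (P (inv s)) \<subseteq> T" by (rule noncut_wordsD(1)[OF Suc.prems(1) cut_label_inv[OF Suc.prems(2)]])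
  then show ?case using Suc cut_label_next by simp
qed simp

text \<open>Cut letters measure the progress in the reduction of closed words, and a round trip
  spends exactly one of them per step.\<close>

lemma round_trip_cuts:
  "noncut_words P \<Longrightarrow> cut_label s \<Longrightarrow> length (filter cut_label (round_trip P k s)) = k"
proof (induction k arbitrary: s)
  case (Suc k)
  have "filter cut_label (P (inv s)) = []"
    using noncut_wordsD(2)[OF Suc.prems(1) cut_label_inv[OF Suc.prems(2)]] by (simp add: filter_empty_conv)
  then show ?case using Suc cut_label_next by simp
qed simp

lemma round_trip_edge:
  assumes P: "noncut_words P" and s: "cut_label s"
  shows "ed (pr (round_trip P k s)) ((next_label ^^ k) s) \<approx> ed \<one> s"
proof (induction k)
  case 0
  then show ?case using ed_edge[of \<one> s] s by (simp add: cut_equiv_def)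
next
  case (Suc k)
  let ?r = "(next_label ^^ k) s" and ?g = "pr (round_trip P k s)"
  have r: "cut_label ?r" "cut_label (inv ?r)" using cut_label_next_funpow[OF s] cut_label_inv by blast+
  have g: "?g \<in> carrier G" using round_trip_T[OF P s] by simp
  note Pr = noncut_wordsD[OF P r(2)]
  have "ed (?g \<otimes> (?r \<otimes> exit_at (inv ?r))) (next_label ?r) \<approx> ed (?g \<otimes> \<one>) ?r"
    using cut_equiv_ed_translate[OF g, of "?r \<otimes> exit_at (inv ?r)" \<one> "next_label ?r" ?r] next_edge[OF r(1)]
      r cut_label_next[OF r(1)] by simp
  moreover have "pr (round_trip P (Suc k) s) = ?g \<otimes> (?r \<otimes> exit_at (inv ?r))"
    unfolding round_trip_Suc using round_trip_T[OF P s] r Pr by simp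
  ultimately have "ed (pr (round_trip P (Suc k) s)) (next_label ?r) \<approx> ed ?g ?r" using g by simp
  then show ?case using Suc.IH by (simp add: cut_equiv_trans)
qed

text \<open>A closed word reduces to \<open>\<one>\<close> by induction on its number of cut letters. Starting from a cut
  letter, follow the visits to its edge class: between consecutive visits the word may be replaced
  by \<open>[]\<close> or \<open>P\<close>, so that the word either shortens or becomes a round trip.\<close>

theorem closed_word_trivial:
  fixes F :: "('f, 'n) monoid_scheme" and l :: "'a \<Rightarrow> 'f"
  assumes F: "group F" and lc: "\<And>t. t \<in> T \<Longrightarrow> l t \<in> carrier F"
    and linv: "\<And>t. t \<in> T \<Longrightarrow> l (inv t) = inv\<^bsub>F\<^esub> l t"
    and P: "noncut_words P"
    and nc: "\<And>u. set u \<subseteq> T \<Longrightarrow> \<forall>t\<in>set u. \<not> cut_label t \<Longrightarrow> pr u = \<one> \<Longrightarrow> word_prod F l u = \<one>\<^bsub>F\<^esub>"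
    and trips: "\<And>s k. cut_label s \<Longrightarrow> (next_label ^^ k) s = s \<Longrightarrow> pr (round_trip P k s) = \<one> \<Longrightarrow>
      word_prod F l (round_trip P k s) = \<one>\<^bsub>F\<^esub>"
  shows "set w \<subseteq> T \<Longrightarrow> pr w = \<one> \<Longrightarrow> word_prod F l w = \<one>\<^bsub>F\<^esub>"
proof -
  interpret F: group F by (rule F)
  let ?f = "word_prod F l" and ?c = "\<lambda>w. length (filter cut_label w)"
  have img: "l ` set u \<subseteq> carrier F" if "set u \<subseteq> T" for u using that lc by blast
  have fc [simp]: "?f u \<in> carrier F" if "set u \<subseteq> T" for u using img[OF that] by simp
  have fapp [simp]: "?f (u @ v) = ?f u \<otimes>\<^bsub>F\<^esub> ?f v" if "set u \<subseteq> T" "set v \<subseteq> T" for u v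
    using F.word_prod_append[OF img img] that by simp
  have finv: "?f (rev (map (\<lambda>t. inv t) u)) \<otimes>\<^bsub>F\<^esub> ?f u = \<one>\<^bsub>F\<^esub>" if "set u \<subseteq> T" for u
    using that lc linv by (intro F.word_prod_rev_map) (auto intro: inv_T)
  have pinv: "pr (rev (map (\<lambda>t. inv t) u)) \<otimes> pr u = \<one>" if "set u \<subseteq> T" for u
    using that by (intro word_prod_rev_map) (auto intro: inv_T)
  show "set w \<subseteq> T \<Longrightarrow> pr w = \<one> \<Longrightarrow> ?f w = \<one>\<^bsub>F\<^esub>"
  proof (induction "?c w" arbitrary: w rule: less_induct)
    case less
    have IH: "?f v = \<one>\<^bsub>F\<^esub>" if "?c v < ?c w" "set v \<subseteq> T" "pr v = \<one>" for v
      using less.hyps that by blast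
    \<comment> \<open>Prefixing the formal inverse of \<open>P r\<close> closes the word
      \<open>u\<close> and adds no cut letter, so the induction hypothesis identifies the values of
      \<open>u\<close> and \<open>P r\<close>.\<close>
    have IH2: "?f u = ?f (P r)" if "?c u < ?c w" "set u \<subseteq> T" "cut_label r" "pr u = exit_at r" for u r
    proof -
      note Pr = noncut_wordsD[OF P that(3)]
      let ?v = "rev (map (\<lambda>t. inv t) (P r))"
      have v: "set ?v \<subseteq> T" using Pr(1) inv_T by auto
      have "\<not> cut_label (inv t)" if "t \<in> set (P r)" for t
        using cut_label_inv[of "inv t"] Pr(2)[OF that] that Pr(1) by auto
      then have "filter cut_label ?v = []" by (auto simp: filter_empty_conv)
      moreover have "pr (?v @ u) = \<one>" using v that Pr pinv[OF Pr(1)] by simp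
      ultimately have "?f (?v @ u) = \<one>\<^bsub>F\<^esub>" using that v by (intro IH) auto
      then have 1: "?f ?v \<otimes>\<^bsub>F\<^esub> ?f u = \<one>\<^bsub>F\<^esub>" using v that(2) by simp
      have 2: "?f ?v \<otimes>\<^bsub>F\<^esub> ?f (P r) = \<one>\<^bsub>F\<^esub>" using finv[OF Pr(1)] .
      show ?thesis using F.inv_equality[OF 1] F.inv_equality[OF 2] v that(2) Pr(1) F.inv_inv by (metis fc)
    qed
    show ?case
    proof (cases "\<forall>t\<in>set w. \<not> cut_label t")
      case True then show ?thesis using nc less.prems by blast
    next
      case False
      then obtain w0 s w1 where w: "w = w0 @ s # w1" "cut_label s"
        using split_list_first_prop[of w cut_label] by blast
      have T: "set w0 \<subseteq> T" "s \<in> T" "set w1 \<subseteq> T" using less.prems w(1) by auto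
      \<comment> \<open>Invariant: what has been read so far is replaced by a round trip of
        \<open>k\<close> steps, and \<open>u\<close> is what remains after the next crossing. The
        bound says that the replacements have not raised the number of cut letters.\<close>
      have inner: "?f (round_trip P k s @ (next_label ^^ k) s # u) = \<one>\<^bsub>F\<^esub>"
        if "set u \<subseteq> T" "pr (round_trip P k s @ (next_label ^^ k) s # u) = \<one>" "k + 1 + ?c u \<le> ?c w" for k u
        using that
      proof (induction "length u" arbitrary: u k rule: less_induct)
        case (less u k)
        let ?R = "round_trip P k s" and ?C = "cut_class (ed \<one> s)"
        define r where "r = (next_label ^^ k) s"
        define g where "g = pr ?R"
        have r: "cut_label r" "cut_label (inv r)" "r \<in> T" "inv r \<in> T"
          unfolding r_def using cut_label_next_funpow[OF w(2)] cut_label_inv cut_labelD by blast+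
        have R: "set ?R \<subseteq> T" by (rule round_trip_T[OF P w(2)])
        have g: "g \<in> carrier G" "g \<otimes> r \<in> carrier G" using R r by (simp_all add: g_def)
        note Pr = noncut_wordsD[OF P r(2)]
        have "cut_class (ed g r) = ?C"
          unfolding g_def r_def by (rule cut_class_eq[OF round_trip_edge[OF P w(2)]])
        then have C: "cut_class (ed (g \<otimes> r) (inv r)) = ?C" using ed_inv[OF g(1) r(3)] by simp
        have closed: "g \<otimes> r \<otimes> pr u = \<one>"
          using less.prems(1,2) R r by (simp add: g_def r_def m_assoc)
        have lr: "l r \<in> carrier F" using lc r by blast
        show ?case
        proof (cases "av ?C (g \<otimes> r) u")
          case True
          \<comment> \<open>The rest of the word does not cross the class again, but it ends at
            \<open>\<one>\<close>, where the edge \<open>s\<close> of the class begins. So its end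
            counts as a visit to the class.\<close>
          have "ed \<one> s \<in> ?C" by (rule cut_class_self[OF ed_edge[OF one_closed T(2)]])
          then have "ed (g \<otimes> r \<otimes> pr u) s \<in> ?C" unfolding closed .
          then have "pr u = \<one> \<and> s = inv r \<or> pr u = exit_at (inv r) \<and> s = exit_label (inv r)"
            using return_general[OF r(2) g(2) less.prems(1) _ T(2)] True unfolding C by blast
          then show ?thesis
          proof
            \<comment> \<open>The last crossing was that of the first edge in the opposite
              direction. The trip is then \<open>s\<close> followed by a closed word
              \<open>?X\<close>, and the induction hypothesis applies to \<open>?X\<close> and to
              \<open>u\<close>.\<close>
            assume *: "pr u = \<one> \<and> s = inv r"
            then have gr: "g \<otimes> r = \<one>" using closed g by simp
            obtain j where j: "k = Suc j"
            proof (cases k)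
              case 0
              then have "r = \<one>" using gr r by (simp add: g_def)
              then show ?thesis using r one_notin_T by simp
            qed
            let ?X = "P (inv s) @ round_trip P j (next_label s)"
            have X: "set ?X \<subseteq> T" "?R = s # ?X" using R unfolding j by auto
            have "filter cut_label (P (inv s)) = []"
              using noncut_wordsD(2)[OF P cut_label_inv[OF w(2)]] by (simp add: filter_empty_conv)
            then have cX: "?c ?X = j" using round_trip_cuts[OF P cut_label_next[OF w(2)]] by simp
            have ri: "r = inv s" using * r by simp
            have "s \<otimes> pr ?X \<otimes> inv s = \<one>" using gr X(2) ri by (simp add: g_def)
            moreover have "s \<otimes> pr ?X = (s \<otimes> pr ?X \<otimes> inv s) \<otimes> s"
              using T(2) pr_closed[OF X(1)] by (simp only: m_assoc l_inv r_one T_in m_closed inv_closed)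
            ultimately have "s \<otimes> pr ?X = s" using T(2) by simp
            then have "pr ?X = \<one>" using T(2) pr_closed[OF X(1)] by (simp only: l_cancel_one T_in)
            then have "?f ?X = \<one>\<^bsub>F\<^esub>" using cX less.prems(3) j X(1) by (intro IH) auto
            moreover have "?f u = \<one>\<^bsub>F\<^esub>" using * less.prems by (intro IH) auto
            moreover have "?f (?R @ r # u) = l s \<otimes>\<^bsub>F\<^esub> ?f ?X \<otimes>\<^bsub>F\<^esub> (l r \<otimes>\<^bsub>F\<^esub> ?f u)"
              using R less.prems(1) r X T lc by (simp add: F.m_assoc del: round_trip.simps)
            ultimately show ?thesis using linv[OF T(2)] lc[OF T(2)] ri unfolding r_def[symmetric] by simp
          next
            \<comment> \<open>One more step brings the trip back to its first edge with its first
              label: it has become a closed round trip.\<close>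
            assume *: "pr u = exit_at (inv r) \<and> s = exit_label (inv r)"
            have "?f u = ?f (P (inv r))" using * r less.prems by (intro IH2) auto
            then have 1: "?f (?R @ r # u) = ?f (round_trip P (Suc k) s)"
              unfolding round_trip_Suc using R less.prems(1) r Pr by (simp add: r_def[symmetric])
            have "pr (round_trip P (Suc k) s) = g \<otimes> r \<otimes> pr u"
              unfolding round_trip_Suc using R less.prems(1) r Pr *[THEN conjunct1] g
              by (simp add: r_def[symmetric] g_def m_assoc)
            moreover have "(next_label ^^ Suc k) s = s" using * by (simp add: r_def)
            ultimately have "?f (round_trip P (Suc k) s) = \<one>\<^bsub>F\<^esub>" using closed by (intro trips w(2)) simp_all
            then show ?thesis using 1 by (simp only: r_def)
          qed
        next
          case False
          from av_split[OF False g(2) less.prems(1)] obtain u1 t u2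
            where u: "u = u1 @ t # u2" "av ?C (g \<otimes> r) u1" "ed (g \<otimes> r \<otimes> pr u1) t \<in> ?C" by blast
          have Tu: "set u1 \<subseteq> T" "t \<in> T" "set u2 \<subseteq> T" using less.prems(1) u(1) by auto
          have "pr u1 = \<one> \<and> t = inv r \<or> pr u1 = exit_at (inv r) \<and> t = next_label r"
            using return_general[OF r(2) g(2) Tu(1) _ Tu(2)] u(2,3) unfolding C by blast
          then show ?thesis
          proof
            \<comment> \<open>The walk turns back across the same edge. Removing \<open>r\<close>,
              \<open>u1\<close> and \<open>t\<close> saves at least two cut letters.\<close>
            assume *: "pr u1 = \<one> \<and> t = inv r"
            have cu: "?c u = ?c u1 + 1 + ?c u2" using * r u(1) by simp
            have "?f u1 = \<one>\<^bsub>F\<^esub>" using * cu less.prems(3) Tu by (intro IH) auto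
            then have "?f (?R @ r # u) = ?f ?R \<otimes>\<^bsub>F\<^esub> (l r \<otimes>\<^bsub>F\<^esub> (inv\<^bsub>F\<^esub> l r \<otimes>\<^bsub>F\<^esub> ?f u2))"
              using R Tu r * linv lr by (simp add: u(1))
            also have "\<dots> = ?f ?R \<otimes>\<^bsub>F\<^esub> ?f u2" using lr Tu by (simp add: F.m_assoc[symmetric])
            also have "\<dots> = ?f (?R @ u2)" using R Tu by simp
            also have "\<dots> = \<one>\<^bsub>F\<^esub>"
            proof (rule IH)
              show "?c (?R @ u2) < ?c w" using cu less.prems(3) round_trip_cuts[OF P w(2), of k] by simp
              show "set (?R @ u2) \<subseteq> T" using R Tu by simp
              have "g \<otimes> r \<otimes> (inv r \<otimes> pr u2) = g \<otimes> (r \<otimes> inv r) \<otimes> pr u2"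
                using g(1) r Tu(3) by (simp only: m_assoc m_closed T_in pr_closed)
              then show "pr (?R @ u2) = \<one>" using closed * Tu R r g by (simp add: u(1) g_def)
            qed
            finally show ?thesis by (simp only: r_def)
          next
            \<comment> \<open>The walk goes on through the side: \<open>u1\<close> is replaced by
              the chosen word and the trip grows by one step.\<close>
            assume *: "pr u1 = exit_at (inv r) \<and> t = next_label r"
            have t: "t = (next_label ^^ Suc k) s" using * by (simp add: r_def)
            have cu: "?c u = ?c u1 + 1 + ?c u2" using cut_label_next[OF r(1)] * u(1) by simp
            have 1: "?f u1 = ?f (P (inv r))" using * r cu Tu less.prems(3) by (intro IH2) auto
            have "?f (?R @ r # u) = ?f (round_trip P (Suc k) s @ t # u2)"
              unfolding round_trip_Suc using R Tu r Pr 1 by (simp add: r_def[symmetric] u(1) F.m_assoc lc)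
            also have "\<dots> = \<one>\<^bsub>F\<^esub>" unfolding t
            proof (rule less.hyps)
              show "length u2 < length u" by (simp add: u(1))
              show "set u2 \<subseteq> T" by (rule Tu)
              show "Suc k + 1 + ?c u2 \<le> ?c w" using cu less.prems(3) by simp
              have "pr (round_trip P (Suc k) s @ t # u2) = g \<otimes> r \<otimes> pr u"
                unfolding round_trip_Suc using R Tu r Pr * g by (simp add: r_def[symmetric] g_def u(1) m_assoc)
              then show "pr (round_trip P (Suc k) s @ (next_label ^^ Suc k) s # u2) = \<one>"
                using closed t by simp
            qed
            finally show ?thesis by (simp only: r_def)
          qed
        qed
      qed
      \<comment> \<open>A closed word may be rotated so that it starts at its first cut letter; this
        only conjugates its value.\<close>
      have "pr w0 \<otimes> pr (s # w1) = \<one>" using less.prems T unfolding w(1) by simp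
      then have "pr (s # w1) \<otimes> pr w0 = \<one>" by (rule inv_comm) (use T in simp_all)
      then have "?f (round_trip P 0 s @ (next_label ^^ 0) s # (w1 @ w0)) = \<one>\<^bsub>F\<^esub>"
        using T w by (intro inner) (simp_all add: m_assoc)
      then have "?f (s # w1) \<otimes>\<^bsub>F\<^esub> ?f w0 = \<one>\<^bsub>F\<^esub>" using T lc by (simp add: F.m_assoc)
      then have "?f w0 \<otimes>\<^bsub>F\<^esub> ?f (s # w1) = \<one>\<^bsub>F\<^esub>" by (rule F.inv_comm) (use T lc in simp_all)
      then show ?thesis unfolding w(1) using T by simp
    qed
  qed
qed

end

section \<open>Cubic graphs of connectivity two\<close>

text \<open>Bridges: an end \<open>u\<close> of a bridge has another neighbour on its own side, so
  the deletion of \<open>u\<close> would disconnect the graph. Cuts: let \<open>A\<close> be a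
  component left by a separating pair. A vertex of the pair is added to \<open>A\<close> if at least
  two of its three edges meet \<open>A\<close>, and is left outside otherwise; either way at most
  one of its edges crosses. The boundary so obtained has at most two edges, and none or one is
  impossible.\<close>

lemma connectivity_two_bridgeless_graph:
  fixes V :: "'v set" and E :: "'v set set"
  assumes edge: "\<And>e. e \<in> E \<Longrightarrow> \<exists>x y. x \<in> V \<and> y \<in> V \<and> x \<noteq> y \<and> e = {x, y}"
    and cubic: "cubic_graph V E" and conn: "connectivity_two V E"
  shows "bridgeless_graph V E" "\<exists>A e f. e \<noteq> f \<and> boundary E A = {e, f}"
proof -
  have deg: "card {e \<in> E. v \<in> e} = 3" "finite {e \<in> E. v \<in> e}" if "v \<in> V" for v
  proof -
    show "card {e \<in> E. v \<in> e} = 3" using cubic that by (simp add: cubic_graph_def)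
    then show "finite {e \<in> E. v \<in> e}" by (intro card_ge_0_finite) simp
  qed
  have kc: "connected_on (V - X) E" if "X \<subseteq> V" "finite X" "card X < 2" for X
    using conn that unfolding connectivity_two_def k_connected_def by blast
  have closed: "v \<in> A"
    if con: "connected_on W E" and uv: "u \<in> W" "v \<in> W" "u \<in> A"
      and step: "\<And>x y. x \<in> W \<Longrightarrow> y \<in> W \<Longrightarrow> {x, y} \<in> E \<Longrightarrow> x \<in> A \<Longrightarrow> y \<in> A" for W u v A
  proof -
    have "(u, v) \<in> {(x, y). x \<in> W \<and> y \<in> W \<and> {x, y} \<in> E}\<^sup>*" using con uv by (simp add: connected_on_def)
    then show ?thesis by (induction rule: rtrancl_induct) (use uv(3) step in auto)
  qed
  show bg: "bridgeless_graph V E"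
  proof
    fix A assume A: "boundary E A = {}"
    have "V \<subseteq> A" if "u \<in> V" "u \<in> A" for u
    proof
      fix v assume v: "v \<in> V"
      have "connected_on V E" using kc[of "{}"] by simp
      then show "v \<in> A"
      proof (rule closed[OF _ that(1) v that(2)])
        fix x y assume "{x, y} \<in> E" "x \<in> A"
        then show "y \<in> A" using A boundary_edge[of x y E A] by simp
      qed
    qed
    then show "V \<subseteq> A \<or> V \<inter> A = {}" by blast
  next
    fix A e
    show "boundary E A \<noteq> {e}"
    proof
      assume A: "boundary E A = {e}"
      then have "e \<in> boundary E A" by simp
      then have e: "e \<in> E" "e \<inter> A \<noteq> {}" "e - A \<noteq> {}" by (auto simp: boundary_def)
      obtain u v where uv: "e = {u, v}" "u \<in> A" "v \<notin> A" "u \<in> V" "v \<in> V"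
      proof -
        obtain x y where xy: "e = {x, y}" "x \<in> V" "y \<in> V" using edge[OF e(1)] by blast
        show ?thesis
        proof (cases "x \<in> A")
          case True then show ?thesis using that[of x y] xy e(3) by simp
        next
          case False then show ?thesis using that[of y x] xy e(2) by (simp add: insert_commute)
        qed
      qed
      have "{f \<in> E. u \<in> f} \<noteq> {e}"
      proof
        assume "{f \<in> E. u \<in> f} = {e}"
        then have "card {f \<in> E. u \<in> f} = 1" by simp
        then show False using deg(1)[OF uv(4)] by simp
      qed
      moreover have "e \<in> {f \<in> E. u \<in> f}" using e uv by simp
      ultimately obtain f where f: "f \<in> E" "u \<in> f" "f \<noteq> e" by blast
      obtain w where w: "f = {u, w}" "w \<in> V" "w \<noteq> u"
      proof -
        obtain x y where xy: "f = {x, y}" "x \<in> V" "y \<in> V" "x \<noteq> y" using edge[OF f(1)] by blast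
        show ?thesis
        proof (cases "x = u")
          case True then show ?thesis using that[of y] xy by simp
        next
          case False then show ?thesis using that[of x] xy f(2) by (simp add: insert_commute)
        qed
      qed
      have "{u, w} \<notin> boundary E A" using f(3) unfolding A w(1) by simp
      then have wA: "w \<in> A" using f(1) uv(2) by (simp add: w(1) boundary_edge)
      have "connected_on (V - {u}) E" using kc[of "{u}"] uv(4) by simp
      then have "v \<in> A"
      proof (rule closed)
        show "w \<in> V - {u}" "v \<in> V - {u}" "w \<in> A" using w wA uv by auto
        fix x y assume xy: "x \<in> V - {u}" "y \<in> V - {u}" "{x, y} \<in> E" "x \<in> A"
        have "{x, y} \<notin> boundary E A" using xy(1,2) unfolding A uv(1) by (auto simp: doubleton_eq_iff)
        then show "y \<in> A" using xy by (simp add: boundary_edge)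
      qed
      then show False using uv by simp
    qed
  qed (rule edge)
  interpret bridgeless_graph V E by (rule bg)
  obtain X where X: "finite X" "card X = 2" "X \<subseteq> V" "\<not> connected_on (V - X) E"
    using conn unfolding connectivity_two_def separates_def by blast
  let ?R = "{(x, y). x \<in> V - X \<and> y \<in> V - X \<and> {x, y} \<in> E}"
  obtain u v where uv: "u \<in> V - X" "v \<in> V - X" "(u, v) \<notin> ?R\<^sup>*" using X(4) unfolding connected_on_def by blast
  define A where "A = {a. (u, a) \<in> ?R\<^sup>*}"
  have AW: "A \<subseteq> V - X"
  proof
    fix a assume "a \<in> A"
    then have "(u, a) \<in> ?R\<^sup>*" by (simp add: A_def)
    then show "a \<in> V - X" by (cases rule: rtranclE) (use uv in auto)
  qed
  have step: "y \<in> A \<or> y \<in> X" if "x \<in> A" "{x, y} \<in> E" for x y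
  proof (cases "y \<in> X")
    case False
    have "y \<in> V" using edge[OF that(2)] by (auto simp: doubleton_eq_iff)
    then have "(x, y) \<in> ?R" using that AW False by auto
    then show ?thesis using that(1) unfolding A_def by (auto intro: rtrancl_into_rtrancl)
  qed simp
  define to where "to = (\<lambda>z. {e \<in> E. z \<in> e \<and> e \<inter> A \<noteq> {}})"
  define A' where "A' = A \<union> {z \<in> X. card (to z) \<ge> 2}"
  \<comment> \<open>\<open>N z\<close> contains the edges at \<open>z\<close> that can cross once
    \<open>z\<close> has been placed: those away from \<open>A\<close> if \<open>z\<close> has
    joined it, those into \<open>A\<close> otherwise.\<close>
  define N where "N = (\<lambda>z. if z \<in> A' then {e \<in> E. z \<in> e \<and> e \<inter> A = {}} else to z)"
  have N: "finite (N z)" "card (N z) \<le> 1" if z: "z \<in> X" for z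
  proof -
    have zV: "z \<in> V" using z X by blast
    have fin: "finite (to z)" "finite (N z)"
      unfolding N_def to_def by (rule finite_subset[OF _ deg(2)[OF zV]], auto)+
    show "finite (N z)" by (rule fin)
    show "card (N z) \<le> 1"
    proof (cases "z \<in> A'")
      case True
      then have "card (to z) \<ge> 2" using z AW by (auto simp: A'_def)
      moreover have "card (N z) + card (to z) = card (N z \<union> to z)"
        using fin True by (intro card_Un_disjoint[symmetric]) (auto simp: N_def to_def)
      moreover have "N z \<union> to z = {e \<in> E. z \<in> e}" using True by (auto simp: N_def to_def)
      ultimately show ?thesis using deg(1)[OF zV] by simp
    next
      case False
      then have "\<not> card (to z) \<ge> 2" using z by (simp add: A'_def)
      then show ?thesis using False by (simp add: N_def)
    qed
  qed
  have sub: "\<delta> A' \<subseteq> (\<Union>z\<in>X. N z)"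
  proof
    fix e assume "e \<in> \<delta> A'"
    then obtain p q where e: "e = {p, q}" "p \<in> A'" "q \<notin> A'" "e \<in> E" by (rule boundaryE)
    show "e \<in> (\<Union>z\<in>X. N z)"
    proof (cases "p \<in> A")
      case True
      then have q: "q \<in> X" using step[of p q] e by (auto simp: A'_def)
      then have "e \<in> N q" using True e by (auto simp: N_def to_def)
      then show ?thesis using q by blast
    next
      case False
      then have p: "p \<in> X" using e(2) by (auto simp: A'_def)
      have "q \<notin> A" using e(3) by (simp add: A'_def)
      then have "e \<in> N p" using False e by (auto simp: N_def)
      then show ?thesis using p by blast
    qed
  qed
  have "card (\<Union>z\<in>X. N z) \<le> (\<Sum>z\<in>X. card (N z))" by (rule card_UN_le[OF X(1)])
  also have "\<dots> \<le> (\<Sum>z\<in>X. 1)" by (intro sum_mono N(2))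
  finally have UN2: "card (\<Union>z\<in>X. N z) \<le> 2" using X(2) by simp
  have finU: "finite (\<Union>z\<in>X. N z)" using X(1) N(1) by blast
  have c2: "card (\<delta> A') \<le> 2" using card_mono[OF finU sub] UN2 by simp
  have fin: "finite (\<delta> A')" by (rule finite_subset[OF sub finU])
  have uA: "u \<in> A'" "v \<notin> A'" using uv by (auto simp: A'_def A_def)
  then have "\<delta> A' \<noteq> {}" using connected[of A'] uv by blast
  then have "card (\<delta> A') \<noteq> 0" using fin by simp
  moreover have "card (\<delta> A') \<noteq> 1" using bridgeless[of A'] by (metis card_1_singletonE)
  ultimately have "card (\<delta> A') = 2" using c2 by simp
  then show "\<exists>A e f. e \<noteq> f \<and> \<delta> A = {e, f}" by (metis card_2_iff)
qed

text \<open>The set \<open>S\<close> may contain \<open>\<one>\<close> and may lack inverses.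
  Closing it under inverses and removing \<open>\<one>\<close> leaves the simple graph unchanged,
  and then the degree counts the labels.\<close>

lemma cubic_cayley_of_hyps:
  fixes G (structure) and S :: "'g set"
  assumes G: "group G" and S: "S \<subseteq> carrier G" and gen: "generate G S = carrier G"
    and cubic: "cubic_graph (carrier G) (cayley_edges G S)"
    and conn: "connectivity_two (carrier G) (cayley_edges G S)"
  obtains T where "cubic_cayley G T" "generate G T = carrier G" "\<exists>s. cubic_cayley.cut_label G T s"
proof -
  interpret group G by (rule G)
  define T where "T = (S \<union> (\<lambda>s. inv s) ` S) - {\<one>}"
  have Tc: "T \<subseteq> carrier G" using S by (auto simp: T_def)
  have invT: "inv t \<in> T" if "t \<in> T" for t
    using that S Tc by (auto simp: T_def)
  let ?E = "cayley_edges G S"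
  have E: "?E = cayley_edges G T"
  proof
    show "?E \<subseteq> cayley_edges G T"
    proof
      fix e assume "e \<in> ?E"
      then obtain g s where gs: "e = {g, g \<otimes> s}" "g \<in> carrier G" "s \<in> S" "g \<otimes> s \<noteq> g"
        unfolding cayley_edges_def by blast
      then have "s \<in> T" using S by (auto simp: T_def)
      then show "e \<in> cayley_edges G T" using gs unfolding cayley_edges_def by blast
    qed
    show "cayley_edges G T \<subseteq> ?E"
    proof
      fix e assume "e \<in> cayley_edges G T"
      then obtain g t where gt: "e = {g, g \<otimes> t}" "g \<in> carrier G" "t \<in> T" "g \<otimes> t \<noteq> g"
        unfolding cayley_edges_def by blast
      from gt(3) consider "t \<in> S" | s where "s \<in> S" "t = inv s" by (auto simp: T_def)
      then show "e \<in> ?E"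
      proof cases
        case 1 then show ?thesis using gt unfolding cayley_edges_def by blast
      next
        case 2
        have s: "s \<in> carrier G" using 2 S by blast
        have gg: "(g \<otimes> t) \<otimes> s = g" using gt 2 s by (simp add: m_assoc)
        have "g \<otimes> t \<in> carrier G" "(g \<otimes> t) \<otimes> s \<noteq> g \<otimes> t" using gt Tc unfolding gg by auto
        then have "{g \<otimes> t, (g \<otimes> t) \<otimes> s} \<in> ?E" using 2(1) unfolding cayley_edges_def by blast
        then show ?thesis unfolding gt(1) gg by (simp only: insert_commute)
      qed
    qed
  qed
  have ne: "g \<otimes> t \<noteq> g" if "g \<in> carrier G" "t \<in> T" for g t
    using that Tc by (auto simp: T_def)
  have edge: "\<exists>x y. x \<in> carrier G \<and> y \<in> carrier G \<and> x \<noteq> y \<and> e = {x, y}" if e: "e \<in> ?E" for e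
  proof -
    obtain g s where gs: "e = {g, g \<otimes> s}" "g \<in> carrier G" "s \<in> S" "g \<otimes> s \<noteq> g"
      using e unfolding cayley_edges_def by blast
    then show ?thesis using S by (intro exI[of _ g] exI[of _ "g \<otimes> s"]) auto
  qed
  have "{e \<in> ?E. \<one> \<in> e} = (\<lambda>t. {\<one>, t}) ` T"
  proof
    show "{e \<in> ?E. \<one> \<in> e} \<subseteq> (\<lambda>t. {\<one>, t}) ` T"
    proof
      fix e assume "e \<in> {e \<in> ?E. \<one> \<in> e}"
      then have "e \<in> cayley_edges G T" "\<one> \<in> e" using E by auto
      then obtain g t where gt: "e = {g, g \<otimes> t}" "g \<in> carrier G" "t \<in> T"
        unfolding cayley_edges_def by blast
      from \<open>\<one> \<in> e\<close> gt(1) consider "g = \<one>" | "g \<otimes> t = \<one>" by auto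
      then show "e \<in> (\<lambda>t. {\<one>, t}) ` T"
      proof cases
        case 1 then show ?thesis using gt Tc by auto
      next
        case 2
        then have "g = inv t" using inv_equality[OF 2] gt Tc by auto
        then have "e = {\<one>, inv t}" using 2 gt(1) by (simp add: insert_commute)
        then show ?thesis using invT[OF gt(3)] by blast
      qed
    qed
    show "(\<lambda>t. {\<one>, t}) ` T \<subseteq> {e \<in> ?E. \<one> \<in> e}"
    proof
      fix e assume "e \<in> (\<lambda>t. {\<one>, t}) ` T"
      then obtain t where t: "t \<in> T" "e = {\<one>, t}" by auto
      then have "e = {\<one>, \<one> \<otimes> t}" using Tc by auto
      then have "e \<in> cayley_edges G T" using t ne[of \<one> t] unfolding cayley_edges_def by blast
      then show "e \<in> {e \<in> ?E. \<one> \<in> e}" using t E by simp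
    qed
  qed
  moreover have "inj_on (\<lambda>t. {\<one>, t}) T" by (auto simp: inj_on_def doubleton_eq_iff)
  moreover have "card {e \<in> ?E. \<one> \<in> e} = 3" using cubic unfolding cubic_graph_def by simp
  ultimately have card: "card T = 3" by (metis card_image)
  have genT: "generate G T = carrier G"
  proof
    show "generate G T \<subseteq> carrier G" by (rule generate_incl[OF Tc])
    have "S \<subseteq> generate G T"
    proof
      fix s assume "s \<in> S"
      then show "s \<in> generate G T"
        using generate.one[of G T] generate.incl[of s T G] by (cases "s = \<one>") (auto simp: T_def)
    qed
    from generate_subgroup_incl[OF this generate_is_subgroup[OF Tc]]
    show "carrier G \<subseteq> generate G T" using gen by simp
  qed
  have cb: "bridgeless_graph (carrier G) ?E" "\<exists>A e f. e \<noteq> f \<and> boundary ?E A = {e, f}"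
    using connectivity_two_bridgeless_graph[OF _ cubic conn] edge by metis+
  have cc: "cubic_cayley G T"
  proof (rule cubic_cayley.intro[OF G cubic_cayley_axioms.intro])
    show "bridgeless_graph (carrier G) (cayley_edges G T)" using cb(1) E by simp
    show "\<one> \<notin> T" by (simp add: T_def)
  qed (rule Tc, erule invT, rule card)
  interpret C: cubic_cayley G T by (rule cc)
  from cb(2) obtain A e f where ef: "e \<noteq> f" "boundary ?E A = {e, f}" by (elim exE conjE)
  then have e: "C.in_cut e" using C.in_cutI[of A e f] unfolding E by simp
  have "e \<in> boundary ?E A" using ef(2) by simp
  then have "e \<in> cayley_edges G T" unfolding E[symmetric] by (simp add: boundary_def)
  then obtain g s where "e = {g, g \<otimes> s}" "g \<in> carrier G" "s \<in> T" unfolding cayley_edges_def by blast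
  then have "C.cut_label s" using C.in_cut_ed[of g s] e by simp
  then show thesis using that[OF cc genT] by blast
qed

section \<open>The number of cut labels\<close>

lemma (in group) word_prod_replicate:
  assumes "l ` set w \<subseteq> carrier G"
  shows "word_prod G l (concat (replicate n w)) = word_prod G l w [^] n"
proof (induction n)
  case (Suc n)
  have "l ` set (concat (replicate n w)) \<subseteq> carrier G" using assms by (induction n) auto
  then show ?case
    using assms Suc nat_pow_comm[of "word_prod G l w" n 1] by (simp add: word_prod_append)
qed simp

context cubic_cayley
begin

lemma round_trip_fixed:
  assumes "next_label s = s"
  shows "round_trip P k s = concat (replicate k (s # P (inv s)))"
  using assms by (induction k) auto

lemma round_trip_swap:
  assumes "next_label s = r" "next_label r = s"
  shows "round_trip P (2 * j) s = concat (replicate j (s # P (inv s) @ r # P (inv r)))"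
  using assms by (induction j) auto

lemma next_funpow_swap:
  assumes "next_label s = r" "next_label r = s"
  shows "(next_label ^^ k) s = (if even k then s else r)"
  using assms by (induction k) auto

text \<open>\<open>s \<otimes> exit_at (inv s)\<close> is one step along the class; when the label
  repeats, it carries the edge \<open>s\<close> into its own class. As \<open>ord\<close> is zero
  for elements of infinite order, positivity means finite order.\<close>

lemma ord_next_pos:
  assumes s: "cut_label s" and "next_label s = s"
  shows "ord (s \<otimes> exit_at (inv s)) > 0"
proof -
  have "exit_at (inv s) \<in> carrier G" using cut_label_inv[OF s] by simp
  then have z: "s \<otimes> exit_at (inv s) \<in> carrier G" using s by simp
  have "\<exists>n>0. (s \<otimes> exit_at (inv s)) [^] (n::nat) = \<one>"
    using finite_order[OF z, of s] next_edge[OF s] assms by simp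
  then show ?thesis using pow_eq_id[OF z] by (metis dvd_0_left_iff gr0I)
qed

text \<open>Only two steps together restore the label, so the order in question is that of their
  product.\<close>

lemma ord_next_next_pos:
  assumes s: "cut_label s" and r: "next_label s = r" "next_label r = s"
  shows "ord (s \<otimes> exit_at (inv s) \<otimes> (r \<otimes> exit_at (inv r))) > 0"
proof -
  have rc: "cut_label r" using cut_label_next[OF s] r(1) by simp
  have c: "s \<in> carrier G" "r \<in> carrier G" "exit_at (inv s) \<in> carrier G" "exit_at (inv r) \<in> carrier G"
    "s \<in> T" "r \<in> T" using s rc cut_label_inv[OF s] cut_label_inv[OF rc] by auto
  let ?x = "s \<otimes> exit_at (inv s)" and ?y = "r \<otimes> exit_at (inv r)"
  have z: "?x \<otimes> ?y \<in> carrier G" using c by simp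
  have "ed (?x \<otimes> ?y) s \<approx> ed (?x \<otimes> \<one>) r"
    using cut_equiv_ed_translate[of ?x ?y \<one> s r] next_edge[OF rc] r c by simp
  moreover have "ed (?x \<otimes> \<one>) r \<approx> ed \<one> s" using next_edge[OF s] r c by simp
  ultimately have "ed (?x \<otimes> ?y) s \<approx> ed \<one> s" by (rule cut_equiv_trans)
  from finite_order[OF z _ this] c have "\<exists>n>0. (?x \<otimes> ?y) [^] (n::nat) = \<one>" by simp
  then show ?thesis using pow_eq_id[OF z] by (metis dvd_0_left_iff gr0I)
qed

text \<open>A word in uncut labels has the value \<open>\<one>\<close> or \<open>b\<close>, so an
  exit reached by such a word is \<open>b\<close>. This gives the exit of one of the two cut labels.
  \<open>doubled_label\<close> transfers it to the other, together with the complementary exit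
  label.\<close>

lemma two_cut_labels:
  assumes T: "T = {b, s, s'}" "b \<noteq> s" "b \<noteq> s'" "s \<noteq> s'" and b: "b \<otimes> b = \<one>"
    and cut: "cut_label s" "cut_label s'" "\<not> cut_label b"
  shows "exit_at s = b" "exit_at s' = b"
    "exit_label s = s \<and> exit_label s' = s' \<or> exit_label s = s' \<and> exit_label s' = s"
proof -
  have bT: "b \<in> T" using T by simp
  have pow: "pr u = \<one> \<or> pr u = b" if "set u \<subseteq> {b}" for u
    using that by (induction u) (use bT b in auto)
  have lab: "exit_label r \<in> {s, s'}" if "cut_label r" for r
    using exit_label_in[OF that] cut_label_exit[OF that] cut(3) unfolding T(1) by auto
  have step: "exit_at s' = b \<and> (exit_label s = s \<and> exit_label s' = s' \<or> exit_label s = s' \<and> exit_label s' = s)"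
    if T: "T = {b, s, s'}" "b \<noteq> s" "b \<noteq> s'" "s \<noteq> s'" and cut: "cut_label s" "cut_label s'" and "exit_at s = b"
      and lab: "exit_label s \<in> {s, s'}" for s s'
  proof -
    define q where "q = exit_label s"
    define q' where "q' = (if q = s then s' else s)"
    have q: "q = s \<and> q' = s' \<or> q = s' \<and> q' = s" using lab by (auto simp: q_def q'_def)
    have "ed \<one> s \<approx> ed b q" using exit_equiv[OF cut(1)] \<open>exit_at s = b\<close> unfolding q_def by metis
    from doubled_label[OF T b this q] have eq: "ed \<one> s' \<approx> ed b q'" .
    have "\<not> ed \<one> s' \<approx> ed \<one> b"
      using adjacent_not_equiv[OF one_closed cut_labelD[OF cut(2)] bT] T(3) by metis
    then have "av (cut_class (ed \<one> s')) \<one> [b]" unfolding avoids.simps cut_class_def by blast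
    moreover have "pr [b] = b" using bT by simp
    moreover have "q' \<in> T" using q T by auto
    ultimately have "pr [b] = \<one> \<and> q' = s' \<or> pr [b] = exit_at s' \<and> q' = exit_label s'"
      using return_one[OF cut(2), of "[b]" q'] eq bT unfolding cut_class_def by simp
    then show ?thesis using \<open>pr [b] = b\<close> bT one_notin_T q unfolding q_def by auto
  qed
  obtain r u where r: "cut_label r" "set u \<subseteq> T" "\<forall>t\<in>set u. \<not> cut_label t" "pr u = exit_at r"
    using exit_noncut[OF cut(1)] by blast
  have "set u \<subseteq> {b}"
  proof
    fix x assume "x \<in> set u"
    then have "x \<in> T" "\<not> cut_label x" using r by auto
    then show "x \<in> {b}" using cut unfolding T(1) by auto
  qed
  then have rb: "exit_at r = b" using pow[of u] r(4) exit_at_ne_one[OF r(1)] by metis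
  have T': "T = {b, s', s}" using T(1) by auto
  from r(1) cut(3) have "r = s \<or> r = s'" using cut_labelD[OF r(1)] unfolding T(1) by auto
  then have "exit_at s = b \<and> exit_at s' = b \<and>
    (exit_label s = s \<and> exit_label s' = s' \<or> exit_label s = s' \<and> exit_label s' = s)"
  proof
    assume "r = s"
    then show ?thesis using rb step[OF T cut(1,2) _ lab[OF cut(1)]] by simp
  next
    assume "r = s'"
    then show ?thesis
      using rb step[OF T' T(3) T(2) T(4)[symmetric] cut(2,1) _ ] lab[OF cut(2)] by (auto simp: insert_commute)
  qed
  then show "exit_at s = b" "exit_at s' = b"
    "exit_label s = s \<and> exit_label s' = s' \<or> exit_label s = s' \<and> exit_label s' = s" by auto
qed

text \<open>With three cut labels the word supplied by \<open>exit_noncut\<close> would be empty,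
  and the exit would be \<open>\<one>\<close>.\<close>

lemma not_all_cut: assumes "cut_label s" shows "\<exists>t\<in>T. \<not> cut_label t"
proof (rule ccontr)
  assume all: "\<not> ?thesis"
  obtain r u where r: "cut_label r" "set u \<subseteq> T" "\<forall>t\<in>set u. \<not> cut_label t" "pr u = exit_at r"
    using exit_noncut[OF assms] by blast
  then have "u = []" using all by (cases u) auto
  then show False using r exit_at_ne_one by auto
qed

text \<open>Exit labels and inverses of cut labels are cut labels, so both are \<open>s\<close>. As
  \<open>exit_at\<close> of the exit label is the inverse of \<open>exit_at s\<close>, the exit
  squares to \<open>\<one>\<close>.\<close>

lemma one_cut_label:
  assumes s: "cut_label s" and only: "\<And>t. cut_label t \<Longrightarrow> t = s"
  shows "exit_label s = s" "inv s = s" "exit_at s \<otimes> exit_at s = \<one>"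
    "\<exists>u. set u \<subseteq> T - {s} \<and> pr u = exit_at s"
proof -
  show l: "exit_label s = s" by (rule only[OF cut_label_exit[OF s]])
  show "inv s = s" by (rule only[OF cut_label_inv[OF s]])
  have "exit_at s = inv (exit_at s)" using exit_exit(2)[OF s] l by simp
  then show "exit_at s \<otimes> exit_at s = \<one>" using exit_at_closed[OF s] by (metis r_inv)
  obtain r u where r: "cut_label r" "set u \<subseteq> T" "\<forall>t\<in>set u. \<not> cut_label t" "pr u = exit_at r"
    using exit_noncut[OF s] by blast
  then show "\<exists>u. set u \<subseteq> T - {s} \<and> pr u = exit_at s"
    using only[OF r(1)] s by (intro exI[of _ u]) auto
qed

text \<open>If the only cut label \<open>s\<close> came back at a generator \<open>b\<close>, then the third label would be cut.\<close>

lemma one_cut_exit_ne: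
  assumes T: "T = {b, s, c}" "b \<noteq> s" "b \<noteq> c" "s \<noteq> c" and b: "b \<otimes> b = \<one>"
    and s: "cut_label s" and only: "\<And>t. cut_label t \<Longrightarrow> t = s"
  shows "exit_at s \<noteq> b"
proof
  assume *: "exit_at s = b"
  have "ed \<one> s \<approx> ed b s" using exit_equiv[OF s] one_cut_label(1)[OF s only] * by metis
  from doubled_label[OF T b this, of c] have eq: "ed \<one> c \<approx> ed b c" by simp
  have c: "c \<in> T" "b \<in> T" "c \<in> carrier G" "b \<in> carrier G" "b \<noteq> \<one>" using T one_notin_T by auto
  have "ed b c \<noteq> ed \<one> c"
  proof
    assume "ed b c = ed \<one> c"
    then have "b = \<one> \<otimes> c \<or> b = \<one>" by (auto simp: doubleton_eq_iff)
    then show False using c T(3) by simp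
  qed
  then have "in_cut (ed \<one> c)" using eq unfolding in_cut_def by (intro exI[of _ "ed b c"] conjI)
  then have "cut_label c" using in_cut_ed[OF one_closed c(1)] by simp
  then show False using only T(4) by blast
qed

text \<open>The homomorphism goes from \<open>F\<close> to \<open>G\<close> because universal
  properties produce maps out of \<open>F\<close>. It is onto since every label has a preimage. It
  is injective since each element of \<open>F\<close> is a word in the lifted labels, and a word
  that closes in \<open>G\<close> is trivial in \<open>F\<close>.\<close>

lemma lift_iso:
  fixes F :: "('f, 'n) monoid_scheme" and l :: "'a \<Rightarrow> 'f"
  assumes F: "group F" and lc: "\<And>t. t \<in> T \<Longrightarrow> l t \<in> carrier F"
    and linv: "\<And>t. t \<in> T \<Longrightarrow> l (inv t) = inv\<^bsub>F\<^esub> l t"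
    and triv: "\<And>w. set w \<subseteq> T \<Longrightarrow> pr w = \<one> \<Longrightarrow> word_prod F l w = \<one>\<^bsub>F\<^esub>"
    and \<pi>: "\<pi> \<in> hom F G" "\<And>t. t \<in> T \<Longrightarrow> \<pi> (l t) = t"
    and gen: "carrier F \<subseteq> generate F (l ` T)" "generate G T = carrier G"
  shows "\<pi> \<in> iso F G"
proof -
  interpret F: group F by (rule F)
  interpret \<pi>: group_hom F G \<pi> using F \<pi>(1) by unfold_locales
  have img: "l ` set u \<subseteq> carrier F" if "set u \<subseteq> T" for u using that lc by blast
  have \<pi>w: "\<pi> (word_prod F l u) = pr u" if "set u \<subseteq> T" for u
    using that
  proof (induction u)
    case (Cons t u)
    then show ?case using lc \<pi>(2) F.word_prod_closed[OF img, of u] by simp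
  qed simp
  have words: "\<exists>u. set u \<subseteq> T \<and> x = word_prod F l u" if "x \<in> generate F (l ` T)" for x
    using that
  proof (induction rule: generate.induct)
    case one then show ?case by (intro exI[of _ "[]"]) simp
  next
    case (incl h)
    then obtain t where t: "t \<in> T" "h = l t" by auto
    then show ?case using lc by (intro exI[of _ "[t]"]) simp
  next
    case (inv h)
    then obtain t where t: "t \<in> T" "h = l t" by auto
    then show ?case using lc linv inv_T by (intro exI[of _ "[inv t]"]) simp
  next
    case (eng h1 h2)
    then obtain u v where "set u \<subseteq> T" "h1 = word_prod F l u" "set v \<subseteq> T" "h2 = word_prod F l v" by blast
    then show ?case using F.word_prod_append[OF img img, of u v] by (intro exI[of _ "u @ v"]) simp
  qed
  have "inj_on \<pi> (carrier F)"
    unfolding \<pi>.inj_on_one_iff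
  proof (intro allI impI)
    fix x assume x: "x \<in> carrier F" "\<pi> x = \<one>"
    obtain u where "set u \<subseteq> T" "x = word_prod F l u" using words x(1) gen(1) by blast
    then show "x = \<one>\<^bsub>F\<^esub>" using triv \<pi>w x(2) by simp
  qed
  moreover have "\<pi> ` carrier F = carrier G"
  proof
    show "\<pi> ` carrier F \<subseteq> carrier G" by auto
    have "T \<subseteq> \<pi> ` carrier F"
    proof
      fix t assume "t \<in> T"
      then show "t \<in> \<pi> ` carrier F" using lc[of t] \<pi>(2)[of t] by (metis imageI)
    qed
    then have "generate G T \<subseteq> \<pi> ` carrier F"
      by (rule generate_subgroup_incl) (rule \<pi>.img_is_subgroup)
    then show "carrier G \<subseteq> \<pi> ` carrier F" using gen(2) by simp
  qed
  ultimately show ?thesis using \<pi>(1) by (simp add: iso_def bij_betw_def)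
qed

end

section \<open>Groups given by generators and relators\<close>

definition letter_val :: "('b, 'm) monoid_scheme \<Rightarrow> ('x \<Rightarrow> 'b) \<Rightarrow> 'x \<times> bool \<Rightarrow> 'b" where
  "letter_val H f = (\<lambda>(x, e). if e then f x else inv\<^bsub>H\<^esub> f x)"

abbreviation word_val :: "('b, 'm) monoid_scheme \<Rightarrow> ('x \<Rightarrow> 'b) \<Rightarrow> 'x word \<Rightarrow> 'b" where
  "word_val H f \<equiv> word_prod H (letter_val H f)"

lemma letter_val_simps [simp]:
  "letter_val H f (x, True) = f x" "letter_val H f (x, False) = inv\<^bsub>H\<^esub> f x"
  by (simp_all add: letter_val_def)

lemma wpow_in_words [simp]: "w \<in> words X \<Longrightarrow> w \<^bold>^ n \<in> words X"
  by (induction n) (auto simp: wpow_def)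

lemma Cons_in_words [simp]: "(x, e) # w \<in> words X \<longleftrightarrow> x \<in> X \<and> w \<in> words X"
  by (simp add: words_def)

context group begin

lemma letter_val_words: "f ` X \<subseteq> carrier G \<Longrightarrow> w \<in> words X \<Longrightarrow> letter_val G f ` set w \<subseteq> carrier G"
  by (force simp: words_def letter_val_def)

lemma word_val_closed [simp]: "f ` X \<subseteq> carrier G \<Longrightarrow> w \<in> words X \<Longrightarrow> word_val G f w \<in> carrier G"
  by (intro word_prod_closed letter_val_words)

lemma word_val_append:
  "f ` X \<subseteq> carrier G \<Longrightarrow> u \<in> words X \<Longrightarrow> v \<in> words X \<Longrightarrow>
   word_val G f (u @ v) = word_val G f u \<otimes> word_val G f v"
  by (intro word_prod_append letter_val_words)

lemma word_val_wpow:
  "f ` X \<subseteq> carrier G \<Longrightarrow> w \<in> words X \<Longrightarrow> word_val G f (w \<^bold>^ n) = word_val G f w [^] n"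
  unfolding wpow_def by (intro word_prod_replicate letter_val_words)

lemma word_val_presentation_rel:
  assumes "(u, v) \<in> presentation_rel X R" "f ` X \<subseteq> carrier G" "R \<subseteq> words X"
    and "\<And>r. r \<in> R \<Longrightarrow> word_val G f r = \<one>"
  shows "word_val G f u = word_val G f v"
  using assms(1)
proof (induction rule: presentation_rel.induct)
  case (cancel u v x e)
  have x: "f x \<in> carrier G" using cancel assms(2) by auto
  have "word_val G f [(x, e), (x, \<not> e)] = \<one>" using x by (cases e) auto
  moreover have w: "[(x, e), (x, \<not> e)] \<in> words X" using cancel by simp
  ultimately show ?case
    using cancel assms(2) word_val_append[OF assms(2), of "[(x, e), (x, \<not> e)]" v]
    by (simp add: word_val_append[OF assms(2)] del: append_Cons append_Nil word_prod_Cons)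
next
  case (relator u v r)
  then show ?case using assms(2-4) by (auto simp: word_val_append[OF assms(2)])
qed auto

end

abbreviation pgen :: "'x set \<Rightarrow> 'x word set \<Rightarrow> 'x \<Rightarrow> 'x word set" where
  "pgen X R x \<equiv> presentation_rel X R `` {[(x, True)]}"

locale presentation =
  fixes X :: "'x set" and R :: "'x word set"
  assumes R_words: "R \<subseteq> words X"
begin

sublocale P: group "presented X R" by (rule group_presented[OF R_words])

abbreviation cls where "cls w \<equiv> presentation_rel X R `` {w}"

lemma carrierE: assumes "U \<in> carrier (presented X R)" obtains u where "u \<in> words X" "U = cls u"
  using assms unfolding presented_def by (auto elim: quotientE)

lemma cls_closed [simp]: "w \<in> words X \<Longrightarrow> cls w \<in> carrier (presented X R)"
  unfolding presented_def by (auto intro: quotientI)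

lemma cls_Nil: "cls [] = \<one>\<^bsub>presented X R\<^esub>"
  by (simp add: presented_def)

lemma cls_eqI: "(u, v) \<in> presentation_rel X R \<Longrightarrow> cls u = cls v"
  by (rule equiv_class_eq[OF equiv_presentation_rel[OF R_words]])

lemma cls_single: assumes "x \<in> X" shows "cls [(x, e)] = letter_val (presented X R) (pgen X R) (x, e)"
proof (cases e)
  case False
  have w: "[(x, True)] \<in> words X" "[(x, False)] \<in> words X" using assms by simp_all
  have "([] @ [(x, False), (x, \<not> False)] @ [], [] @ []) \<in> presentation_rel X R"
    using assms by (intro presentation_rel.cancel) simp_all
  then have "cls [(x, False), (x, True)] = cls []" by (intro cls_eqI) simp
  then have "cls [(x, False)] \<otimes>\<^bsub>presented X R\<^esub> cls [(x, True)] = \<one>\<^bsub>presented X R\<^esub>"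
    using presented_mult[OF R_words w(2,1)] cls_Nil by simp
  then have "inv\<^bsub>presented X R\<^esub> cls [(x, True)] = cls [(x, False)]"
    using w by (intro P.inv_equality) auto
  then show ?thesis using False by simp
qed simp

lemma pgen_closed: "pgen X R ` X \<subseteq> carrier (presented X R)"
  by auto

lemma pgen_in [simp]: "x \<in> X \<Longrightarrow> pgen X R x \<in> carrier (presented X R)"
  by auto

lemma word_val_pgen: "w \<in> words X \<Longrightarrow> word_val (presented X R) (pgen X R) w = cls w"
proof (induction w)
  case Nil then show ?case using cls_Nil by simp
next
  case (Cons y w)
  obtain x e where y: "y = (x, e)" by (cases y)
  then have "x \<in> X" "w \<in> words X" using Cons.prems by auto
  then show ?case using Cons.IH cls_single presented_mult[OF R_words, of "[(x, e)]" w] y by simp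
qed

lemma relator_val: assumes "r \<in> R" shows "word_val (presented X R) (pgen X R) r = \<one>\<^bsub>presented X R\<^esub>"
proof -
  have "([] @ r @ [], [] @ []) \<in> presentation_rel X R" using assms by (intro presentation_rel.relator) auto
  then have "cls r = cls []" by (intro cls_eqI) simp
  then show ?thesis using word_val_pgen R_words assms cls_Nil by auto
qed

lemma carrier_generate: "carrier (presented X R) = generate (presented X R) (pgen X R ` X)"
proof
  show "generate (presented X R) (pgen X R ` X) \<subseteq> carrier (presented X R)"
    by (rule P.generate_incl[OF pgen_closed])
  have "word_val (presented X R) (pgen X R) w \<in> generate (presented X R) (pgen X R ` X)" if "w \<in> words X" for w
    using that
  proof (induction w)
    case Nil then show ?case by (simp add: generate.one)
  next
    case (Cons y w)
    obtain x e where y: "y = (x, e)" by (cases y)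
    then have x: "x \<in> X" and w: "w \<in> words X" using Cons.prems by auto
    have "pgen X R x \<in> pgen X R ` X" using x by (rule imageI)
    then have "letter_val (presented X R) (pgen X R) y \<in> generate (presented X R) (pgen X R ` X)"
      using y by (cases e) (auto intro: generate.incl generate.inv)
    from generate.eng[OF this Cons.IH[OF w]] show ?case by simp
  qed
  then have "cls w \<in> generate (presented X R) (pgen X R ` X)" if "w \<in> words X" for w
    using word_val_pgen[OF that] that by metis
  then show "carrier (presented X R) \<subseteq> generate (presented X R) (pgen X R ` X)"
    by (auto elim!: carrierE)
qed

text \<open>This is von Dyck's theorem. The representative picked by \<open>SOME\<close> does not
  matter, because related words have equal values.\<close>

lemma universal:
  assumes H: "group H" and f: "f ` X \<subseteq> carrier H" and R: "\<And>r. r \<in> R \<Longrightarrow> word_val H f r = \<one>\<^bsub>H\<^esub>"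
  shows "\<exists>\<phi>\<in>hom (presented X R) H. \<forall>x\<in>X. \<phi> (pgen X R x) = f x"
proof -
  interpret H: group H by (rule H)
  define \<phi> where "\<phi> U = word_val H f (SOME u. u \<in> U)" for U
  have \<phi>: "\<phi> (cls u) = word_val H f u" if "u \<in> words X" for u
  proof -
    have "u \<in> cls u" using that by (simp add: presentation_rel.refl)
    then have "(SOME v. v \<in> cls u) \<in> cls u" by (rule someI)
    then have "(u, SOME v. v \<in> cls u) \<in> presentation_rel X R" by simp
    from H.word_val_presentation_rel[OF this f R_words R] show ?thesis by (simp add: \<phi>_def)
  qed
  have "\<phi> \<in> hom (presented X R) H"
  proof (rule homI)
    fix U assume "U \<in> carrier (presented X R)"
    then show "\<phi> U \<in> carrier H" using \<phi> f by (auto elim!: carrierE)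
  next
    fix U V assume "U \<in> carrier (presented X R)" "V \<in> carrier (presented X R)"
    then obtain u v where "u \<in> words X" "U = cls u" "v \<in> words X" "V = cls v" by (metis carrierE)
    then show "\<phi> (U \<otimes>\<^bsub>presented X R\<^esub> V) = \<phi> U \<otimes>\<^bsub>H\<^esub> \<phi> V"
      using presented_mult[OF R_words] \<phi> H.word_val_append[OF f] by simp
  qed
  moreover have "\<forall>x\<in>X. \<phi> (pgen X R x) = f x" using \<phi> f by auto
  ultimately show ?thesis by blast
qed

lemma table_hom:
  assumes A: "group A" and f: "f ` carrier A \<subseteq> X" and R: "table_relators f A \<subseteq> R"
  shows "(\<lambda>x. pgen X R (f x)) \<in> hom A (presented X R)"
proof (rule homI)
  interpret A: group A by (rule A)
  fix x y assume xy: "x \<in> carrier A" "y \<in> carrier A"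
  have in_X: "f x \<in> X" "f y \<in> X" "f (x \<otimes>\<^bsub>A\<^esub> y) \<in> X" using f xy by auto
  then show "pgen X R (f x) \<in> carrier (presented X R)" by simp
  have "[(f x, True), (f y, True), (f (x \<otimes>\<^bsub>A\<^esub> y), False)] \<in> R"
    using R xy by (auto simp: table_relators_def)
  from relator_val[OF this]
  have "pgen X R (f x) \<otimes>\<^bsub>presented X R\<^esub> pgen X R (f y) \<otimes>\<^bsub>presented X R\<^esub> inv\<^bsub>presented X R\<^esub> pgen X R (f (x \<otimes>\<^bsub>A\<^esub> y))
      = \<one>\<^bsub>presented X R\<^esub>"
    using in_X by (simp add: P.m_assoc)
  then show "pgen X R (f (x \<otimes>\<^bsub>A\<^esub> y)) = pgen X R (f x) \<otimes>\<^bsub>presented X R\<^esub> pgen X R (f y)"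
    using in_X P.inv_equality[of "pgen X R (f x) \<otimes>\<^bsub>presented X R\<^esub> pgen X R (f y)" "inv\<^bsub>presented X R\<^esub> pgen X R (f (x \<otimes>\<^bsub>A\<^esub> y))"]
    by simp
qed

end

section \<open>Universal properties of amalgams, free products and HNN-extensions\<close>

lemma table_relators_words:
  assumes "group A" "f ` carrier A \<subseteq> X" shows "table_relators f A \<subseteq> words X"
proof -
  interpret group A by (rule assms)
  have "f x \<in> X" if "x \<in> carrier A" for x using assms(2) that by blast
  then show ?thesis by (auto simp: table_relators_def)
qed

lemma table_relators_val:
  assumes "group A" "group H" "h \<in> hom A H" "\<And>x. x \<in> carrier A \<Longrightarrow> g (f x) = h x" "r \<in> table_relators f A"
  shows "word_val H g r = \<one>\<^bsub>H\<^esub>"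
proof -
  interpret A: group A by (rule assms)
  interpret H: group H by (rule assms)
  obtain x y where xy: "r = [(f x, True), (f y, True), (f (x \<otimes>\<^bsub>A\<^esub> y), False)]" "x \<in> carrier A" "y \<in> carrier A"
    using assms(5) by (auto simp: table_relators_def)
  have "h x \<in> carrier H" "h y \<in> carrier H" using xy assms(3) by (auto simp: hom_def)
  then show ?thesis using xy assms(4) hom_mult[OF assms(3) xy(2,3)] by (simp add: H.m_assoc[symmetric])
qed

text \<open>The pushout property together with generation by the two factors. Only the maps
  \<open>\<alpha>\<close>, \<open>\<beta>\<close> and \<open>\<pi>\<close> are exported, so that
  words over the disjoint sum need not be handled again.\<close>

lemma amalgam_universal:
  fixes A :: "('a, 'm) monoid_scheme" and B :: "('b, 'n) monoid_scheme" and C :: "('c, 'k) monoid_scheme"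
    and H :: "('h, 'l) monoid_scheme"
  assumes A: "group A" and B: "group B" and H: "group H"
    and i: "i ` carrier C \<subseteq> carrier A" and j: "j ` carrier C \<subseteq> carrier B"
    and fA: "fA \<in> hom A H" and fB: "fB \<in> hom B H"
    and eq: "\<And>c. c \<in> carrier C \<Longrightarrow> fA (i c) = fB (j c)"
  obtains \<alpha> \<beta> \<pi> where "group (amalgam A B C i j)"
    "\<alpha> \<in> hom A (amalgam A B C i j)" "\<beta> \<in> hom B (amalgam A B C i j)"
    "\<And>c. c \<in> carrier C \<Longrightarrow> \<alpha> (i c) = \<beta> (j c)"
    "carrier (amalgam A B C i j) = generate (amalgam A B C i j) (\<alpha> ` carrier A \<union> \<beta> ` carrier B)"
    "\<pi> \<in> hom (amalgam A B C i j) H"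
    "\<And>x. x \<in> carrier A \<Longrightarrow> \<pi> (\<alpha> x) = fA x" "\<And>y. y \<in> carrier B \<Longrightarrow> \<pi> (\<beta> y) = fB y"
proof -
  interpret A: group A by (rule A)
  interpret B: group B by (rule B)
  interpret H: group H by (rule H)
  define X where "X = carrier A <+> carrier B"
  define RC :: "('a + 'b) word set" where "RC = {[(Inl (i h), True), (Inr (j h), False)] | h. h \<in> carrier C}"
  define R where "R = table_relators Inl A \<union> table_relators Inr B \<union> RC"
  let ?F = "presented X R"
  have F: "amalgam A B C i j = ?F" unfolding amalgam_def X_def R_def RC_def ..
  have RC: "RC \<subseteq> words X" using image_subset_iff[THEN iffD1, OF i] image_subset_iff[THEN iffD1, OF j]
    by (auto simp: RC_def X_def)
  interpret presentation X R
    by unfold_locales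
      (use RC table_relators_words[OF A, of Inl X] table_relators_words[OF B, of Inr X] in \<open>auto simp: R_def X_def\<close>)
  define \<alpha> where "\<alpha> = (\<lambda>x. pgen X R (Inl x :: 'a + 'b))"
  define \<beta> where "\<beta> = (\<lambda>y. pgen X R (Inr y :: 'a + 'b))"
  have \<alpha>: "\<alpha> \<in> hom A ?F" unfolding \<alpha>_def by (rule table_hom[OF A]) (auto simp: X_def R_def)
  have \<beta>: "\<beta> \<in> hom B ?F" unfolding \<beta>_def by (rule table_hom[OF B]) (auto simp: X_def R_def)
  have glue: "\<alpha> (i c) = \<beta> (j c)" if c: "c \<in> carrier C" for c
  proof -
    have "[(Inl (i c), True), (Inr (j c), False)] \<in> R" using c by (auto simp: R_def RC_def)
    note rel = relator_val[OF this]
    have "i c \<in> carrier A" "j c \<in> carrier B" using c i j by auto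
    then have c': "\<alpha> (i c) \<in> carrier ?F" "\<beta> (j c) \<in> carrier ?F" using \<alpha> \<beta> by (auto simp: hom_def)
    then have *: "\<alpha> (i c) \<otimes>\<^bsub>?F\<^esub> inv\<^bsub>?F\<^esub> \<beta> (j c) = \<one>\<^bsub>?F\<^esub>" using rel by (simp add: \<alpha>_def \<beta>_def)
    show ?thesis using P.inv_equality[OF *] c' by simp
  qed
  have gen: "carrier ?F = generate ?F (\<alpha> ` carrier A \<union> \<beta> ` carrier B)"
  proof -
    have "pgen X R ` X = \<alpha> ` carrier A \<union> \<beta> ` carrier B"
      by (force simp: X_def \<alpha>_def \<beta>_def)
    then show ?thesis using carrier_generate by simp
  qed
  have "\<exists>\<pi>\<in>hom ?F H. \<forall>x\<in>X. \<pi> (pgen X R x) = case_sum fA fB x"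
  proof (rule universal[OF H])
    show "case_sum fA fB ` X \<subseteq> carrier H" using fA fB by (auto simp: X_def hom_def)
    fix r assume "r \<in> R"
    then consider "r \<in> table_relators Inl A" | "r \<in> table_relators Inr B" | "r \<in> RC" by (auto simp: R_def)
    then show "word_val H (case_sum fA fB) r = \<one>\<^bsub>H\<^esub>"
    proof cases
      case 1 then show ?thesis by (intro table_relators_val[OF A H fA _ 1]) simp
    next
      case 2 then show ?thesis by (intro table_relators_val[OF B H fB _ 2]) simp
    next
      case 3
      then obtain c where c: "c \<in> carrier C" "r = [(Inl (i c), True), (Inr (j c), False)]" by (auto simp: RC_def)
      have "fB (j c) \<in> carrier H" using c j fB by (auto simp: hom_def)
      then show ?thesis using c eq[of c] by simp
    qed
  qed
  then obtain \<pi> where \<pi>: "\<pi> \<in> hom ?F H" "\<And>x. x \<in> X \<Longrightarrow> \<pi> (pgen X R x) = case_sum fA fB x" by blast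
  have \<pi>A: "\<pi> (\<alpha> x) = fA x" if "x \<in> carrier A" for x 
    using \<pi>(2)[of "Inl x"] InlI[OF that, of "carrier B"] by (simp add: X_def \<alpha>_def)
  have \<pi>B: "\<pi> (\<beta> y) = fB y" if "y \<in> carrier B" for y 
    using \<pi>(2)[of "Inr y"] InrI[OF that, of "carrier A"] by (simp add: X_def \<beta>_def)
  show thesis
    by (rule that[of \<alpha> \<beta> \<pi>, unfolded F]) (fact P.group_axioms \<alpha> \<beta> gen \<pi>(1) | erule glue \<pi>A \<pi>B)+
qed

lemma free_product_universal:
  fixes A :: "('a, 'm) monoid_scheme" and B :: "('b, 'n) monoid_scheme" and H :: "('h, 'l) monoid_scheme"
  assumes A: "group A" and B: "group B" and H: "group H"
    and fA: "fA \<in> hom A H" and fB: "fB \<in> hom B H"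
  obtains \<alpha> \<beta> \<pi> where "group (free_product A B)"
    "\<alpha> \<in> hom A (free_product A B)" "\<beta> \<in> hom B (free_product A B)"
    "carrier (free_product A B) = generate (free_product A B) (\<alpha> ` carrier A \<union> \<beta> ` carrier B)"
    "\<pi> \<in> hom (free_product A B) H"
    "\<And>x. x \<in> carrier A \<Longrightarrow> \<pi> (\<alpha> x) = fA x" "\<And>y. y \<in> carrier B \<Longrightarrow> \<pi> (\<beta> y) = fB y"
proof -
  \<comment> \<open>This is no group: only the carrier of \<open>C\<close> is read, and with an
    empty carrier the gluing relators disappear.\<close>
  define C :: "unit monoid" where "C = \<lparr>carrier = {}, mult = \<lambda>x y. (), one = ()\<rparr>"
  have C: "carrier C = {}" by (simp add: C_def)
  have eq: "amalgam A B C i j = free_product A B" for i j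
    unfolding amalgam_def free_product_def by (simp add: C)
  show thesis
  proof (rule amalgam_universal[OF A B H _ _ fA fB, of undefined C undefined, unfolded eq])
  qed (use that in \<open>auto simp: C\<close>)
qed

lemma hnn_universal:
  fixes A :: "('a, 'm) monoid_scheme" and H :: "('h, 'l) monoid_scheme"
  assumes A: "group A" and H: "group H" and K: "K \<subseteq> carrier A" "\<phi> ` K \<subseteq> carrier A"
    and f: "f \<in> hom A H" and s: "s \<in> carrier H"
    and eq: "\<And>h. h \<in> K \<Longrightarrow> s \<otimes>\<^bsub>H\<^esub> f h \<otimes>\<^bsub>H\<^esub> inv\<^bsub>H\<^esub> s = f (\<phi> h)"
  obtains \<alpha> t \<pi> where "group (hnn_extension A K \<phi>)"
    "\<alpha> \<in> hom A (hnn_extension A K \<phi>)" "t \<in> carrier (hnn_extension A K \<phi>)"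
    "\<And>h. h \<in> K \<Longrightarrow> t \<otimes>\<^bsub>hnn_extension A K \<phi>\<^esub> \<alpha> h \<otimes>\<^bsub>hnn_extension A K \<phi>\<^esub> inv\<^bsub>hnn_extension A K \<phi>\<^esub> t = \<alpha> (\<phi> h)"
    "carrier (hnn_extension A K \<phi>) = generate (hnn_extension A K \<phi>) (insert t (\<alpha> ` carrier A))"
    "\<pi> \<in> hom (hnn_extension A K \<phi>) H"
    "\<And>x. x \<in> carrier A \<Longrightarrow> \<pi> (\<alpha> x) = f x" "\<pi> t = s"
proof -
  interpret A: group A by (rule A)
  interpret H: group H by (rule H)
  define X :: "'a option set" where "X = insert None (Some ` carrier A)"
  define RC where "RC = {[(None, True), (Some h, True), (None, False), (Some (\<phi> h), False)] | h. h \<in> K}"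
  define R where "R = table_relators Some A \<union> RC"
  let ?F = "presented X R"
  have F: "hnn_extension A K \<phi> = ?F" unfolding hnn_extension_def X_def R_def RC_def ..
  have RC: "RC \<subseteq> words X"
  proof -
    have "h \<in> carrier A \<and> \<phi> h \<in> carrier A" if "h \<in> K" for h using K that by blast
    then show ?thesis by (auto simp: RC_def X_def)
  qed
  interpret presentation X R
    by unfold_locales (use RC table_relators_words[OF A, of Some X] in \<open>auto simp: R_def X_def\<close>)
  define \<alpha> where "\<alpha> = (\<lambda>x. pgen X R (Some x))"
  define t where "t = pgen X R None"
  have \<alpha>: "\<alpha> \<in> hom A ?F" unfolding \<alpha>_def by (rule table_hom[OF A]) (auto simp: X_def R_def)
  have t: "t \<in> carrier ?F" unfolding t_def by (rule pgen_in) (simp add: X_def)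
  have glue: "t \<otimes>\<^bsub>?F\<^esub> \<alpha> h \<otimes>\<^bsub>?F\<^esub> inv\<^bsub>?F\<^esub> t = \<alpha> (\<phi> h)" if h: "h \<in> K" for h
  proof -
    have c: "\<alpha> h \<in> carrier ?F" "\<alpha> (\<phi> h) \<in> carrier ?F" using h K \<alpha> by (auto simp: hom_def)
    have "[(None, True), (Some h, True), (None, False), (Some (\<phi> h), False)] \<in> R" using h by (auto simp: R_def RC_def)
    from relator_val[OF this] have *: "t \<otimes>\<^bsub>?F\<^esub> \<alpha> h \<otimes>\<^bsub>?F\<^esub> inv\<^bsub>?F\<^esub> t \<otimes>\<^bsub>?F\<^esub> inv\<^bsub>?F\<^esub> \<alpha> (\<phi> h) = \<one>\<^bsub>?F\<^esub>"
      using c t by (simp add: \<alpha>_def[symmetric] t_def[symmetric] P.m_assoc) (simp add: \<alpha>_def t_def)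
    show ?thesis using P.inv_equality[OF *] c t by simp
  qed
  have gen: "carrier ?F = generate ?F (insert t (\<alpha> ` carrier A))"
  proof -
    have "pgen X R ` X = insert t (\<alpha> ` carrier A)" by (force simp: X_def \<alpha>_def t_def)
    then show ?thesis using carrier_generate by simp
  qed
  have "\<exists>\<pi>\<in>hom ?F H. \<forall>x\<in>X. \<pi> (pgen X R x) = case_option s f x"
  proof (rule universal[OF H])
    show "case_option s f ` X \<subseteq> carrier H" using f s by (auto simp: X_def hom_def)
    fix r assume "r \<in> R"
    then consider "r \<in> table_relators Some A" | "r \<in> RC" by (auto simp: R_def)
    then show "word_val H (case_option s f) r = \<one>\<^bsub>H\<^esub>"
    proof cases
      case 1 then show ?thesis by (intro table_relators_val[OF A H f _ 1]) simp
    next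
      case 2
      then obtain h where h: "h \<in> K" "r = [(None, True), (Some h, True), (None, False), (Some (\<phi> h), False)]"
        by (auto simp: RC_def)
      have "f h \<in> carrier H" "f (\<phi> h) \<in> carrier H" using h K f by (auto simp: hom_def)
      then have "s \<otimes>\<^bsub>H\<^esub> f h \<otimes>\<^bsub>H\<^esub> inv\<^bsub>H\<^esub> s \<otimes>\<^bsub>H\<^esub> inv\<^bsub>H\<^esub> f (\<phi> h) = \<one>\<^bsub>H\<^esub>" using eq[OF h(1)] by simp
      then show ?thesis using h s \<open>f h \<in> carrier H\<close> \<open>f (\<phi> h) \<in> carrier H\<close> by (simp add: H.m_assoc)
    qed
  qed
  then obtain \<pi> where \<pi>: "\<pi> \<in> hom ?F H" "\<And>x. x \<in> X \<Longrightarrow> \<pi> (pgen X R x) = case_option s f x" by blast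
  have \<pi>A: "\<pi> (\<alpha> x) = f x" if "x \<in> carrier A" for x using \<pi>(2)[of "Some x"] that by (simp add: X_def \<alpha>_def)
  have \<pi>t: "\<pi> t = s" using \<pi>(2)[of None] by (simp add: X_def t_def)
  show thesis
    by (rule that[of \<alpha> t \<pi>, unfolded F]) (fact P.group_axioms \<alpha> t gen \<pi>(1) \<pi>t | erule glue \<pi>A)+
qed

section \<open>Dihedral and cyclic factors\<close>

text \<open>\<open>y \<otimes> x\<close> is conjugate to \<open>x \<otimes> y\<close>. This is what
  allows a relator to be read from another starting letter.\<close>

lemma (in group) pow_mult_swap:
  assumes "x \<in> carrier G" "y \<in> carrier G" "(x \<otimes> y) [^] (n::nat) = \<one>"
  shows "(y \<otimes> x) [^] n = \<one>"
proof -
  have "(x \<otimes> y) [^] k \<otimes> x = x \<otimes> (y \<otimes> x) [^] k" for k :: nat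
  proof (induction k)
    case (Suc k)
    have "(x \<otimes> y) [^] Suc k \<otimes> x = ((x \<otimes> y) [^] k \<otimes> x) \<otimes> (y \<otimes> x)" using assms by (simp add: m_assoc)
    also have "\<dots> = x \<otimes> (y \<otimes> x) [^] Suc k" unfolding Suc using assms by (simp add: m_assoc)
    finally show ?case .
  qed (use assms in simp)
  from this[of n] have "x = x \<otimes> (y \<otimes> x) [^] n" using assms by simp
  then show ?thesis using assms by simp
qed

lemma (in group) involution_inv: "x \<in> carrier G \<Longrightarrow> x \<otimes> x = \<one> \<Longrightarrow> inv x = x"
  by (rule inv_equality)

lemma (in group) pow2_eq: "x \<in> carrier G \<Longrightarrow> x [^] (2::nat) = x \<otimes> x"
  by (simp add: numeral_2_eq_2)

lemma (in group) generate_closed: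
  assumes "S \<subseteq> carrier G" "U \<subseteq> generate G S"
  shows "generate G U \<subseteq> generate G S"
  by (rule generate_subgroup_incl[OF assms(2) generate_is_subgroup[OF assms(1)]])

lemma hom_image_generate:
  assumes "group A" "group F" "h \<in> hom A F" "carrier A = generate A S" "S \<subseteq> carrier A"
    and "h ` S \<subseteq> generate F U" "U \<subseteq> carrier F"
  shows "h ` carrier A \<subseteq> generate F U"
proof -
  interpret h: group_hom A F h using assms by (simp add: group_hom_def group_hom_axioms_def)
  have "h ` carrier A = generate F (h ` S)" using h.generate_img[OF assms(5)] assms(4) by simp
  then show ?thesis using h.H.generate_closed[OF assms(7,6)] by simp
qed

text \<open>The value \<open>n = 0\<close> stands for the infinite dihedral group: the power
  relation is then vacuous, and one statement serves both families.\<close>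

lemma dihedral_gens:
  fixes H :: "('h, 'l) monoid_scheme" and D :: "gen word set monoid"
  assumes D: "D = (if n = 0 then dihedral_inf else dihedral n)" and H: "group H" and xy: "x \<in> carrier H" "y \<in> carrier H"
    and rel: "y \<otimes>\<^bsub>H\<^esub> y = \<one>\<^bsub>H\<^esub>" "x [^]\<^bsub>H\<^esub> n = \<one>\<^bsub>H\<^esub>" "(y \<otimes>\<^bsub>H\<^esub> x) \<otimes>\<^bsub>H\<^esub> (y \<otimes>\<^bsub>H\<^esub> x) = \<one>\<^bsub>H\<^esub>"
  obtains \<rho> \<tau> \<phi> where "group D" "\<rho> \<in> carrier D" "\<tau> \<in> carrier D"
    "\<tau> \<otimes>\<^bsub>D\<^esub> \<tau> = \<one>\<^bsub>D\<^esub>" "\<rho> [^]\<^bsub>D\<^esub> n = \<one>\<^bsub>D\<^esub>"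
    "(\<tau> \<otimes>\<^bsub>D\<^esub> \<rho>) \<otimes>\<^bsub>D\<^esub> (\<tau> \<otimes>\<^bsub>D\<^esub> \<rho>) = \<one>\<^bsub>D\<^esub>"
    "carrier D = generate D {\<rho>, \<tau>}"
    "\<phi> \<in> hom D H" "\<phi> \<rho> = x" "\<phi> \<tau> = y"
proof -
  interpret H: group H by (rule H)
  define X where "X = {GenA, GenB}"
  define R where "R = {\<bb> \<^bold>^ 2, (\<bb> @ \<aa>) \<^bold>^ 2} \<union> (if n = 0 then {} else {\<aa> \<^bold>^ n})"
  have D: "D = presented X R"
    unfolding D dihedral_def dihedral_inf_def X_def R_def by (simp add: insert_commute)
  interpret presentation X R by unfold_locales (auto simp: X_def R_def)
  define \<rho> where "\<rho> = pgen X R GenA"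
  define \<tau> where "\<tau> = pgen X R GenB"
  have c: "\<rho> \<in> carrier (presented X R)" "\<tau> \<in> carrier (presented X R)"
    unfolding \<rho>_def \<tau>_def by (rule pgen_in, simp add: X_def)+
  have wv: "word_val K f (\<bb> \<^bold>^ 2) = f GenB \<otimes>\<^bsub>K\<^esub> f GenB"
    "word_val K f (\<aa> \<^bold>^ n) = f GenA [^]\<^bsub>K\<^esub> n"
    "word_val K f ((\<bb> @ \<aa>) \<^bold>^ 2) = (f GenB \<otimes>\<^bsub>K\<^esub> f GenA) \<otimes>\<^bsub>K\<^esub> (f GenB \<otimes>\<^bsub>K\<^esub> f GenA)"
    if K: "group K" and f: "f GenA \<in> carrier K" "f GenB \<in> carrier K" for K :: "('k, 'q) monoid_scheme" and f
  proof -
    interpret K: group K by (rule K)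
    have fX: "f ` X \<subseteq> carrier K" using f by (simp add: X_def)
    have w: "\<aa> \<in> words X" "\<bb> \<in> words X" "\<bb> @ \<aa> \<in> words X" by (simp_all add: X_def)
    show "word_val K f (\<bb> \<^bold>^ 2) = f GenB \<otimes>\<^bsub>K\<^esub> f GenB"
      "word_val K f (\<aa> \<^bold>^ n) = f GenA [^]\<^bsub>K\<^esub> n"
      "word_val K f ((\<bb> @ \<aa>) \<^bold>^ 2) = (f GenB \<otimes>\<^bsub>K\<^esub> f GenA) \<otimes>\<^bsub>K\<^esub> (f GenB \<otimes>\<^bsub>K\<^esub> f GenA)"
      unfolding K.word_val_wpow[OF fX w(1)] K.word_val_wpow[OF fX w(2)] K.word_val_wpow[OF fX w(3)]
      using f by (simp_all add: K.pow2_eq)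
  qed
  have r: "word_val (presented X R) (pgen X R) r = \<one>\<^bsub>presented X R\<^esub>" if "r \<in> R" for r
    using relator_val[OF that] .
  have rels: "\<tau> \<otimes>\<^bsub>presented X R\<^esub> \<tau> = \<one>\<^bsub>presented X R\<^esub>" "\<rho> [^]\<^bsub>presented X R\<^esub> n = \<one>\<^bsub>presented X R\<^esub>"
    "(\<tau> \<otimes>\<^bsub>presented X R\<^esub> \<rho>) \<otimes>\<^bsub>presented X R\<^esub> (\<tau> \<otimes>\<^bsub>presented X R\<^esub> \<rho>) = \<one>\<^bsub>presented X R\<^esub>"
  proof -
    have R: "\<bb> \<^bold>^ 2 \<in> R" "(\<bb> @ \<aa>) \<^bold>^ 2 \<in> R" "n \<noteq> 0 \<Longrightarrow> \<aa> \<^bold>^ n \<in> R" by (simp_all add: R_def)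
    note w = wv[OF P.group_axioms c[unfolded \<rho>_def \<tau>_def], folded \<rho>_def \<tau>_def]
    show "\<tau> \<otimes>\<^bsub>presented X R\<^esub> \<tau> = \<one>\<^bsub>presented X R\<^esub>"
      "(\<tau> \<otimes>\<^bsub>presented X R\<^esub> \<rho>) \<otimes>\<^bsub>presented X R\<^esub> (\<tau> \<otimes>\<^bsub>presented X R\<^esub> \<rho>) = \<one>\<^bsub>presented X R\<^esub>"
      using r[OF R(1)] r[OF R(2)] unfolding w .
    show "\<rho> [^]\<^bsub>presented X R\<^esub> n = \<one>\<^bsub>presented X R\<^esub>"
      using r[OF R(3)] unfolding w by (cases "n = 0") simp_all
  qed
  \<comment> \<open>The third value given to \<open>case_gen\<close> is a filler, since
    \<open>GenC\<close> is not among the generators \<open>X\<close>.\<close>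
  have "\<exists>\<phi>\<in>hom (presented X R) H. \<forall>z\<in>X. \<phi> (pgen X R z) = case_gen x y x z"
  proof (rule universal[OF H])
    show "case_gen x y x ` X \<subseteq> carrier H" using xy by (simp add: X_def)
    fix r assume "r \<in> R"
    then show "word_val H (case_gen x y x) r = \<one>\<^bsub>H\<^esub>"
      using wv[OF H, of "case_gen x y x"] xy rel by (auto simp: R_def split: if_splits)
  qed
  then obtain \<phi> where "\<phi> \<in> hom (presented X R) H" "\<phi> \<rho> = x" "\<phi> \<tau> = y"
    by (auto simp: X_def \<rho>_def \<tau>_def)
  moreover have "carrier (presented X R) = generate (presented X R) {\<rho>, \<tau>}"
    using carrier_generate by (simp add: X_def \<rho>_def \<tau>_def)
  ultimately show thesis
    using that[of \<rho> \<tau> \<phi>, unfolded D] P.group_axioms c rels by blast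
qed

lemma cyclic_hom:
  assumes "group H" "x \<in> carrier H" "x [^]\<^bsub>H\<^esub> n = \<one>\<^bsub>H\<^esub>" "n > 0"
  shows "(\<lambda>k. x [^]\<^bsub>H\<^esub> (k::int)) \<in> hom (cyclic n) H"
proof (rule homI)
  interpret group H by (rule assms)
  show "x [^]\<^bsub>H\<^esub> (k::int) \<in> carrier H" for k using assms(2) by simp
  fix j k assume "j \<in> carrier (cyclic n)" "k \<in> carrier (cyclic n)"
  have "ord x dvd n" using pow_eq_id[OF assms(2)] assms(3) by simp
  then have "int (ord x) dvd (j + k) mod int n - (j + k)"
    using dvd_trans[of "int (ord x)" "int n"] by (metis dvd_minus_mod dvd_minus_iff int_dvd_int_iff minus_diff_eq)
  then have "x [^]\<^bsub>H\<^esub> ((j + k) mod int n - (j + k)) = \<one>\<^bsub>H\<^esub>" using int_pow_eq_id[OF assms(2)] by simp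
  moreover have "x [^]\<^bsub>H\<^esub> ((j + k) mod int n)
      = x [^]\<^bsub>H\<^esub> ((j + k) mod int n - (j + k)) \<otimes>\<^bsub>H\<^esub> x [^]\<^bsub>H\<^esub> (j + k)"
    using assms(2) by (simp flip: int_pow_mult)
  ultimately show "x [^]\<^bsub>H\<^esub> (j \<otimes>\<^bsub>cyclic n\<^esub> k) = x [^]\<^bsub>H\<^esub> j \<otimes>\<^bsub>H\<^esub> x [^]\<^bsub>H\<^esub> k"
    using assms(2) by (simp add: int_pow_mult)
qed

text \<open>The generator is \<open>1 mod int n\<close> rather than 1 because for
  \<open>n = 1\<close> the carrier is \<open>{0}\<close>.\<close>

lemma cyclic_generator:
  assumes "n > 0"
  shows "1 mod int n \<in> carrier (cyclic n)" "carrier (cyclic n) = generate (cyclic n) {1 mod int n}"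
proof -
  interpret group "cyclic n" by simp
  show c: "1 mod int n \<in> carrier (cyclic n)" using assms by (simp add: carrier_integer_mod_group)
  show "carrier (cyclic n) = generate (cyclic n) {1 mod int n}"
  proof
    show "generate (cyclic n) {1 mod int n} \<subseteq> carrier (cyclic n)" using c by (intro generate_incl) simp
    show "carrier (cyclic n) \<subseteq> generate (cyclic n) {1 mod int n}"
    proof
      fix k assume k: "k \<in> carrier (cyclic n)"
      then have "(1 mod int n) [^]\<^bsub>cyclic n\<^esub> k = k"
        using assms by (simp add: int_pow_integer_mod_group carrier_integer_mod_group mod_mult_right_eq)
      then have "k \<in> {(1 mod int n) [^]\<^bsub>cyclic n\<^esub> j | j. j \<in> (UNIV :: int set)}"
        by (intro CollectI exI[of _ k]) simp
      then show "k \<in> generate (cyclic n) {1 mod int n}" using generate_pow[OF c] by simp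
    qed
  qed
qed

lemma cyclic_two_mon:
  assumes "group A" "x \<in> carrier A" "x \<otimes>\<^bsub>A\<^esub> x = \<one>\<^bsub>A\<^esub>" "x \<noteq> \<one>\<^bsub>A\<^esub>"
  shows "(\<lambda>k. x [^]\<^bsub>A\<^esub> (k::int)) \<in> mon (cyclic 2) A"
proof -
  interpret group A by (rule assms)
  have "(\<lambda>k. x [^]\<^bsub>A\<^esub> (k::int)) \<in> hom (cyclic 2) A"
    using assms by (intro cyclic_hom) (auto simp: pow2_eq)
  moreover have "carrier (cyclic 2) = {0, 1}" by (auto simp: carrier_integer_mod_group)
  ultimately show ?thesis using assms by (simp add: mon_def inj_on_def)
qed

text \<open>Every amalgamated product of the theorem has the form \<open>A *\<^bsub>\<langle>q\<rangle>\<^esub> D\<^bsub>2m\<^esub>\<close>, where the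
  involution \<open>q\<close> of \<open>A\<close> is glued to a reflection, so it is generated by \<open>A\<close> and one further
  reflection \<open>x\<close>.\<close>

lemma amalgam_dihedral:
  fixes A :: "('a, 'm) monoid_scheme" and G :: "('g, 'l) monoid_scheme"
  assumes A: "group A" and G: "group G" and f: "f \<in> hom A G"
    and q: "q \<in> carrier A" "q \<otimes>\<^bsub>A\<^esub> q = \<one>\<^bsub>A\<^esub>" "f q \<noteq> \<one>\<^bsub>G\<^esub>"
    and a: "a \<in> carrier G" "a \<otimes>\<^bsub>G\<^esub> a = \<one>\<^bsub>G\<^esub>" "(a \<otimes>\<^bsub>G\<^esub> f q) [^]\<^bsub>G\<^esub> m = \<one>\<^bsub>G\<^esub>" "m > 0"
  obtains F :: "('a + gen word set) word set monoid" and \<alpha> x \<pi> where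
    "group F" "G \<cong> F \<Longrightarrow> is_amalgam G A (cyclic 2) (dihedral m)"
    "\<alpha> \<in> hom A F" "x \<in> carrier F" "x \<otimes>\<^bsub>F\<^esub> x = \<one>\<^bsub>F\<^esub>" "(x \<otimes>\<^bsub>F\<^esub> \<alpha> q) [^]\<^bsub>F\<^esub> m = \<one>\<^bsub>F\<^esub>"
    "\<pi> \<in> hom F G" "\<And>y. y \<in> carrier A \<Longrightarrow> \<pi> (\<alpha> y) = f y" "\<pi> x = a"
    "\<And>U. U \<subseteq> carrier F \<Longrightarrow> x \<in> generate F U \<Longrightarrow> \<alpha> ` carrier A \<subseteq> generate F U \<Longrightarrow> carrier F \<subseteq> generate F U"
proof -
  interpret A: group A by (rule A)
  interpret G: group G by (rule G)
  interpret f: group_hom A G f using A G f by (simp add: group_hom_def group_hom_axioms_def)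
  let ?p = "f q"
  have p: "?p \<in> carrier G" "?p \<otimes>\<^bsub>G\<^esub> ?p = \<one>\<^bsub>G\<^esub>" 
  proof -
    have "?p \<otimes>\<^bsub>G\<^esub> ?p = f (q \<otimes>\<^bsub>A\<^esub> q)" using q(1) by simp
    then show "?p \<otimes>\<^bsub>G\<^esub> ?p = \<one>\<^bsub>G\<^esub>" unfolding q(2) by simp
  qed (use q(1) in simp)
  have rel: "(?p \<otimes>\<^bsub>G\<^esub> a) [^]\<^bsub>G\<^esub> m = \<one>\<^bsub>G\<^esub>" using G.pow_mult_swap[OF a(1) p(1) a(3)] .
  have ppa: "?p \<otimes>\<^bsub>G\<^esub> (?p \<otimes>\<^bsub>G\<^esub> a) = a" using p a by (simp flip: G.m_assoc)
  have pa: "?p \<otimes>\<^bsub>G\<^esub> a \<in> carrier G" using p a by simp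
  \<comment> \<open>\<open>\<tau>\<close> is the reflection that will be glued to \<open>q\<close>.
    The rotation \<open>\<rho>\<close> is sent to the product of \<open>f q\<close> and
    \<open>a\<close>, so that the other reflection, the product of \<open>\<tau>\<close> and
    \<open>\<rho>\<close>, goes to \<open>a\<close>.\<close>
  obtain \<rho> \<tau> g where B: "group (dihedral m)" and \<rho>: "\<rho> \<in> carrier (dihedral m)" and \<tau>: "\<tau> \<in> carrier (dihedral m)"
    and r\<tau>: "\<tau> \<otimes>\<^bsub>dihedral m\<^esub> \<tau> = \<one>\<^bsub>dihedral m\<^esub>" and r\<rho>: "\<rho> [^]\<^bsub>dihedral m\<^esub> m = \<one>\<^bsub>dihedral m\<^esub>"
    and r\<tau>\<rho>: "(\<tau> \<otimes>\<^bsub>dihedral m\<^esub> \<rho>) \<otimes>\<^bsub>dihedral m\<^esub> (\<tau> \<otimes>\<^bsub>dihedral m\<^esub> \<rho>) = \<one>\<^bsub>dihedral m\<^esub>"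
    and genB: "carrier (dihedral m) = generate (dihedral m) {\<rho>, \<tau>}"
    and g: "g \<in> hom (dihedral m) G" "g \<rho> = ?p \<otimes>\<^bsub>G\<^esub> a" "g \<tau> = ?p"
    by (rule dihedral_gens[OF _ G pa p(1) p(2) rel, unfolded ppa, OF _ a(2)], use a(4) in simp) (rule that; assumption)
  interpret B: group "dihedral m" by (rule B)
  interpret g: group_hom "dihedral m" G g using B G g by (simp add: group_hom_def group_hom_axioms_def)
  define i where "i = (\<lambda>k. q [^]\<^bsub>A\<^esub> (k::int))"
  define j where "j = (\<lambda>k. \<tau> [^]\<^bsub>dihedral m\<^esub> (k::int))"
  \<comment> \<open>The two embeddings of the group of order two are injective because the glued
    elements have the common nontrivial image \<open>f q\<close> in \<open>G\<close>.\<close>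
  have "q \<noteq> \<one>\<^bsub>A\<^esub>" using q(3) by auto
  then have i: "i \<in> mon (cyclic 2) A" unfolding i_def using q A by (intro cyclic_two_mon)
  have "\<tau> \<noteq> \<one>\<^bsub>dihedral m\<^esub>" using q(3) g(3) by auto
  then have j: "j \<in> mon (cyclic 2) (dihedral m)" unfolding j_def using \<tau> r\<tau> B by (intro cyclic_two_mon)
  let ?F = "amalgam A (dihedral m) (cyclic 2) i j"
  have ic: "i ` carrier (cyclic 2) \<subseteq> carrier A" "j ` carrier (cyclic 2) \<subseteq> carrier (dihedral m)"
    using i j by (auto simp: mon_def hom_def)
  have eq: "f (i k) = g (j k)" for k
    unfolding i_def j_def using q \<tau> g by (simp add: f.hom_int_pow g.hom_int_pow)
  obtain \<alpha> \<beta> \<pi> where F: "group ?F"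
    and \<alpha>: "\<alpha> \<in> hom A ?F" and \<beta>: "\<beta> \<in> hom (dihedral m) ?F"
    and glue: "\<And>c. c \<in> carrier (cyclic 2) \<Longrightarrow> \<alpha> (i c) = \<beta> (j c)"
    and gen: "carrier ?F = generate ?F (\<alpha> ` carrier A \<union> \<beta> ` carrier (dihedral m))"
    and \<pi>: "\<pi> \<in> hom ?F G" "\<And>x. x \<in> carrier A \<Longrightarrow> \<pi> (\<alpha> x) = f x" "\<And>y. y \<in> carrier (dihedral m) \<Longrightarrow> \<pi> (\<beta> y) = g y"
    by (rule amalgam_universal[OF A B G ic f g(1) eq]) (rule that; (assumption | simp))
  interpret F: group ?F by (rule F)
  interpret \<alpha>: group_hom A ?F \<alpha> using A F \<alpha> by (simp add: group_hom_def group_hom_axioms_def)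
  interpret \<beta>: group_hom "dihedral m" ?F \<beta> using B F \<beta> by (simp add: group_hom_def group_hom_axioms_def)
  have q\<tau>: "\<alpha> q = \<beta> \<tau>" using glue[of 1] q \<tau> by (simp add: i_def j_def carrier_integer_mod_group)
  define x where "x = \<beta> (\<tau> \<otimes>\<^bsub>dihedral m\<^esub> \<rho>)"
  have x: "x \<in> carrier ?F" using \<rho> \<tau> by (simp add: x_def)
  have \<rho>x: "\<beta> \<rho> = \<alpha> q \<otimes>\<^bsub>?F\<^esub> x"
    unfolding q\<tau> x_def using \<rho> \<tau> r\<tau> by (simp flip: \<beta>.hom_mult B.m_assoc)
  show thesis
  proof (rule that[of ?F \<alpha> x \<pi>])
    show "is_amalgam G A (cyclic 2) (dihedral m)" if "G \<cong> ?F" using that i j unfolding is_amalgam_def by blast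
    show "x \<otimes>\<^bsub>?F\<^esub> x = \<one>\<^bsub>?F\<^esub>" unfolding x_def using r\<tau>\<rho> \<rho> \<tau> by (simp flip: \<beta>.hom_mult)
    have "(\<alpha> q \<otimes>\<^bsub>?F\<^esub> x) [^]\<^bsub>?F\<^esub> m = \<one>\<^bsub>?F\<^esub>"
      unfolding \<rho>x[symmetric] using \<rho> r\<rho> by (simp flip: \<beta>.hom_nat_pow)
    then show "(x \<otimes>\<^bsub>?F\<^esub> \<alpha> q) [^]\<^bsub>?F\<^esub> m = \<one>\<^bsub>?F\<^esub>" using F.pow_mult_swap[of "\<alpha> q" x] x q by simp
    show "\<pi> x = a" unfolding x_def using \<pi>(3)[of "\<tau> \<otimes>\<^bsub>dihedral m\<^esub> \<rho>"] \<rho> \<tau> g ppa by simp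
    fix U assume U: "U \<subseteq> carrier ?F" "x \<in> generate ?F U" "\<alpha> ` carrier A \<subseteq> generate ?F U"
    have "\<alpha> q \<in> generate ?F U" using U(3) q by blast
    then have "\<beta> ` {\<rho>, \<tau>} \<subseteq> generate ?F U" using \<rho>x q\<tau> U(2) by (auto intro: generate.eng)
    from hom_image_generate[OF B F \<beta> genB _ this U(1)] \<rho> \<tau>
    have "\<beta> ` carrier (dihedral m) \<subseteq> generate ?F U" by simp
    then show "carrier ?F \<subseteq> generate ?F U" using F.generate_closed[OF U(1)] U(3) gen by simp
  qed (use F \<alpha> x \<pi> in auto)
qed

text \<open>By the relator, the product of the involutions \<open>b\<close> and
  \<open>a^-1 b a\<close> has order dividing \<open>n\<close>, so they span an image of the dihedral
  group. Conjugation by \<open>a\<close> carries the second to the first: \<open>a\<close> is the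
  image of the stable letter.\<close>

lemma hnn_dihedral:
  fixes G :: "('g, 'l) monoid_scheme"
  assumes G: "group G" and ab: "a \<in> carrier G" "b \<in> carrier G" and b: "b \<otimes>\<^bsub>G\<^esub> b = \<one>\<^bsub>G\<^esub>" "b \<noteq> \<one>\<^bsub>G\<^esub>"
    and rel: "(b \<otimes>\<^bsub>G\<^esub> (inv\<^bsub>G\<^esub> a \<otimes>\<^bsub>G\<^esub> b \<otimes>\<^bsub>G\<^esub> a)) [^]\<^bsub>G\<^esub> n = \<one>\<^bsub>G\<^esub>" and n: "n > 0"
  obtains F :: "gen word set option word set monoid" and A B \<pi> where
    "group F" "G \<cong> F \<Longrightarrow> is_hnn_extension G (dihedral n) (cyclic 2)"
    "A \<in> carrier F" "B \<in> carrier F" "B \<otimes>\<^bsub>F\<^esub> B = \<one>\<^bsub>F\<^esub>"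
    "(B \<otimes>\<^bsub>F\<^esub> (inv\<^bsub>F\<^esub> A \<otimes>\<^bsub>F\<^esub> B \<otimes>\<^bsub>F\<^esub> A)) [^]\<^bsub>F\<^esub> n = \<one>\<^bsub>F\<^esub>"
    "\<pi> \<in> hom F G" "\<pi> A = a" "\<pi> B = b" "carrier F \<subseteq> generate F {A, B}"
proof -
  interpret G: group G by (rule G)
  let ?D = "dihedral n"
  let ?q = "inv\<^bsub>G\<^esub> a \<otimes>\<^bsub>G\<^esub> b \<otimes>\<^bsub>G\<^esub> a"
  have q: "?q \<in> carrier G" "?q \<otimes>\<^bsub>G\<^esub> ?q = \<one>\<^bsub>G\<^esub>" "?q \<noteq> \<one>\<^bsub>G\<^esub>"
  proof -
    show "?q \<in> carrier G" using ab by simp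
    have "?q \<otimes>\<^bsub>G\<^esub> ?q = inv\<^bsub>G\<^esub> a \<otimes>\<^bsub>G\<^esub> (b \<otimes>\<^bsub>G\<^esub> (a \<otimes>\<^bsub>G\<^esub> inv\<^bsub>G\<^esub> a) \<otimes>\<^bsub>G\<^esub> b) \<otimes>\<^bsub>G\<^esub> a"
      using ab by (simp only: G.m_assoc G.m_closed G.inv_closed)
    then show "?q \<otimes>\<^bsub>G\<^esub> ?q = \<one>\<^bsub>G\<^esub>" using ab b by simp
    show "?q \<noteq> \<one>\<^bsub>G\<^esub>"
    proof
      assume "?q = \<one>\<^bsub>G\<^esub>"
      moreover have "b = a \<otimes>\<^bsub>G\<^esub> ?q \<otimes>\<^bsub>G\<^esub> inv\<^bsub>G\<^esub> a"
      proof -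
        have "a \<otimes>\<^bsub>G\<^esub> ?q \<otimes>\<^bsub>G\<^esub> inv\<^bsub>G\<^esub> a = (a \<otimes>\<^bsub>G\<^esub> inv\<^bsub>G\<^esub> a) \<otimes>\<^bsub>G\<^esub> b \<otimes>\<^bsub>G\<^esub> (a \<otimes>\<^bsub>G\<^esub> inv\<^bsub>G\<^esub> a)"
          using ab by (simp only: G.m_assoc G.m_closed G.inv_closed)
        then show ?thesis using ab by simp
      qed
      ultimately show False using ab b by simp
    qed
  qed
  have bbq: "b \<otimes>\<^bsub>G\<^esub> (b \<otimes>\<^bsub>G\<^esub> ?q) = ?q" using ab b q by (simp flip: G.m_assoc)
  have bq: "b \<otimes>\<^bsub>G\<^esub> ?q \<in> carrier G" using ab q by simp
  obtain \<rho> \<tau> g where D: "group ?D" and \<rho>: "\<rho> \<in> carrier ?D" and \<tau>: "\<tau> \<in> carrier ?D"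
    and r\<tau>: "\<tau> \<otimes>\<^bsub>?D\<^esub> \<tau> = \<one>\<^bsub>?D\<^esub>" and r\<rho>: "\<rho> [^]\<^bsub>?D\<^esub> n = \<one>\<^bsub>?D\<^esub>"
    and r\<tau>\<rho>: "(\<tau> \<otimes>\<^bsub>?D\<^esub> \<rho>) \<otimes>\<^bsub>?D\<^esub> (\<tau> \<otimes>\<^bsub>?D\<^esub> \<rho>) = \<one>\<^bsub>?D\<^esub>"
    and genD: "carrier ?D = generate ?D {\<rho>, \<tau>}"
    and g: "g \<in> hom ?D G" "g \<rho> = b \<otimes>\<^bsub>G\<^esub> ?q" "g \<tau> = b"
    by (rule dihedral_gens[OF _ G bq ab(2) b(1) rel, unfolded bbq, OF _ q(2)], use n in simp) (rule that; assumption)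
  interpret D: group ?D by (rule D)
  interpret g: group_hom ?D G g using D G g by (simp add: group_hom_def group_hom_axioms_def)
  \<comment> \<open>The second reflection, which lies over \<open>a^-1 b a\<close>; it spans the
    subgroup that the stable letter conjugates onto that of \<open>\<tau>\<close>.\<close>
  define \<sigma> where "\<sigma> = \<tau> \<otimes>\<^bsub>?D\<^esub> \<rho>"
  have \<sigma>: "\<sigma> \<in> carrier ?D" "\<sigma> \<otimes>\<^bsub>?D\<^esub> \<sigma> = \<one>\<^bsub>?D\<^esub>" "g \<sigma> = ?q"
    using \<rho> \<tau> r\<tau>\<rho> g bbq by (simp_all add: \<sigma>_def)
  have \<sigma>1: "\<sigma> \<noteq> \<one>\<^bsub>?D\<^esub>" using \<sigma>(3) q(3) by auto
  have \<tau>1: "\<tau> \<noteq> \<one>\<^bsub>?D\<^esub>" using g(3) b(2) by auto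
  define K where "K = {\<one>\<^bsub>?D\<^esub>, \<sigma>}"
  define \<phi> where "\<phi> h = (if h = \<one>\<^bsub>?D\<^esub> then \<one>\<^bsub>?D\<^esub> else \<tau>)" for h
  have KD: "K \<subseteq> carrier ?D" using \<sigma> by (simp add: K_def)
  have K: "subgroup K ?D"
    using \<sigma> D.involution_inv[OF \<sigma>(1,2)] by (intro D.subgroupI) (auto simp: K_def)
  have \<phi>: "\<phi> \<in> mon (?D\<lparr>carrier := K\<rparr>) ?D"
    using \<sigma> \<sigma>1 \<tau> \<tau>1 r\<tau> by (auto simp: mon_def hom_def inj_on_def \<phi>_def K_def)
  have isoK: "?D\<lparr>carrier := K\<rparr> \<cong> cyclic 2"
  proof -
    have m: "(\<lambda>k. \<sigma> [^]\<^bsub>?D\<^esub> (k::int)) \<in> mon (cyclic 2) ?D" using \<sigma> \<sigma>1 D by (intro cyclic_two_mon)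
    have im: "(\<lambda>k. \<sigma> [^]\<^bsub>?D\<^esub> (k::int)) ` carrier (cyclic 2) = K"
    proof -
      have "carrier (cyclic 2) = {0, 1}" by (auto simp: carrier_integer_mod_group)
      then show ?thesis using \<sigma>(1) by (simp add: K_def)
    qed
    have "(\<lambda>k. \<sigma> [^]\<^bsub>?D\<^esub> (k::int)) \<in> iso (cyclic 2) (?D\<lparr>carrier := K\<rparr>)"
      using m im by (auto simp: mon_def iso_def bij_betw_def hom_def)
    then have "cyclic 2 \<cong> ?D\<lparr>carrier := K\<rparr>" by (rule is_isoI)
    then show ?thesis by (rule group.iso_sym[OF group_integer_mod_group])
  qed
  let ?F = "hnn_extension ?D K \<phi>"
  have "a \<otimes>\<^bsub>G\<^esub> ?q \<otimes>\<^bsub>G\<^esub> inv\<^bsub>G\<^esub> a = (a \<otimes>\<^bsub>G\<^esub> inv\<^bsub>G\<^esub> a) \<otimes>\<^bsub>G\<^esub> b \<otimes>\<^bsub>G\<^esub> (a \<otimes>\<^bsub>G\<^esub> inv\<^bsub>G\<^esub> a)"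
    using ab by (simp only: G.m_assoc G.m_closed G.inv_closed)
  then have aqa: "a \<otimes>\<^bsub>G\<^esub> ?q \<otimes>\<^bsub>G\<^esub> inv\<^bsub>G\<^esub> a = b" using ab by simp
  have eq: "a \<otimes>\<^bsub>G\<^esub> g h \<otimes>\<^bsub>G\<^esub> inv\<^bsub>G\<^esub> a = g (\<phi> h)" if h: "h \<in> K" for h
    using h aqa ab \<sigma>(3) \<sigma>1 g(3) by (cases "h = \<one>\<^bsub>?D\<^esub>") (auto simp: K_def \<phi>_def)
  have \<phi>K: "\<phi> ` K \<subseteq> carrier ?D" using \<tau> by (auto simp: \<phi>_def K_def)
  obtain \<alpha> t \<pi> where F: "group ?F"
    and \<alpha>: "\<alpha> \<in> hom ?D ?F" and t: "t \<in> carrier ?F"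
    and glue: "\<And>h. h \<in> K \<Longrightarrow> t \<otimes>\<^bsub>?F\<^esub> \<alpha> h \<otimes>\<^bsub>?F\<^esub> inv\<^bsub>?F\<^esub> t = \<alpha> (\<phi> h)"
    and gen: "carrier ?F = generate ?F (insert t (\<alpha> ` carrier ?D))"
    and \<pi>: "\<pi> \<in> hom ?F G" "\<And>x. x \<in> carrier ?D \<Longrightarrow> \<pi> (\<alpha> x) = g x" "\<pi> t = a"
    by (rule hnn_universal[OF D G KD \<phi>K g(1) ab(1) eq], assumption) (rule that; (assumption | simp))
  interpret F: group ?F by (rule F)
  interpret \<alpha>: group_hom ?D ?F \<alpha> using D F \<alpha> by (simp add: group_hom_def group_hom_axioms_def)
  have "t \<otimes>\<^bsub>?F\<^esub> \<alpha> \<sigma> \<otimes>\<^bsub>?F\<^esub> inv\<^bsub>?F\<^esub> t = \<alpha> \<tau>" using glue[of \<sigma>] \<sigma>1 by (simp add: K_def \<phi>_def)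
  then have \<alpha>\<sigma>: "inv\<^bsub>?F\<^esub> t \<otimes>\<^bsub>?F\<^esub> \<alpha> \<tau> \<otimes>\<^bsub>?F\<^esub> t = \<alpha> \<sigma>"
  proof -
    assume *: "t \<otimes>\<^bsub>?F\<^esub> \<alpha> \<sigma> \<otimes>\<^bsub>?F\<^esub> inv\<^bsub>?F\<^esub> t = \<alpha> \<tau>"
    have "inv\<^bsub>?F\<^esub> t \<otimes>\<^bsub>?F\<^esub> (t \<otimes>\<^bsub>?F\<^esub> \<alpha> \<sigma> \<otimes>\<^bsub>?F\<^esub> inv\<^bsub>?F\<^esub> t) \<otimes>\<^bsub>?F\<^esub> t
      = (inv\<^bsub>?F\<^esub> t \<otimes>\<^bsub>?F\<^esub> t) \<otimes>\<^bsub>?F\<^esub> \<alpha> \<sigma> \<otimes>\<^bsub>?F\<^esub> (inv\<^bsub>?F\<^esub> t \<otimes>\<^bsub>?F\<^esub> t)"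
      using t \<sigma>(1) by (simp only: F.m_assoc F.m_closed F.inv_closed \<alpha>.hom_closed)
    then show ?thesis using * t \<sigma>(1) by simp
  qed
  have \<alpha>\<rho>: "\<alpha> \<tau> \<otimes>\<^bsub>?F\<^esub> \<alpha> \<sigma> = \<alpha> \<rho>"
    using \<rho> \<tau> r\<tau> by (simp add: \<sigma>_def flip: \<alpha>.hom_mult D.m_assoc)
  show thesis
  proof (rule that[of ?F t "\<alpha> \<tau>" \<pi>])
    show "is_hnn_extension G ?D (cyclic 2)" if "G \<cong> ?F"
      unfolding is_hnn_extension_def using K isoK \<phi> that by blast
    show "\<alpha> \<tau> \<otimes>\<^bsub>?F\<^esub> \<alpha> \<tau> = \<one>\<^bsub>?F\<^esub>" using \<tau> r\<tau> by (simp flip: \<alpha>.hom_mult)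
    show "(\<alpha> \<tau> \<otimes>\<^bsub>?F\<^esub> (inv\<^bsub>?F\<^esub> t \<otimes>\<^bsub>?F\<^esub> \<alpha> \<tau> \<otimes>\<^bsub>?F\<^esub> t)) [^]\<^bsub>?F\<^esub> n = \<one>\<^bsub>?F\<^esub>"
      unfolding \<alpha>\<sigma> \<alpha>\<rho> using \<rho> r\<rho> by (simp flip: \<alpha>.hom_nat_pow)
    let ?U = "{t, \<alpha> \<tau>}"
    have U: "?U \<subseteq> carrier ?F" using t \<tau> by simp
    have tU: "t \<in> generate ?F ?U" "\<alpha> \<tau> \<in> generate ?F ?U" "inv\<^bsub>?F\<^esub> t \<in> generate ?F ?U"
      by (auto intro: generate.incl generate.inv)
    have "\<alpha> \<rho> \<in> generate ?F ?U" unfolding \<alpha>\<rho>[symmetric] \<alpha>\<sigma>[symmetric] using tU by (intro generate.eng)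
    then have "\<alpha> ` {\<rho>, \<tau>} \<subseteq> generate ?F ?U" using tU by simp
    from hom_image_generate[OF D F \<alpha> genD _ this U] \<rho> \<tau>
    have "\<alpha> ` carrier ?D \<subseteq> generate ?F ?U" by simp
    then show "carrier ?F \<subseteq> generate ?F ?U" using F.generate_closed[OF U, of "insert t (\<alpha> ` carrier ?D)"] gen tU by simp
  qed (use F t \<tau> \<pi> g in auto)
qed

text \<open>The cyclic factor is generated by an element over \<open>b a\<close>, not over
  \<open>a\<close>. With the involution \<open>b\<close> one recovers \<open>a\<close> as
  \<open>b (b a)\<close>.\<close>

lemma free_product_cyclic:
  fixes G :: "('g, 'l) monoid_scheme"
  assumes G: "group G" and ab: "a \<in> carrier G" "b \<in> carrier G" and b: "b \<otimes>\<^bsub>G\<^esub> b = \<one>\<^bsub>G\<^esub>"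
    and rel: "(b \<otimes>\<^bsub>G\<^esub> a) [^]\<^bsub>G\<^esub> n = \<one>\<^bsub>G\<^esub>" and n: "n > 0"
  obtains A B \<pi> where "group (free_product (cyclic n) (cyclic 2))"
    "A \<in> carrier (free_product (cyclic n) (cyclic 2))" "B \<in> carrier (free_product (cyclic n) (cyclic 2))"
    "B \<otimes>\<^bsub>free_product (cyclic n) (cyclic 2)\<^esub> B = \<one>\<^bsub>free_product (cyclic n) (cyclic 2)\<^esub>"
    "(B \<otimes>\<^bsub>free_product (cyclic n) (cyclic 2)\<^esub> A) [^]\<^bsub>free_product (cyclic n) (cyclic 2)\<^esub> n
      = \<one>\<^bsub>free_product (cyclic n) (cyclic 2)\<^esub>"
    "\<pi> \<in> hom (free_product (cyclic n) (cyclic 2)) G" "\<pi> A = a" "\<pi> B = b"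
    "carrier (free_product (cyclic n) (cyclic 2)) \<subseteq> generate (free_product (cyclic n) (cyclic 2)) {A, B}"
proof -
  interpret G: group G by (rule G)
  let ?F = "free_product (cyclic n) (cyclic 2)"
  have c: "b \<otimes>\<^bsub>G\<^esub> a \<in> carrier G" using ab by simp
  have f: "(\<lambda>k. (b \<otimes>\<^bsub>G\<^esub> a) [^]\<^bsub>G\<^esub> (k::int)) \<in> hom (cyclic n) G" using cyclic_hom[OF G c rel n] .
  have h: "(\<lambda>k. b [^]\<^bsub>G\<^esub> (k::int)) \<in> hom (cyclic 2) G"
    using ab b by (intro cyclic_hom[OF G]) (auto simp: G.pow2_eq)
  obtain \<alpha> \<beta> \<pi> where F: "group ?F" and \<alpha>: "\<alpha> \<in> hom (cyclic n) ?F" and \<beta>: "\<beta> \<in> hom (cyclic 2) ?F"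
    and gen: "carrier ?F = generate ?F (\<alpha> ` carrier (cyclic n) \<union> \<beta> ` carrier (cyclic 2))"
    and \<pi>: "\<pi> \<in> hom ?F G" "\<And>x. x \<in> carrier (cyclic n) \<Longrightarrow> \<pi> (\<alpha> x) = (b \<otimes>\<^bsub>G\<^esub> a) [^]\<^bsub>G\<^esub> x"
      "\<And>y. y \<in> carrier (cyclic 2) \<Longrightarrow> \<pi> (\<beta> y) = b [^]\<^bsub>G\<^esub> y"
    by (rule free_product_universal[OF group_integer_mod_group group_integer_mod_group G f h]) (rule that; (assumption | simp))
  interpret F: group ?F by (rule F)
  interpret \<alpha>: group_hom "cyclic n" ?F \<alpha> using F \<alpha> by (simp add: group_hom_def group_hom_axioms_def)
  interpret \<beta>: group_hom "cyclic 2" ?F \<beta> using F \<beta> by (simp add: group_hom_def group_hom_axioms_def)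
  interpret \<pi>: group_hom ?F G \<pi> using F G \<pi> by (simp add: group_hom_def group_hom_axioms_def)
  \<comment> \<open>For \<open>n = 1\<close> this is 0, which agrees with the relation: there
    \<open>b a\<close> is trivial.\<close>
  define g where "g = 1 mod int n"
  have g: "g \<in> carrier (cyclic n)" "carrier (cyclic n) = generate (cyclic n) {g}"
    using cyclic_generator[OF n] by (simp_all add: g_def)
  have one: "(1::int) \<in> carrier (cyclic 2)" "carrier (cyclic 2) = generate (cyclic 2) {1}"
    using cyclic_generator[of 2] by simp_all
  have gn: "g [^]\<^bsub>cyclic n\<^esub> n = \<one>\<^bsub>cyclic n\<^esub>" by simp
  have "(b \<otimes>\<^bsub>G\<^esub> a) [^]\<^bsub>G\<^esub> g = b \<otimes>\<^bsub>G\<^esub> a"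
  proof (cases "n = 1")
    case True
    then show ?thesis using rel c by (simp add: g_def)
  next
    case False
    then have "g = 1" using n by (simp add: g_def)
    then show ?thesis using c by simp
  qed
  then have \<pi>g: "\<pi> (\<alpha> g) = b \<otimes>\<^bsub>G\<^esub> a" using \<pi>(2)[OF g(1)] by simp
  have \<pi>1: "\<pi> (\<beta> 1) = b" using \<pi>(3)[OF one(1)] ab by simp
  define B where "B = \<beta> 1"
  define A where "A = B \<otimes>\<^bsub>?F\<^esub> \<alpha> g"
  have B: "B \<in> carrier ?F" "B \<otimes>\<^bsub>?F\<^esub> B = \<one>\<^bsub>?F\<^esub>"
    using one(1) \<beta>.hom_one by (simp_all add: B_def flip: \<beta>.hom_mult)
  have BA: "B \<otimes>\<^bsub>?F\<^esub> A = \<alpha> g" using B g by (simp add: A_def flip: F.m_assoc)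
  show thesis
  proof (rule that[of A B \<pi>])
    show "(B \<otimes>\<^bsub>?F\<^esub> A) [^]\<^bsub>?F\<^esub> n = \<one>\<^bsub>?F\<^esub>"
      unfolding BA using \<alpha>.hom_nat_pow[OF g(1), of n] \<alpha>.hom_one gn by simp
    show A: "A \<in> carrier ?F" using B g by (simp add: A_def)
    show "\<pi> A = a" using B g \<pi>g \<pi>1 ab b by (simp add: A_def B_def flip: G.m_assoc)
    let ?U = "{A, B}"
    have U: "?U \<subseteq> carrier ?F" using A B by simp
    have AB: "A \<in> generate ?F ?U" "B \<in> generate ?F ?U" by (auto intro: generate.incl)
    have "\<alpha> g \<in> generate ?F ?U" unfolding BA[symmetric] using AB by (intro generate.eng)
    then have "\<alpha> ` carrier (cyclic n) \<subseteq> generate ?F ?U"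
      using hom_image_generate[OF group_integer_mod_group F \<alpha> g(2) _ _ U] g(1) by simp
    moreover have "\<beta> ` carrier (cyclic 2) \<subseteq> generate ?F ?U"
      using hom_image_generate[OF group_integer_mod_group F \<beta> one(2) _ _ U] one(1) AB by (simp add: B_def)
    ultimately show "carrier ?F \<subseteq> generate ?F ?U" using F.generate_closed[OF U] gen by simp
  qed (use F B \<pi> \<pi>1 in \<open>auto simp: B_def\<close>)
qed

section \<open>Recognising the group\<close>

text \<open>Conjugation by the reflection \<open>b\<close> is a homomorphism and inverts the
  rotation \<open>b c\<close>.\<close>

lemma (in group) involution_conj_pow:
  assumes "b \<in> carrier G" "c \<in> carrier G" "b \<otimes> b = \<one>" "c \<otimes> c = \<one>"
  shows "b \<otimes> (b \<otimes> c) [^] (k::int) = (b \<otimes> c) [^] (- k) \<otimes> b"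
proof -
  have bb: "b \<otimes> (b \<otimes> y) = y" if "y \<in> carrier G" for y
    using assms that by (simp flip: m_assoc)
  have h: "(\<lambda>x. b \<otimes> x \<otimes> b) \<in> hom G G"
    by (rule homI) (use assms bb in \<open>simp_all add: m_assoc\<close>)
  have i: "inv (b \<otimes> c) = c \<otimes> b"
    using assms by (simp add: inv_mult_group inv_equality)
  have "b \<otimes> (b \<otimes> c) [^] k \<otimes> b = (b \<otimes> (b \<otimes> c) \<otimes> b) [^] k"
    using hom_int_pow[OF h _ is_group is_group, of "b \<otimes> c" k] assms by simp
  also have "b \<otimes> (b \<otimes> c) \<otimes> b = inv (b \<otimes> c)" unfolding i using assms bb by simp
  also have "inv (b \<otimes> c) [^] k = (b \<otimes> c) [^] (- k)" using assms by (simp add: int_pow_inv int_pow_neg)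
  finally have "(b \<otimes> (b \<otimes> c) [^] k \<otimes> b) \<otimes> b = (b \<otimes> c) [^] (- k) \<otimes> b" by simp
  then show ?thesis using assms by (simp add: m_assoc)
qed

text \<open>Rotations and rotations times \<open>b\<close> are closed under multiplication by a
  letter from the left. Signed exponents make this uniform, since
  \<open>c = (b c)^-1 b\<close>.\<close>

lemma (in group) dihedral_word:
  assumes bc: "b \<in> carrier G" "c \<in> carrier G" "b \<otimes> b = \<one>" "c \<otimes> c = \<one>"
    and l: "l x = b" "l y = c" and u: "set u \<subseteq> {x, y}"
  shows "\<exists>k::int. word_prod G l u = (b \<otimes> c) [^] k \<or> word_prod G l u = (b \<otimes> c) [^] k \<otimes> b"
  using u
proof (induction u)
  case Nil
  have "word_prod G l [] = (b \<otimes> c) [^] (0::int)" by simp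
  then show ?case by blast
next
  case (Cons t u)
  let ?x = "b \<otimes> c"
  have x: "?x \<in> carrier G" using bc by simp
  obtain k :: int where k: "word_prod G l u = ?x [^] k \<or> word_prod G l u = ?x [^] k \<otimes> b" using Cons by auto
  note b1 = involution_conj_pow[OF bc]
  have b2: "b \<otimes> (?x [^] j \<otimes> b) = ?x [^] (- j)" for j :: int
  proof -
    have "b \<otimes> (?x [^] j \<otimes> b) = (b \<otimes> ?x [^] j) \<otimes> b" using bc x by (simp add: m_assoc)
    also have "\<dots> = ?x [^] (- j) \<otimes> (b \<otimes> b)" unfolding b1 using bc x by (simp add: m_assoc)
    finally show ?thesis using bc x by simp
  qed
  have "inv ?x = c \<otimes> b" using bc by (simp add: inv_mult_group inv_equality)
  then have c: "c = ?x [^] (-1::int) \<otimes> b" using bc x by (simp add: int_pow_neg m_assoc)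
  have c1: "c \<otimes> ?x [^] j = ?x [^] (- 1 - j) \<otimes> b" for j :: int
  proof -
    have "c \<otimes> ?x [^] j = ?x [^] (-1::int) \<otimes> (b \<otimes> ?x [^] j)"
      using bc x by (subst c) (simp add: m_assoc)
    also have "\<dots> = ?x [^] (-1::int) \<otimes> ?x [^] (- j) \<otimes> b" unfolding b1 using bc x by (simp add: m_assoc)
    finally show ?thesis using x by (simp flip: int_pow_mult)
  qed
  have c2: "c \<otimes> (?x [^] j \<otimes> b) = ?x [^] (- 1 - j)" for j :: int
  proof -
    have "c \<otimes> (?x [^] j \<otimes> b) = (c \<otimes> ?x [^] j) \<otimes> b" using bc x by (simp add: m_assoc)
    also have "\<dots> = ?x [^] (- 1 - j) \<otimes> (b \<otimes> b)" unfolding c1 using bc x by (simp add: m_assoc)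
    finally show ?thesis using bc x by simp
  qed
  have "t = x \<or> t = y" using Cons.prems by simp
  then have "l t = b \<or> l t = c" using l by auto
  then show ?case using k b1[of k] b2[of k] c1[of k] c2[of k] by auto
qed

text \<open>If \<open>b\<close> were a power of \<open>b c\<close>, it would both commute with
  \<open>b c\<close> and invert it. Then \<open>b c\<close> would square to \<open>\<one>\<close>,
  and \<open>b\<close> would be \<open>\<one>\<close> or \<open>b c\<close>. Hence a closed word in
  two involutive labels is always of rotation type.\<close>

lemma (in group) reflection_ne_one:
  assumes bc: "b \<in> carrier G" "c \<in> carrier G" "b \<otimes> b = \<one>" "c \<otimes> c = \<one>" "b \<noteq> \<one>" "c \<noteq> \<one>"
  shows "(b \<otimes> c) [^] (k::int) \<otimes> b \<noteq> \<one>"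
proof
  let ?x = "b \<otimes> c"
  assume 1: "?x [^] k \<otimes> b = \<one>"
  have x: "?x \<in> carrier G" using bc by simp
  have "inv b = ?x [^] k" by (rule inv_equality[OF 1]) (use bc x in auto)
  moreover have "inv b = b" using bc by (intro inv_equality) auto
  ultimately have b: "b = ?x [^] k" by simp
  have "b \<otimes> ?x = ?x \<otimes> b"
  proof -
    have "?x [^] k \<otimes> ?x [^] (1::int) = ?x [^] (1::int) \<otimes> ?x [^] k"
      using x by (simp only: add.commute flip: int_pow_mult)
    then show ?thesis using b x by simp
  qed
  moreover have "b \<otimes> ?x = ?x [^] (-1::int) \<otimes> b" using involution_conj_pow[OF bc(1-4), of 1] x by simp
  ultimately have "?x \<otimes> b = inv ?x \<otimes> b" using x by (simp add: int_pow_neg)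
  then have "?x = inv ?x" using bc x by simp
  then have xx: "?x \<otimes> ?x = \<one>" using x by (metis r_inv)
  have "?x [^] (k mod 2) = ?x [^] k"
  proof -
    have "?x [^] k = ?x [^] (2 * (k div 2) + k mod 2)" by simp
    also have "\<dots> = (?x [^] (2::int)) [^] (k div 2) \<otimes> ?x [^] (k mod 2)"
      unfolding int_pow_mult[OF x, of "2 * (k div 2)"] using x by (simp add: int_pow_pow)
    also have "?x [^] (2::int) = \<one>"
      using int_pow_mult[OF x, of 1 1] xx x by simp
    finally show ?thesis using x by simp
  qed
  moreover have "k mod 2 = 0 \<or> k mod 2 = 1" by auto
  ultimately have "b = \<one> \<or> b = ?x" using b x by auto
  then show False using bc by auto
qed

context cubic_cayley
begin

section \<open>Isomorphism criteria by the number of cut labels\<close>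

text \<open>A group over \<open>G\<close> generated by chosen lifts of the labels. For an
  isomorphism it remains to see that closed words are trivial in it.\<close>

definition lifting :: "('f, 'n) monoid_scheme \<Rightarrow> ('f \<Rightarrow> 'a) \<Rightarrow> ('a \<Rightarrow> 'f) \<Rightarrow> bool" where
  "lifting F \<pi> l \<longleftrightarrow> group F \<and> \<pi> \<in> hom F G \<and> carrier F \<subseteq> generate F (l ` T) \<and>
     (\<forall>t\<in>T. l t \<in> carrier F \<and> l (inv t) = inv\<^bsub>F\<^esub> l t \<and> \<pi> (l t) = t)"

lemma is_iso_lifting:
  assumes "generate G T = carrier G" "lifting F \<pi> l"
    and "\<And>w. set w \<subseteq> T \<Longrightarrow> pr w = \<one> \<Longrightarrow> word_prod F l w = \<one>\<^bsub>F\<^esub>"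
  shows "G \<cong> F"
proof -
  have "\<pi> \<in> iso F G"
    using assms by (intro lift_iso[of F l \<pi>]) (auto simp: lifting_def)
  then have "F \<cong> G" by (rule is_isoI)
  then show ?thesis using assms(2) group.iso_sym by (auto simp: lifting_def)
qed

lemma liftingD:
  assumes "lifting F \<pi> l"
  shows "group F" "\<And>t. t \<in> T \<Longrightarrow> l t \<in> carrier F" "\<And>t. t \<in> T \<Longrightarrow> l (inv t) = inv\<^bsub>F\<^esub> l t"
    "\<And>t. t \<in> T \<Longrightarrow> \<pi> (l t) = t" "group_hom F G \<pi>"
  using assms by (auto simp: lifting_def group_hom_def group_hom_axioms_def)

lemma lifting_word_prod:
  assumes L: "lifting F \<pi> l" and u: "set u \<subseteq> T"
  shows "word_prod F l u \<in> carrier F" "\<pi> (word_prod F l u) = pr u"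
proof -
  interpret F: group F by (rule liftingD[OF L])
  interpret \<pi>: group_hom F G \<pi> by (rule liftingD[OF L])
  have c: "word_prod F l v \<in> carrier F" if "set v \<subseteq> T" for v
    by (rule F.word_prod_closed) (use that liftingD(2)[OF L] in blast)
  show "word_prod F l u \<in> carrier F" by (rule c[OF u])
  show "\<pi> (word_prod F l u) = pr u" using u
  proof (induction u)
    case (Cons t u)
    then show ?case using c[of u] liftingD(2,4)[OF L, of t] by simp
  qed simp
qed

lemma noncut_words_const: "set w \<subseteq> T \<Longrightarrow> \<forall>t\<in>set w. \<not> cut_label t \<Longrightarrow>
    (\<And>s. cut_label s \<Longrightarrow> exit_at s = pr w) \<Longrightarrow> noncut_words (\<lambda>_. w)"
  by (simp add: noncut_words_def)

text \<open>With one cut label the round trips are the powers of \<open>s v\<close>, and those that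
  close in \<open>G\<close> have exponents divisible by its order. So one relator is enough besides
  the relations among the uncut labels.\<close>

lemma one_cut_iso:
  assumes gen: "generate G T = carrier G" and L: "lifting F \<pi> l"
    and s: "cut_label s" and only: "\<And>t. cut_label t \<Longrightarrow> t = s"
    and v: "set v \<subseteq> T - {s}" "pr v = exit_at s"
    and nc: "\<And>u. set u \<subseteq> T - {s} \<Longrightarrow> pr u = \<one> \<Longrightarrow> word_prod F l u = \<one>\<^bsub>F\<^esub>"
    and rel: "(l s \<otimes>\<^bsub>F\<^esub> word_prod F l v) [^]\<^bsub>F\<^esub> ord (s \<otimes> exit_at s) = \<one>\<^bsub>F\<^esub>"
  shows "G \<cong> F"
proof (rule is_iso_lifting[OF gen L])
  interpret F: group F by (rule liftingD[OF L])
  note oc = one_cut_label[OF s only]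
  have sT: "s \<in> T" "s \<in> carrier G" using s by auto
  have n: "next_label s = s" using oc by simp
  fix w assume w: "set w \<subseteq> T" "pr w = \<one>"
  show "word_prod F l w = \<one>\<^bsub>F\<^esub>"
  proof (rule closed_word_trivial[OF _ _ _ _ _ _ w])
    show "group F" "\<And>t. t \<in> T \<Longrightarrow> l t \<in> carrier F" "\<And>t. t \<in> T \<Longrightarrow> l (inv t) = inv\<^bsub>F\<^esub> l t"
      using liftingD[OF L] by auto
    show "noncut_words (\<lambda>_. v)"
    proof (rule noncut_words_const)
      show "set v \<subseteq> T" "\<forall>t\<in>set v. \<not> cut_label t" using v(1) only by auto
      show "exit_at t = pr v" if "cut_label t" for t using only[OF that] v(2) by simp
    qed
    show "word_prod F l u = \<one>\<^bsub>F\<^esub>" if "set u \<subseteq> T" "\<forall>t\<in>set u. \<not> cut_label t" "pr u = \<one>" for u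
      using that s by (intro nc) auto
    fix r k assume r: "cut_label r" and one: "pr (round_trip (\<lambda>_. v) k r) = \<one>"
    have rs: "r = s" by (rule only[OF r])
    have R: "round_trip (\<lambda>_. v) k r = concat (replicate k (s # v))" using round_trip_fixed[OF n] rs by simp
    have vT: "set (s # v) \<subseteq> T" using v sT by auto
    have "pr (concat (replicate k (s # v))) = pr (s # v) [^] k"
      by (rule word_prod_replicate) (use vT in auto)
    then have "(s \<otimes> exit_at s) [^] k = \<one>" using one R v(2) by simp
    moreover have "s \<otimes> exit_at s \<in> carrier G" using s sT by simp
    ultimately have "ord (s \<otimes> exit_at s) dvd k" by (simp add: pow_eq_id)
    then obtain j where j: "k = ord (s \<otimes> exit_at s) * j" by (auto elim: dvdE)
    have c: "word_prod F l v \<in> carrier F" "l s \<in> carrier F"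
      using lifting_word_prod(1)[OF L, of v] v sT liftingD(2)[OF L] by auto
    have "word_prod F l (concat (replicate k (s # v))) = word_prod F l (s # v) [^]\<^bsub>F\<^esub> k"
      by (rule F.word_prod_replicate) (use vT liftingD(2)[OF L] in blast)
    also have "\<dots> = ((l s \<otimes>\<^bsub>F\<^esub> word_prod F l v) [^]\<^bsub>F\<^esub> ord (s \<otimes> exit_at s)) [^]\<^bsub>F\<^esub> j"
      unfolding j using c by (simp add: F.nat_pow_pow)
    finally show "word_prod F l (round_trip (\<lambda>_. v) k r) = \<one>\<^bsub>F\<^esub>" unfolding R rel by simp
  qed
qed

text \<open>Uncut words are powers of \<open>b\<close> and are governed by
  \<open>b b = \<one>\<close>. Round trips either repeat their label or alternate between
  \<open>s\<close> and \<open>s'\<close>. In the second case a trip that returns to its first label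
  has an even number of steps and is a power of a double step.\<close>

lemma two_cut_iso:
  assumes gen: "generate G T = carrier G" and L: "lifting F \<pi> l"
    and T: "T = {b, s, s'}" "b \<noteq> s" "b \<noteq> s'" "s \<noteq> s'" and b: "b \<otimes> b = \<one>"
    and cut: "cut_label s" "cut_label s'" "\<not> cut_label b"
    and rel: "next_label s = s \<and> next_label s' = s' \<and>
        (l s \<otimes>\<^bsub>F\<^esub> l b) [^]\<^bsub>F\<^esub> ord (s \<otimes> b) = \<one>\<^bsub>F\<^esub> \<and> (l s' \<otimes>\<^bsub>F\<^esub> l b) [^]\<^bsub>F\<^esub> ord (s' \<otimes> b) = \<one>\<^bsub>F\<^esub> \<or>
      next_label s = s' \<and> next_label s' = s \<and>
        (l s \<otimes>\<^bsub>F\<^esub> l b \<otimes>\<^bsub>F\<^esub> (l s' \<otimes>\<^bsub>F\<^esub> l b)) [^]\<^bsub>F\<^esub> ord (s \<otimes> b \<otimes> (s' \<otimes> b)) = \<one>\<^bsub>F\<^esub> \<and>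
        (l s' \<otimes>\<^bsub>F\<^esub> l b \<otimes>\<^bsub>F\<^esub> (l s \<otimes>\<^bsub>F\<^esub> l b)) [^]\<^bsub>F\<^esub> ord (s' \<otimes> b \<otimes> (s \<otimes> b)) = \<one>\<^bsub>F\<^esub>"
  shows "G \<cong> F"
proof (rule is_iso_lifting[OF gen L])
  interpret F: group F by (rule liftingD[OF L])
  have c: "s \<in> carrier G" "s' \<in> carrier G" "b \<in> carrier G" "b \<noteq> \<one>" using T one_notin_T by auto
  have lc: "l s \<in> carrier F" "l s' \<in> carrier F" "l b \<in> carrier F" using liftingD(2)[OF L] T by auto
  have bi: "inv b = b" using c b by (intro inv_equality) auto
  have lb: "l b \<otimes>\<^bsub>F\<^esub> l b = \<one>\<^bsub>F\<^esub>" using liftingD(3)[OF L, of b] T(1) bi lc F.r_inv[of "l b"] by simp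
  have cutD: "t = s \<or> t = s'" if "cut_label t" for t using cut_labelD[OF that] that cut(3) T(1) by auto
  fix w assume w: "set w \<subseteq> T" "pr w = \<one>"
  show "word_prod F l w = \<one>\<^bsub>F\<^esub>"
  proof (rule closed_word_trivial[OF _ _ _ _ _ _ w])
    show "group F" "\<And>t. t \<in> T \<Longrightarrow> l t \<in> carrier F" "\<And>t. t \<in> T \<Longrightarrow> l (inv t) = inv\<^bsub>F\<^esub> l t"
      using liftingD[OF L] by auto
    show "noncut_words (\<lambda>_. [b])"
    proof (rule noncut_words_const)
      show "set [b] \<subseteq> T" "\<forall>t\<in>set [b]. \<not> cut_label t" using T(1) cut by auto
      show "exit_at t = pr [b]" if "cut_label t" for t
        using cutD[OF that] two_cut_labels(1,2)[OF T b cut] c by auto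
    qed
    show "word_prod F l u = \<one>\<^bsub>F\<^esub>" if u: "set u \<subseteq> T" "\<forall>t\<in>set u. \<not> cut_label t" "pr u = \<one>" for u
    proof -
      have "set u \<subseteq> {b}" using u(1,2) cut T(1) by auto
      then have "pr u = \<one> \<and> word_prod F l u = \<one>\<^bsub>F\<^esub> \<or> pr u = b \<and> word_prod F l u = l b"
        by (induction u) (use b lb c lc in auto)
      then show ?thesis using u(3) c by auto
    qed
    have fixed: "word_prod F l (round_trip (\<lambda>_. [b]) k r) = \<one>\<^bsub>F\<^esub>"
      if r: "r \<in> T" "next_label r = r" "(l r \<otimes>\<^bsub>F\<^esub> l b) [^]\<^bsub>F\<^esub> ord (r \<otimes> b) = \<one>\<^bsub>F\<^esub>"
        and one: "pr (round_trip (\<lambda>_. [b]) k r) = \<one>" for r k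
    proof -
      have R: "round_trip (\<lambda>_. [b]) k r = concat (replicate k [r, b])" using round_trip_fixed[OF r(2)] by simp
      have "pr (concat (replicate k [r, b])) = pr [r, b] [^] k"
        by (rule word_prod_replicate) (use r c in auto)
      then have "(r \<otimes> b) [^] k = \<one>" using one R c r by simp
      then have "ord (r \<otimes> b) dvd k" using c r by (simp add: pow_eq_id)
      then obtain j where j: "k = ord (r \<otimes> b) * j" by (auto elim: dvdE)
      have lr: "l r \<in> carrier F" using liftingD(2)[OF L r(1)] .
      have "word_prod F l (concat (replicate k [r, b])) = word_prod F l [r, b] [^]\<^bsub>F\<^esub> k"
        by (rule F.word_prod_replicate) (use lr lc in auto)
      also have "\<dots> = ((l r \<otimes>\<^bsub>F\<^esub> l b) [^]\<^bsub>F\<^esub> ord (r \<otimes> b)) [^]\<^bsub>F\<^esub> j"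
        unfolding j using lr lc by (simp add: F.nat_pow_pow)
      finally show ?thesis unfolding R r(3) by simp
    qed
    have swap: "word_prod F l (round_trip (\<lambda>_. [b]) k r) = \<one>\<^bsub>F\<^esub>"
      if r: "r \<in> T" "r' \<in> T" "next_label r = r'" "next_label r' = r" "r \<noteq> r'"
        "(l r \<otimes>\<^bsub>F\<^esub> l b \<otimes>\<^bsub>F\<^esub> (l r' \<otimes>\<^bsub>F\<^esub> l b)) [^]\<^bsub>F\<^esub> ord (r \<otimes> b \<otimes> (r' \<otimes> b)) = \<one>\<^bsub>F\<^esub>"
        and k: "(next_label ^^ k) r = r" and one: "pr (round_trip (\<lambda>_. [b]) k r) = \<one>" for r r' k
    proof -
      have "even k" using next_funpow_swap[OF r(3,4), of k] k r(5) by (auto split: if_splits)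
      then obtain i where i: "k = 2 * i" by (auto elim: evenE)
      have R: "round_trip (\<lambda>_. [b]) k r = concat (replicate i [r, b, r', b])"
        unfolding i using round_trip_swap[OF r(3,4), of "\<lambda>_. [b]" i] by simp
      have z: "r \<otimes> b \<otimes> (r' \<otimes> b) \<in> carrier G" using r c by simp
      have "pr (concat (replicate i [r, b, r', b])) = pr [r, b, r', b] [^] i"
        by (rule word_prod_replicate) (use r c in auto)
      then have "(r \<otimes> b \<otimes> (r' \<otimes> b)) [^] i = \<one>" using one R c r by (simp add: m_assoc)
      then have "ord (r \<otimes> b \<otimes> (r' \<otimes> b)) dvd i" using z by (simp only: pow_eq_id)
      then obtain j where j: "i = ord (r \<otimes> b \<otimes> (r' \<otimes> b)) * j" by (auto elim: dvdE)
      have lr: "l r \<in> carrier F" "l r' \<in> carrier F" using liftingD(2)[OF L] r by auto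
      have "word_prod F l (concat (replicate i [r, b, r', b])) = word_prod F l [r, b, r', b] [^]\<^bsub>F\<^esub> i"
        by (rule F.word_prod_replicate) (use lr lc in auto)
      also have "word_prod F l [r, b, r', b] = l r \<otimes>\<^bsub>F\<^esub> l b \<otimes>\<^bsub>F\<^esub> (l r' \<otimes>\<^bsub>F\<^esub> l b)"
        using lr lc by (simp add: F.m_assoc)
      also have "(l r \<otimes>\<^bsub>F\<^esub> l b \<otimes>\<^bsub>F\<^esub> (l r' \<otimes>\<^bsub>F\<^esub> l b)) [^]\<^bsub>F\<^esub> i
          = ((l r \<otimes>\<^bsub>F\<^esub> l b \<otimes>\<^bsub>F\<^esub> (l r' \<otimes>\<^bsub>F\<^esub> l b)) [^]\<^bsub>F\<^esub> ord (r \<otimes> b \<otimes> (r' \<otimes> b))) [^]\<^bsub>F\<^esub> j"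
        unfolding F.nat_pow_pow[OF F.m_closed[OF F.m_closed[OF lr(1) lc(3)] F.m_closed[OF lr(2) lc(3)]]] j ..
      finally show ?thesis unfolding R r(6) by simp
    qed
    fix r k assume r: "cut_label r" "(next_label ^^ k) r = r" "pr (round_trip (\<lambda>_. [b]) k r) = \<one>"
    have sT: "s \<in> T" "s' \<in> T" using T by auto
    from rel show "word_prod F l (round_trip (\<lambda>_. [b]) k r) = \<one>\<^bsub>F\<^esub>"
    proof (elim disjE conjE)
      assume "next_label s = s" "next_label s' = s'" "(l s \<otimes>\<^bsub>F\<^esub> l b) [^]\<^bsub>F\<^esub> ord (s \<otimes> b) = \<one>\<^bsub>F\<^esub>"
        "(l s' \<otimes>\<^bsub>F\<^esub> l b) [^]\<^bsub>F\<^esub> ord (s' \<otimes> b) = \<one>\<^bsub>F\<^esub>"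
      then show ?thesis using cutD[OF r(1)] fixed[OF sT(1)] fixed[OF sT(2)] r(3) by metis
    next
      assume *: "next_label s = s'" "next_label s' = s"
        "(l s \<otimes>\<^bsub>F\<^esub> l b \<otimes>\<^bsub>F\<^esub> (l s' \<otimes>\<^bsub>F\<^esub> l b)) [^]\<^bsub>F\<^esub> ord (s \<otimes> b \<otimes> (s' \<otimes> b)) = \<one>\<^bsub>F\<^esub>"
        "(l s' \<otimes>\<^bsub>F\<^esub> l b \<otimes>\<^bsub>F\<^esub> (l s \<otimes>\<^bsub>F\<^esub> l b)) [^]\<^bsub>F\<^esub> ord (s' \<otimes> b \<otimes> (s \<otimes> b)) = \<one>\<^bsub>F\<^esub>"
      from cutD[OF r(1)] show ?thesis
      proof
        assume "r = s"
        then show ?thesis using swap[OF sT *(1,2) T(4) *(3)] r by blast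
      next
        assume "r = s'"
        then show ?thesis using swap[OF sT(2,1) *(2,1) T(4)[symmetric] *(4)] r by blast
      qed
    qed
  qed
qed

end

lemma (in group) ord_mult_swap:
  assumes "x \<in> carrier G" "y \<in> carrier G" shows "ord (x \<otimes> y) = ord (y \<otimes> x)"
proof (rule dvd_antisym)
  have c: "x \<otimes> y \<in> carrier G" "y \<otimes> x \<in> carrier G" using assms by simp_all
  show "ord (x \<otimes> y) dvd ord (y \<otimes> x)"
    using pow_mult_swap[OF assms(2,1), of "ord (y \<otimes> x)"] c by (simp add: pow_eq_id)
  show "ord (y \<otimes> x) dvd ord (x \<otimes> y)"
    using pow_mult_swap[OF assms, of "ord (x \<otimes> y)"] c by (simp add: pow_eq_id)
qed

lemma (in group) reflection_square:
  assumes "b \<in> carrier G" "c \<in> carrier G" "b \<otimes> b = \<one>" "c \<otimes> c = \<one>"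
  shows "((b \<otimes> c) [^] (k::int) \<otimes> b) \<otimes> ((b \<otimes> c) [^] k \<otimes> b) = \<one>"
proof -
  have x: "b \<otimes> c \<in> carrier G" using assms by simp
  have "((b \<otimes> c) [^] k \<otimes> b) \<otimes> ((b \<otimes> c) [^] k \<otimes> b) = (b \<otimes> c) [^] k \<otimes> (b \<otimes> (b \<otimes> c) [^] k) \<otimes> b"
    using assms(1) x by (simp only: m_assoc m_closed int_pow_closed)
  also have "\<dots> = (b \<otimes> c) [^] k \<otimes> (b \<otimes> c) [^] (- k) \<otimes> (b \<otimes> b)"
    unfolding involution_conj_pow[OF assms] using assms(1) x by (simp only: m_assoc m_closed int_pow_closed)
  also have "\<dots> = \<one>" using assms x by (simp flip: int_pow_mult)
  finally show ?thesis .
qed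

section \<open>Candidate groups over \<open>G\<close>\<close>

text \<open>The common shape of presented groups and amalgams when all three labels are involutions;
  the criteria below see a candidate only through it. \<open>two_lift\<close> is the variant for an
  inverse pair and one involution.\<close>

definition three_lift ::
    "('f, 'n) monoid_scheme \<Rightarrow> ('g, 'm) monoid_scheme \<Rightarrow> ('f \<Rightarrow> 'g) \<Rightarrow> 'f \<Rightarrow> 'f \<Rightarrow> 'f \<Rightarrow> 'g \<Rightarrow> 'g \<Rightarrow> 'g \<Rightarrow> bool" where
  "three_lift F G \<pi> A B C a b c \<longleftrightarrow> group F \<and> \<pi> \<in> hom F G \<and>
     A \<in> carrier F \<and> B \<in> carrier F \<and> C \<in> carrier F \<and>
     A \<otimes>\<^bsub>F\<^esub> A = \<one>\<^bsub>F\<^esub> \<and> B \<otimes>\<^bsub>F\<^esub> B = \<one>\<^bsub>F\<^esub> \<and> C \<otimes>\<^bsub>F\<^esub> C = \<one>\<^bsub>F\<^esub> \<and>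
     \<pi> A = a \<and> \<pi> B = b \<and> \<pi> C = c \<and> carrier F \<subseteq> generate F {A, B, C}"

definition two_lift ::
    "('f, 'n) monoid_scheme \<Rightarrow> ('g, 'm) monoid_scheme \<Rightarrow> ('f \<Rightarrow> 'g) \<Rightarrow> 'f \<Rightarrow> 'f \<Rightarrow> 'g \<Rightarrow> 'g \<Rightarrow> bool" where
  "two_lift F G \<pi> A B a b \<longleftrightarrow> group F \<and> \<pi> \<in> hom F G \<and> A \<in> carrier F \<and> B \<in> carrier F \<and>
     B \<otimes>\<^bsub>F\<^esub> B = \<one>\<^bsub>F\<^esub> \<and> \<pi> A = a \<and> \<pi> B = b \<and> carrier F \<subseteq> generate F {A, B}"

lemma presented_three_lift:
  fixes G (structure)
  assumes G: "group G" and abc: "a \<in> carrier G" "b \<in> carrier G" "c \<in> carrier G"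
    and R: "R \<subseteq> words {GenA, GenB, GenC}" "{\<aa> \<^bold>^ 2, \<bb> \<^bold>^ 2, \<cc> \<^bold>^ 2} \<subseteq> R"
    and rel: "\<And>r. r \<in> R \<Longrightarrow> word_val G (case_gen a b c) r = \<one>"
  obtains \<pi> A B C where "three_lift (presented {GenA, GenB, GenC} R) G \<pi> A B C a b c"
    "\<And>r. r \<in> R \<Longrightarrow> word_val (presented {GenA, GenB, GenC} R) (case_gen A B C) r = \<one>\<^bsub>presented {GenA, GenB, GenC} R\<^esub>"
proof -
  define X where "X = {GenA, GenB, GenC}"
  interpret presentation X R by unfold_locales (use R in \<open>simp add: X_def\<close>)
  let ?P = "presented X R"
  define A B C where "A = pgen X R GenA" and "B = pgen X R GenB" and "C = pgen X R GenC"
  have f: "case_gen A B C = pgen X R"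
  proof
    fix x show "case_gen A B C x = pgen X R x" by (cases x) (simp_all add: A_def B_def C_def)
  qed
  have c: "A \<in> carrier ?P" "B \<in> carrier ?P" "C \<in> carrier ?P"
    unfolding A_def B_def C_def by (rule pgen_in, simp add: X_def)+
  have r: "word_val ?P (case_gen A B C) r = \<one>\<^bsub>?P\<^esub>" if "r \<in> R" for r
    unfolding f by (rule relator_val[OF that])
  have cX: "case_gen A B C ` X \<subseteq> carrier ?P" unfolding f by (rule pgen_closed)
  have sq: "word_val ?P (case_gen A B C) (w \<^bold>^ 2) = word_val ?P (case_gen A B C) w \<otimes>\<^bsub>?P\<^esub> word_val ?P (case_gen A B C) w"
    if "w \<in> words X" for w
    using P.word_val_wpow[OF cX that, of 2] P.word_val_closed[OF cX that] by (simp add: P.pow2_eq)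
  have w: "\<aa> \<in> words X" "\<bb> \<in> words X" "\<cc> \<in> words X" by (simp_all add: X_def)
  have sqs: "A \<otimes>\<^bsub>?P\<^esub> A = \<one>\<^bsub>?P\<^esub>" "B \<otimes>\<^bsub>?P\<^esub> B = \<one>\<^bsub>?P\<^esub>" "C \<otimes>\<^bsub>?P\<^esub> C = \<one>\<^bsub>?P\<^esub>"
    using sq[OF w(1)] sq[OF w(2)] sq[OF w(3)] r[of "\<aa> \<^bold>^ 2"] r[of "\<bb> \<^bold>^ 2"] r[of "\<cc> \<^bold>^ 2"] R(2) c
    by simp_all
  have "\<exists>\<phi>\<in>hom ?P G. \<forall>z\<in>X. \<phi> (pgen X R z) = case_gen a b c z"
    using universal[OF G, of "case_gen a b c"] abc rel by (simp add: X_def)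
  then obtain \<pi> where "\<pi> \<in> hom ?P G" "\<pi> A = a" "\<pi> B = b" "\<pi> C = c"
    by (auto simp: X_def A_def B_def C_def)
  moreover have "carrier ?P = generate ?P {A, B, C}"
    using carrier_generate by (simp add: X_def A_def B_def C_def)
  ultimately have "three_lift ?P G \<pi> A B C a b c"
    using P.group_axioms c sqs by (simp add: three_lift_def)
  then show thesis using that r unfolding X_def by blast
qed

lemma presented_two_lift:
  fixes G (structure)
  assumes G: "group G" and ab: "a \<in> carrier G" "b \<in> carrier G"
    and R: "R \<subseteq> words {GenA, GenB}" "\<bb> \<^bold>^ 2 \<in> R"
    and rel: "\<And>r. r \<in> R \<Longrightarrow> word_val G (case_gen a b a) r = \<one>"
  obtains \<pi> A B where "two_lift (presented {GenA, GenB} R) G \<pi> A B a b"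
    "\<And>r. r \<in> R \<Longrightarrow> word_val (presented {GenA, GenB} R) (case_gen A B A) r = \<one>\<^bsub>presented {GenA, GenB} R\<^esub>"
proof -
  define X where "X = {GenA, GenB}"
  interpret presentation X R by unfold_locales (use R in \<open>simp add: X_def\<close>)
  let ?P = "presented X R"
  define A B where "A = pgen X R GenA" and "B = pgen X R GenB"
  have c: "A \<in> carrier ?P" "B \<in> carrier ?P"
    unfolding A_def B_def by (rule pgen_in, simp add: X_def)+
  have "word_val ?P (case_gen A B A) w = word_val ?P (pgen X R) w" if "w \<in> words X" for w
    using that by (induction w) (auto simp: X_def A_def B_def letter_val_def words_def)
  then have r: "word_val ?P (case_gen A B A) r = \<one>\<^bsub>?P\<^esub>" if "r \<in> R" for r
    using relator_val[OF that] that R by (auto simp: X_def)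
  have cX: "case_gen A B A ` X \<subseteq> carrier ?P" using c by (simp add: X_def)
  have w: "\<bb> \<in> words X" by (simp add: X_def)
  have sq: "B \<otimes>\<^bsub>?P\<^esub> B = \<one>\<^bsub>?P\<^esub>"
    using P.word_val_wpow[OF cX w, of 2] r[OF R(2)] c by (simp add: P.pow2_eq)
  have "\<exists>\<phi>\<in>hom ?P G. \<forall>z\<in>X. \<phi> (pgen X R z) = case_gen a b a z"
    using universal[OF G, of "case_gen a b a"] ab rel by (simp add: X_def)
  then obtain \<pi> where "\<pi> \<in> hom ?P G" "\<pi> A = a" "\<pi> B = b"
    by (auto simp: X_def A_def B_def)
  moreover have "carrier ?P = generate ?P {A, B}"
    using carrier_generate by (simp add: X_def A_def B_def)
  ultimately have "two_lift ?P G \<pi> A B a b"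
    using P.group_axioms c sq by (simp add: two_lift_def)
  then show thesis using that r unfolding X_def by blast
qed

text \<open>The factor \<open>D\<close> supplies the reflections over \<open>b\<close> and
  \<open>c\<close>; the second factor, glued along \<open>q\<close>, supplies the involution over
  \<open>a\<close>.\<close>

lemma amalgam_three_lift:
  fixes D :: "('d, 'm) monoid_scheme" and G :: "('g, 'l) monoid_scheme"
  assumes D: "group D" and G: "group G" and f: "f \<in> hom D G"
    and \<rho>\<tau>: "\<rho> \<in> carrier D" "\<tau> \<in> carrier D" "\<tau> \<otimes>\<^bsub>D\<^esub> \<tau> = \<one>\<^bsub>D\<^esub>"
      "(\<tau> \<otimes>\<^bsub>D\<^esub> \<rho>) \<otimes>\<^bsub>D\<^esub> (\<tau> \<otimes>\<^bsub>D\<^esub> \<rho>) = \<one>\<^bsub>D\<^esub>"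
    and gD: "carrier D = generate D {\<rho>, \<tau>}"
    and bc: "b \<in> carrier G" "c \<in> carrier G" "b \<otimes>\<^bsub>G\<^esub> b = \<one>\<^bsub>G\<^esub>" "f \<rho> = b \<otimes>\<^bsub>G\<^esub> c" "f \<tau> = b"
    and q: "q \<in> carrier D" "q \<otimes>\<^bsub>D\<^esub> q = \<one>\<^bsub>D\<^esub>" "f q \<noteq> \<one>\<^bsub>G\<^esub>"
    and a: "a \<in> carrier G" "a \<otimes>\<^bsub>G\<^esub> a = \<one>\<^bsub>G\<^esub>" "(a \<otimes>\<^bsub>G\<^esub> f q) [^]\<^bsub>G\<^esub> m = \<one>\<^bsub>G\<^esub>" "m > 0"
  obtains F :: "('d + gen word set) word set monoid" and \<alpha> \<pi> x where
    "G \<cong> F \<Longrightarrow> is_amalgam G D (cyclic 2) (dihedral m)"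
    "three_lift F G \<pi> x (\<alpha> \<tau>) (\<alpha> (\<tau> \<otimes>\<^bsub>D\<^esub> \<rho>)) a b c" "group_hom D F \<alpha>"
    "(x \<otimes>\<^bsub>F\<^esub> \<alpha> q) [^]\<^bsub>F\<^esub> m = \<one>\<^bsub>F\<^esub>" "\<alpha> \<tau> \<otimes>\<^bsub>F\<^esub> \<alpha> (\<tau> \<otimes>\<^bsub>D\<^esub> \<rho>) = \<alpha> \<rho>"
proof -
  interpret D: group D by (rule D)
  interpret G: group G by (rule G)
  interpret f: group_hom D G f using D G f by (simp add: group_hom_def group_hom_axioms_def)
  obtain F :: "('d + gen word set) word set monoid" and \<alpha> x \<pi> where F: "group F"
    and am: "G \<cong> F \<Longrightarrow> is_amalgam G D (cyclic 2) (dihedral m)"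
    and \<alpha>: "\<alpha> \<in> hom D F" and x: "x \<in> carrier F" "x \<otimes>\<^bsub>F\<^esub> x = \<one>\<^bsub>F\<^esub>" "(x \<otimes>\<^bsub>F\<^esub> \<alpha> q) [^]\<^bsub>F\<^esub> m = \<one>\<^bsub>F\<^esub>"
    and \<pi>: "\<pi> \<in> hom F G" "\<And>y. y \<in> carrier D \<Longrightarrow> \<pi> (\<alpha> y) = f y" "\<pi> x = a"
    and gen: "\<And>U. U \<subseteq> carrier F \<Longrightarrow> x \<in> generate F U \<Longrightarrow> \<alpha> ` carrier D \<subseteq> generate F U \<Longrightarrow> carrier F \<subseteq> generate F U"
    by (rule amalgam_dihedral[OF D G f q a]) (rule that; (assumption | blast))
  interpret F: group F by (rule F)
  interpret \<alpha>: group_hom D F \<alpha> using D F \<alpha> by (simp add: group_hom_def group_hom_axioms_def)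
  have eq: "\<alpha> \<tau> \<otimes>\<^bsub>F\<^esub> \<alpha> (\<tau> \<otimes>\<^bsub>D\<^esub> \<rho>) = \<alpha> \<rho>"
    using \<rho>\<tau> by (simp flip: \<alpha>.hom_mult D.m_assoc)
  have sq: "\<alpha> \<tau> \<otimes>\<^bsub>F\<^esub> \<alpha> \<tau> = \<one>\<^bsub>F\<^esub>" "\<alpha> (\<tau> \<otimes>\<^bsub>D\<^esub> \<rho>) \<otimes>\<^bsub>F\<^esub> \<alpha> (\<tau> \<otimes>\<^bsub>D\<^esub> \<rho>) = \<one>\<^bsub>F\<^esub>"
    using \<rho>\<tau> \<alpha>.hom_mult[of \<tau> \<tau>, symmetric] \<alpha>.hom_mult[of "\<tau> \<otimes>\<^bsub>D\<^esub> \<rho>" "\<tau> \<otimes>\<^bsub>D\<^esub> \<rho>", symmetric] \<alpha>.hom_one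
    by (simp_all del: \<alpha>.hom_mult)
  have bbc: "b \<otimes>\<^bsub>G\<^esub> (b \<otimes>\<^bsub>G\<^esub> c) = c" using bc by (simp flip: G.m_assoc)
  have \<pi>c: "\<pi> (\<alpha> (\<tau> \<otimes>\<^bsub>D\<^esub> \<rho>)) = c" using \<pi>(2)[of "\<tau> \<otimes>\<^bsub>D\<^esub> \<rho>"] \<rho>\<tau> bc bbc by simp
  let ?U = "{x, \<alpha> \<tau>, \<alpha> (\<tau> \<otimes>\<^bsub>D\<^esub> \<rho>)}"
  have U: "?U \<subseteq> carrier F" using x \<rho>\<tau> by simp
  have UU: "x \<in> generate F ?U" "\<alpha> \<tau> \<in> generate F ?U" "\<alpha> (\<tau> \<otimes>\<^bsub>D\<^esub> \<rho>) \<in> generate F ?U"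
    by (auto intro: generate.incl)
  have "\<alpha> \<rho> \<in> generate F ?U" unfolding eq[symmetric] using UU by (intro generate.eng)
  then have "\<alpha> ` {\<rho>, \<tau>} \<subseteq> generate F ?U" using UU by simp
  from hom_image_generate[OF D F \<alpha> gD _ this U] \<rho>\<tau>
  have "\<alpha> ` carrier D \<subseteq> generate F ?U" by simp
  from gen[OF U UU(1) this] have "carrier F \<subseteq> generate F ?U" .
  then have "three_lift F G \<pi> x (\<alpha> \<tau>) (\<alpha> (\<tau> \<otimes>\<^bsub>D\<^esub> \<rho>)) a b c"
    unfolding three_lift_def using F \<pi> x sq \<pi>c \<rho>\<tau> bc by simp
  then show thesis using that[OF am _ _ x(3) eq] \<alpha>.group_hom_axioms by blast
qed

context cubic_cayley
begin

lemma three_lift_lifting: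
  assumes T: "T = {a, b, c}" "a \<noteq> b" "a \<noteq> c" "b \<noteq> c" and sq: "a \<otimes> a = \<one>" "b \<otimes> b = \<one>" "c \<otimes> c = \<one>"
    and L: "three_lift F G \<pi> A B C a b c"
  shows "\<exists>l. lifting F \<pi> l \<and> l a = A \<and> l b = B \<and> l c = C"
proof -
  interpret F: group F using L by (simp add: three_lift_def)
  define l where "l = (\<lambda>t. if t = a then A else if t = b then B else C)"
  have l: "l a = A" "l b = B" "l c = C" using T by (auto simp: l_def)
  have i: "inv a = a" "inv b = b" "inv c = c" using T(1) sq by (auto intro!: inv_equality)
  have I: "inv\<^bsub>F\<^esub> A = A" "inv\<^bsub>F\<^esub> B = B" "inv\<^bsub>F\<^esub> C = C"
    using L unfolding three_lift_def by (auto intro!: F.inv_equality)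
  have "lifting F \<pi> l"
    unfolding lifting_def using L l i I unfolding three_lift_def T(1) by simp
  then show ?thesis using l by blast
qed

lemma two_lift_lifting:
  assumes T: "T = {a, inv a, b}" "a \<noteq> inv a" "a \<noteq> b" "inv a \<noteq> b" and sq: "b \<otimes> b = \<one>"
    and L: "two_lift F G \<pi> A B a b"
  shows "\<exists>l. lifting F \<pi> l \<and> l a = A \<and> l (inv a) = inv\<^bsub>F\<^esub> A \<and> l b = B"
proof -
  have G': "group G" by (rule is_group)
  interpret F: group F using L by (simp add: two_lift_def)
  interpret \<pi>: group_hom F G \<pi> using L G' by (simp add: two_lift_def group_hom_def group_hom_axioms_def)
  define l where "l = (\<lambda>t. if t = a then A else if t = b then B else inv\<^bsub>F\<^esub> A)"
  have l: "l a = A" "l b = B" "l (inv a) = inv\<^bsub>F\<^esub> A" using T by (auto simp: l_def)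
  have c: "a \<in> carrier G" "b \<in> carrier G" using T(1) by auto
  have i: "inv b = b" "inv (inv a) = a" using c sq by (auto intro!: inv_equality)
  have A: "A \<in> carrier F" "B \<in> carrier F" "\<pi> A = a" "\<pi> B = b" using L by (auto simp: two_lift_def)
  have I: "inv\<^bsub>F\<^esub> B = B" "inv\<^bsub>F\<^esub> (inv\<^bsub>F\<^esub> A) = A"
    using L A unfolding two_lift_def by (auto intro!: F.inv_equality)
  have g: "carrier F \<subseteq> generate F {A, inv\<^bsub>F\<^esub> A, B}"
  proof -
    have "generate F {A, B} \<subseteq> generate F {A, inv\<^bsub>F\<^esub> A, B}" by (rule F.mono_generate) auto
    then show ?thesis using L by (auto simp: two_lift_def)
  qed
  have "lifting F \<pi> l"
    unfolding lifting_def using L l i I A g \<pi>.hom_inv[OF A(1)] unfolding two_lift_def T(1) by simp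
  then show ?thesis using l by blast
qed

end

lemma three_lift_swap: "three_lift F G \<pi> A B C a b c \<Longrightarrow> three_lift F G \<pi> C B A c b a"
  unfolding three_lift_def by (auto simp: insert_commute)

context group begin

lemma gen_word_val:
  assumes "a \<in> carrier G" "b \<in> carrier G" "c \<in> carrier G"
  shows "word_val G (case_gen a b c) w \<in> carrier G"
    "word_val G (case_gen a b c) (u @ v) = word_val G (case_gen a b c) u \<otimes> word_val G (case_gen a b c) v"
    "word_val G (case_gen a b c) (w \<^bold>^ n) = word_val G (case_gen a b c) w [^] n"
proof -
  have f: "case_gen a b c ` UNIV \<subseteq> carrier G" using assms by (auto split: gen.split)
  have w: "w \<in> words UNIV" for w :: "gen word" by (simp add: words_def)
  show "word_val G (case_gen a b c) w \<in> carrier G"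
    by (rule word_val_closed[OF f w])
  show "word_val G (case_gen a b c) (u @ v) = word_val G (case_gen a b c) u \<otimes> word_val G (case_gen a b c) v"
    by (rule word_val_append[OF f w w])
  show "word_val G (case_gen a b c) (w \<^bold>^ n) = word_val G (case_gen a b c) w [^] n"
    by (rule word_val_wpow[OF f w])
qed

text \<open>A cyclic group has at most one involution, and it is the power of a generator by half
  its order.\<close>

lemma involution_power:
  assumes x: "x \<in> carrier G" and sq: "x [^] (k::int) \<otimes> x [^] k = \<one>" and ne: "x [^] k \<noteq> \<one>"
  obtains n :: nat where "n > 0" "ord x = 2 * n" "x [^] k = x [^] n"
proof -
  have "x [^] (2 * k) = x [^] k \<otimes> x [^] k" unfolding mult_2 by (rule int_pow_mult[OF x])
  then have "x [^] (2 * k) = \<one>" using sq by simp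
  then have d: "int (ord x) dvd 2 * k" using int_pow_eq_id[OF x] by simp
  have nd: "\<not> int (ord x) dvd k" using ne int_pow_eq_id[OF x] by simp
  have "even (ord x)"
  proof (rule ccontr)
    assume "odd (ord x)"
    then have "coprime (int (ord x)) 2" by simp
    then show False using d nd coprime_dvd_mult_right_iff by blast
  qed
  then obtain n where n: "ord x = 2 * n" by (auto elim: evenE)
  then have "int n dvd k" using d by simp
  then obtain j where j: "k = int n * j" by (auto elim: dvdE)
  have "odd j"
  proof
    assume "even j"
    then show False using nd n j by (auto elim: evenE)
  qed
  then obtain i where i: "j = 2 * i + 1" by (auto elim: oddE)
  have "k - int n = int (ord x) * i" unfolding j n i by (simp add: algebra_simps)
  then have "x [^] (k - int n) = \<one>" using int_pow_eq_id[OF x] by simp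
  moreover have "x [^] k = x [^] (k - int n) \<otimes> x [^] int n" using x by (simp flip: int_pow_mult)
  ultimately have "x [^] k = x [^] n" using x by (simp add: int_pow_int)
  \<comment> \<open>Infinite order is excluded here: there \<open>ord x\<close> is zero, hence so
    are \<open>n\<close> and \<open>k\<close>.\<close>
  moreover have "n \<noteq> 0"
  proof
    assume "n = 0" then have "k = 0" using j by simp
    then show False using ne by simp
  qed
  ultimately show thesis using that n by blast
qed

end

context cubic_cayley
begin

section \<open>Relators that suffice for each pattern of labels\<close>

lemma iso_two_fixed:
  assumes gen: "generate G T = carrier G"
    and T: "T = {b, s, s'}" "b \<noteq> s" "b \<noteq> s'" "s \<noteq> s'" and sq: "b \<otimes> b = \<one>" "s \<otimes> s = \<one>" "s' \<otimes> s' = \<one>"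
    and cut: "cut_label s" "cut_label s'" "\<not> cut_label b" and n: "next_label s = s" "next_label s' = s'"
    and L: "three_lift F G \<pi> A B C s b s'"
    and rel: "(B \<otimes>\<^bsub>F\<^esub> A) [^]\<^bsub>F\<^esub> ord (s \<otimes> b) = \<one>\<^bsub>F\<^esub>" "(B \<otimes>\<^bsub>F\<^esub> C) [^]\<^bsub>F\<^esub> ord (s' \<otimes> b) = \<one>\<^bsub>F\<^esub>"
  shows "G \<cong> F"
proof -
  have T': "T = {s, b, s'}" using T(1) by auto
  obtain l where l: "lifting F \<pi> l" "l s = A" "l b = B" "l s' = C"
    using three_lift_lifting[OF T' T(2)[symmetric] T(4,3) sq(2,1,3) L] by blast
  interpret F: group F using L by (simp add: three_lift_def)
  have c: "A \<in> carrier F" "B \<in> carrier F" "C \<in> carrier F" using L by (auto simp: three_lift_def)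
  show ?thesis
    using two_cut_iso[OF gen l(1) T sq(1) cut] n l F.pow_mult_swap[OF c(2,1) rel(1)] F.pow_mult_swap[OF c(2,3) rel(2)]
    by simp
qed

text \<open>The relator for trips that start at \<open>s'\<close> is a rotation of the one for trips
  that start at \<open>s\<close>, so a single relator covers both.\<close>

lemma iso_two_swapped:
  assumes gen: "generate G T = carrier G"
    and T: "T = {b, s, s'}" "b \<noteq> s" "b \<noteq> s'" "s \<noteq> s'" and sq: "b \<otimes> b = \<one>" "s \<otimes> s = \<one>" "s' \<otimes> s' = \<one>"
    and cut: "cut_label s" "cut_label s'" "\<not> cut_label b" and n: "next_label s = s'" "next_label s' = s"
    and L: "three_lift F G \<pi> A B C s b s'"
    and rel: "(A \<otimes>\<^bsub>F\<^esub> (B \<otimes>\<^bsub>F\<^esub> C \<otimes>\<^bsub>F\<^esub> B)) [^]\<^bsub>F\<^esub> ord (s \<otimes> b \<otimes> (s' \<otimes> b)) = \<one>\<^bsub>F\<^esub>"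
  shows "G \<cong> F"
proof -
  have T': "T = {s, b, s'}" using T(1) by auto
  obtain l where l: "lifting F \<pi> l" "l s = A" "l b = B" "l s' = C"
    using three_lift_lifting[OF T' T(2)[symmetric] T(4,3) sq(2,1,3) L] by blast
  interpret F: group F using L by (simp add: three_lift_def)
  have c: "A \<in> carrier F" "B \<in> carrier F" "C \<in> carrier F" using L by (auto simp: three_lift_def)
  have "A \<otimes>\<^bsub>F\<^esub> (B \<otimes>\<^bsub>F\<^esub> C \<otimes>\<^bsub>F\<^esub> B) = A \<otimes>\<^bsub>F\<^esub> B \<otimes>\<^bsub>F\<^esub> (C \<otimes>\<^bsub>F\<^esub> B)" using c by (simp add: F.m_assoc)
  then have 1: "(A \<otimes>\<^bsub>F\<^esub> B \<otimes>\<^bsub>F\<^esub> (C \<otimes>\<^bsub>F\<^esub> B)) [^]\<^bsub>F\<^esub> ord (s \<otimes> b \<otimes> (s' \<otimes> b)) = \<one>\<^bsub>F\<^esub>" using rel by simp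
  have "(C \<otimes>\<^bsub>F\<^esub> B \<otimes>\<^bsub>F\<^esub> (A \<otimes>\<^bsub>F\<^esub> B)) [^]\<^bsub>F\<^esub> ord (s \<otimes> b \<otimes> (s' \<otimes> b)) = \<one>\<^bsub>F\<^esub>"
    by (rule F.pow_mult_swap[OF _ _ 1]) (use c in auto)
  moreover have "ord (s' \<otimes> b \<otimes> (s \<otimes> b)) = ord (s \<otimes> b \<otimes> (s' \<otimes> b))"
    using T by (intro ord_mult_swap) auto
  ultimately show ?thesis
    using two_cut_iso[OF gen l(1) T sq(1) cut] n l 1 by simp
qed

text \<open>\<open>e\<close> tells whether the exit is the reflection \<open>(b c)^k b\<close> or
  the rotation \<open>(b c)^k\<close>. A word in \<open>b\<close> and \<open>c\<close> that closes
  in \<open>G\<close> is a rotation, so the order of \<open>b c\<close> controls all relations among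
  the uncut labels.\<close>

lemma iso_one_dihedral:
  assumes gen: "generate G T = carrier G"
    and T: "T = {a, b, c}" "a \<noteq> b" "a \<noteq> c" "b \<noteq> c" and sq: "a \<otimes> a = \<one>" "b \<otimes> b = \<one>" "c \<otimes> c = \<one>"
    and cut: "cut_label a" and only: "\<And>t. cut_label t \<Longrightarrow> t = a"
    and p: "exit_at a = (b \<otimes> c) [^] (k::nat) \<otimes> (if e then b else \<one>)"
    and L: "three_lift F G \<pi> A B C a b c"
    and rel: "(B \<otimes>\<^bsub>F\<^esub> C) [^]\<^bsub>F\<^esub> ord (b \<otimes> c) = \<one>\<^bsub>F\<^esub>"
      "(A \<otimes>\<^bsub>F\<^esub> ((B \<otimes>\<^bsub>F\<^esub> C) [^]\<^bsub>F\<^esub> k \<otimes>\<^bsub>F\<^esub> (if e then B else \<one>\<^bsub>F\<^esub>))) [^]\<^bsub>F\<^esub> ord (a \<otimes> exit_at a) = \<one>\<^bsub>F\<^esub>"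
  shows "G \<cong> F"
proof -
  obtain l where l: "lifting F \<pi> l" "l a = A" "l b = B" "l c = C"
    using three_lift_lifting[OF T sq L] by blast
  interpret F: group F using L by (simp add: three_lift_def)
  interpret \<pi>: group_hom F G \<pi> by (rule liftingD[OF l(1)])
  have c: "A \<in> carrier F" "B \<in> carrier F" "C \<in> carrier F" "B \<otimes>\<^bsub>F\<^esub> B = \<one>\<^bsub>F\<^esub>" "C \<otimes>\<^bsub>F\<^esub> C = \<one>\<^bsub>F\<^esub>"
    "\<pi> B = b" "\<pi> C = c" using L by (auto simp: three_lift_def)
  have g: "b \<in> carrier G" "c \<in> carrier G" "b \<noteq> \<one>" "c \<noteq> \<one>" using T one_notin_T by auto
  define v where "v = concat (replicate k [b, c]) @ (if e then [b] else [])"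
  have vs: "set v \<subseteq> {b, c}" by (auto simp: v_def)
  have w: "set (concat (replicate k [b, c])) \<subseteq> {b, c}" by auto
  have fv: "word_prod F l v = (B \<otimes>\<^bsub>F\<^esub> C) [^]\<^bsub>F\<^esub> k \<otimes>\<^bsub>F\<^esub> (if e then B else \<one>\<^bsub>F\<^esub>)"
    unfolding v_def using F.word_prod_append[of l "concat (replicate k [b, c])" "if e then [b] else []"]
      F.word_prod_replicate[of l "[b, c]" k] w l c by auto
  have pv: "pr v = exit_at a"
    unfolding v_def p using word_prod_append[of "\<lambda>t. t" "concat (replicate k [b, c])" "if e then [b] else []"]
      word_prod_replicate[of "\<lambda>t. t" "[b, c]" k] w g by auto
  show ?thesis
  proof (rule one_cut_iso[OF gen l(1) cut only _ pv])
    show "set v \<subseteq> T - {a}" using vs T by auto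
    show "(l a \<otimes>\<^bsub>F\<^esub> word_prod F l v) [^]\<^bsub>F\<^esub> ord (a \<otimes> exit_at a) = \<one>\<^bsub>F\<^esub>" using rel(2) fv l by simp
    fix u assume u: "set u \<subseteq> T - {a}" "pr u = \<one>"
    then have ubc: "set u \<subseteq> {b, c}" "set u \<subseteq> T" using T by auto
    obtain j :: int where j: "word_prod F l u = (B \<otimes>\<^bsub>F\<^esub> C) [^]\<^bsub>F\<^esub> j \<or> word_prod F l u = (B \<otimes>\<^bsub>F\<^esub> C) [^]\<^bsub>F\<^esub> j \<otimes>\<^bsub>F\<^esub> B"
      using F.dihedral_word[OF c(2-5) l(3,4) ubc(1)] by blast
    have \<pi>u: "\<pi> (word_prod F l u) = \<one>" using lifting_word_prod(2)[OF l(1) ubc(2)] u(2) by simp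
    have x: "B \<otimes>\<^bsub>F\<^esub> C \<in> carrier F" using c by simp
    have \<pi>x: "\<pi> ((B \<otimes>\<^bsub>F\<^esub> C) [^]\<^bsub>F\<^esub> j) = (b \<otimes> c) [^] j" using \<pi>.hom_int_pow[OF x] c by simp
    from j show "word_prod F l u = \<one>\<^bsub>F\<^esub>"
    proof
      assume 1: "word_prod F l u = (B \<otimes>\<^bsub>F\<^esub> C) [^]\<^bsub>F\<^esub> j"
      then have "(b \<otimes> c) [^] j = \<one>" using \<pi>u \<pi>x by simp
      then have "int (ord (b \<otimes> c)) dvd j" using g by (simp add: int_pow_eq_id)
      moreover have "F.ord (B \<otimes>\<^bsub>F\<^esub> C) dvd ord (b \<otimes> c)" using rel(1) F.pow_eq_id[OF x] by simp
      ultimately have "int (F.ord (B \<otimes>\<^bsub>F\<^esub> C)) dvd j" by (meson dvd_trans int_dvd_int_iff)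
      then show ?thesis using 1 F.int_pow_eq_id[OF x] by simp
    next
      assume 2: "word_prod F l u = (B \<otimes>\<^bsub>F\<^esub> C) [^]\<^bsub>F\<^esub> j \<otimes>\<^bsub>F\<^esub> B"
      then have "(b \<otimes> c) [^] j \<otimes> b = \<one>" using \<pi>u \<pi>x x c by simp
      then show ?thesis using reflection_ne_one[OF g(1,2) sq(2,3) g(3,4)] by blast
    qed
  qed
qed

lemma lifting_self: "generate G T = carrier G \<Longrightarrow> lifting G (\<lambda>x. x) (\<lambda>t. t)"
  using is_group by (auto simp: lifting_def hom_def)

lemma letters_power:
  assumes L: "lifting F \<pi> l" and a: "a \<in> T" and u: "set u \<subseteq> {a, inv a}"
  shows "\<exists>k::int. word_prod F l u = l a [^]\<^bsub>F\<^esub> k"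
  using u
proof (induction u)
  case Nil
  have "word_prod F l [] = l a [^]\<^bsub>F\<^esub> (0::int)" by simp
  then show ?case by blast
next
  case (Cons t u)
  interpret F: group F by (rule liftingD[OF L])
  have la: "l a \<in> carrier F" "l (inv a) = inv\<^bsub>F\<^esub> l a" using liftingD[OF L] a by auto
  obtain k :: int where k: "word_prod F l u = l a [^]\<^bsub>F\<^esub> k" using Cons by auto
  have "t = a \<or> t = inv a" using Cons.prems by simp
  then have "l t = l a [^]\<^bsub>F\<^esub> (1::int) \<or> l t = l a [^]\<^bsub>F\<^esub> (-1::int)"
    using la by (auto simp: F.int_pow_neg)
  then show ?case
  proof
    assume "l t = l a [^]\<^bsub>F\<^esub> (1::int)"
    then have "word_prod F l (t # u) = l a [^]\<^bsub>F\<^esub> (1 + k)" using k F.int_pow_mult[OF la(1), of 1 k] by simp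
    then show ?thesis by blast
  next
    assume "l t = l a [^]\<^bsub>F\<^esub> (-1::int)"
    then have "word_prod F l (t # u) = l a [^]\<^bsub>F\<^esub> (-1 + k)" using k F.int_pow_mult[OF la(1), of "-1" k] by simp
    then show ?thesis by blast
  qed
qed

text \<open>The uncut labels \<open>a\<close> and \<open>inv a\<close> generate a cyclic group, so
  the order of \<open>a\<close> controls the relations among them.\<close>

lemma iso_one_cyclic:
  assumes gen: "generate G T = carrier G"
    and T: "T = {a, inv a, b}" "a \<noteq> inv a" "a \<noteq> b" "inv a \<noteq> b" and sq: "b \<otimes> b = \<one>"
    and cut: "cut_label b" and only: "\<And>t. cut_label t \<Longrightarrow> t = b"
    and p: "exit_at b = a [^] (n::nat)"
    and L: "two_lift F G \<pi> A B a b"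
    and rel: "A [^]\<^bsub>F\<^esub> ord a = \<one>\<^bsub>F\<^esub>" "(B \<otimes>\<^bsub>F\<^esub> A [^]\<^bsub>F\<^esub> n) [^]\<^bsub>F\<^esub> ord (b \<otimes> exit_at b) = \<one>\<^bsub>F\<^esub>"
  shows "G \<cong> F"
proof -
  obtain l where l: "lifting F \<pi> l" "l a = A" "l (inv a) = inv\<^bsub>F\<^esub> A" "l b = B"
    using two_lift_lifting[OF T sq L] by blast
  interpret F: group F using L by (simp add: two_lift_def)
  interpret \<pi>: group_hom F G \<pi> by (rule liftingD[OF l(1)])
  have c: "A \<in> carrier F" "B \<in> carrier F" "\<pi> A = a" using L by (auto simp: two_lift_def)
  have aT: "a \<in> T" "a \<in> carrier G" using T by auto
  define v where "v = concat (replicate n [a])"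
  have fv: "word_prod F l v = A [^]\<^bsub>F\<^esub> n"
    unfolding v_def using F.word_prod_replicate[of l "[a]" n] l c by simp
  have pv: "pr v = exit_at b"
    unfolding v_def p using word_prod_replicate[of "\<lambda>t. t" "[a]" n] aT by simp
  show ?thesis
  proof (rule one_cut_iso[OF gen l(1) cut only _ pv])
    show "set v \<subseteq> T - {b}" using T by (auto simp: v_def)
    show "(l b \<otimes>\<^bsub>F\<^esub> word_prod F l v) [^]\<^bsub>F\<^esub> ord (b \<otimes> exit_at b) = \<one>\<^bsub>F\<^esub>" using rel(2) fv l by simp
    fix u assume u: "set u \<subseteq> T - {b}" "pr u = \<one>"
    then have uT: "set u \<subseteq> {a, inv a}" "set u \<subseteq> T" using T by auto
    obtain k :: int where k: "word_prod F l u = A [^]\<^bsub>F\<^esub> k"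
      using letters_power[OF l(1) aT(1) uT(1)] l(2) by auto
    have "\<pi> (word_prod F l u) = \<one>" using lifting_word_prod(2)[OF l(1) uT(2)] u(2) by simp
    then have "a [^] k = \<one>" using k \<pi>.hom_int_pow[OF c(1)] c by simp
    then have "int (ord a) dvd k" using aT by (simp add: int_pow_eq_id)
    moreover have "F.ord A dvd ord a" using rel(1) F.pow_eq_id[OF c(1)] by simp
    ultimately have "int (F.ord A) dvd k" by (meson dvd_trans int_dvd_int_iff)
    then show "word_prod F l u = \<one>\<^bsub>F\<^esub>" using k F.int_pow_eq_id[OF c(1)] by simp
  qed
qed

text \<open>The name refers to \<open>exit_label\<close>: the exit keeps the label. A step along the
  class begins at the far end of an edge and so turns \<open>a\<close> into \<open>inv a\<close>;
  round trips alternate between the two directions.\<close>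

lemma iso_directed_fixed:
  assumes gen: "generate G T = carrier G"
    and T: "T = {a, inv a, b}" "a \<noteq> inv a" "a \<noteq> b" "inv a \<noteq> b" and sq: "b \<otimes> b = \<one>"
    and cut: "cut_label a" "\<not> cut_label b" and n: "next_label a = inv a" "next_label (inv a) = a"
    and L: "two_lift F G \<pi> A B a b"
    and rel: "(B \<otimes>\<^bsub>F\<^esub> (inv\<^bsub>F\<^esub> A \<otimes>\<^bsub>F\<^esub> B \<otimes>\<^bsub>F\<^esub> A)) [^]\<^bsub>F\<^esub> ord (a \<otimes> b \<otimes> (inv a \<otimes> b)) = \<one>\<^bsub>F\<^esub>"
  shows "G \<cong> F"
proof -
  obtain l where l: "lifting F \<pi> l" "l a = A" "l (inv a) = inv\<^bsub>F\<^esub> A" "l b = B"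
    using two_lift_lifting[OF T sq L] by blast
  interpret F: group F using L by (simp add: two_lift_def)
  have c: "A \<in> carrier F" "B \<in> carrier F" using L by (auto simp: two_lift_def)
  have g: "a \<in> carrier G" "b \<in> carrier G" using T by auto
  let ?n = "ord (a \<otimes> b \<otimes> (inv a \<otimes> b))"
  have "(inv\<^bsub>F\<^esub> A \<otimes>\<^bsub>F\<^esub> B \<otimes>\<^bsub>F\<^esub> A \<otimes>\<^bsub>F\<^esub> B) [^]\<^bsub>F\<^esub> ?n = \<one>\<^bsub>F\<^esub>"
    by (rule F.pow_mult_swap[OF _ _ rel]) (use c in auto)
  moreover have "inv\<^bsub>F\<^esub> A \<otimes>\<^bsub>F\<^esub> B \<otimes>\<^bsub>F\<^esub> A \<otimes>\<^bsub>F\<^esub> B = inv\<^bsub>F\<^esub> A \<otimes>\<^bsub>F\<^esub> B \<otimes>\<^bsub>F\<^esub> (A \<otimes>\<^bsub>F\<^esub> B)" using c by (simp add: F.m_assoc)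
  ultimately have 1: "(inv\<^bsub>F\<^esub> A \<otimes>\<^bsub>F\<^esub> B \<otimes>\<^bsub>F\<^esub> (A \<otimes>\<^bsub>F\<^esub> B)) [^]\<^bsub>F\<^esub> ?n = \<one>\<^bsub>F\<^esub>" by simp
  have 2: "(A \<otimes>\<^bsub>F\<^esub> B \<otimes>\<^bsub>F\<^esub> (inv\<^bsub>F\<^esub> A \<otimes>\<^bsub>F\<^esub> B)) [^]\<^bsub>F\<^esub> ?n = \<one>\<^bsub>F\<^esub>"
    by (rule F.pow_mult_swap[OF _ _ 1]) (use c in auto)
  have "ord (inv a \<otimes> b \<otimes> (a \<otimes> b)) = ?n" using g by (intro ord_mult_swap) auto
  moreover have "T = {b, a, inv a}" "b \<noteq> a" "b \<noteq> inv a" using T by auto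
  ultimately show ?thesis
    using two_cut_iso[OF gen l(1), of b a "inv a"] T(2) sq cut cut_label_inv[OF cut(1)] n l 1 2 by simp
qed

text \<open>The exit labels of \<open>a\<close> and \<open>inv a\<close> are exchanged, so every
  step repeats its label. The step for \<open>inv a\<close> is the inverse of \<open>b a\<close>, a
  conjugate of the step for \<open>a\<close>; hence one relator is enough.\<close>

lemma iso_directed_swapped:
  assumes gen: "generate G T = carrier G"
    and T: "T = {a, inv a, b}" "a \<noteq> inv a" "a \<noteq> b" "inv a \<noteq> b" and sq: "b \<otimes> b = \<one>"
    and cut: "cut_label a" "\<not> cut_label b" and n: "next_label a = a" "next_label (inv a) = inv a"
    and L: "two_lift F G \<pi> A B a b"
    and rel: "(B \<otimes>\<^bsub>F\<^esub> A) [^]\<^bsub>F\<^esub> ord (a \<otimes> b) = \<one>\<^bsub>F\<^esub>"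
  shows "G \<cong> F"
proof -
  obtain l where l: "lifting F \<pi> l" "l a = A" "l (inv a) = inv\<^bsub>F\<^esub> A" "l b = B"
    using two_lift_lifting[OF T sq L] by blast
  interpret F: group F using L by (simp add: two_lift_def)
  have c: "A \<in> carrier F" "B \<in> carrier F" "B \<otimes>\<^bsub>F\<^esub> B = \<one>\<^bsub>F\<^esub>" using L by (auto simp: two_lift_def)
  have g: "a \<in> carrier G" "b \<in> carrier G" using T by auto
  have 1: "(A \<otimes>\<^bsub>F\<^esub> B) [^]\<^bsub>F\<^esub> ord (a \<otimes> b) = \<one>\<^bsub>F\<^esub>" by (rule F.pow_mult_swap[OF c(2,1) rel])
  have i: "inv b = b" "inv\<^bsub>F\<^esub> B = B" using inv_equality[OF sq] F.inv_equality[OF c(3)] g c by auto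
  have "ord (inv a \<otimes> b) = ord (b \<otimes> a)"
  proof (rule dvd_antisym)
    have e: "inv a \<otimes> b = inv (b \<otimes> a)" using g i by (simp add: inv_mult_group)
    have x: "b \<otimes> a \<in> carrier G" using g by simp
    show "ord (inv a \<otimes> b) dvd ord (b \<otimes> a)" "ord (b \<otimes> a) dvd ord (inv a \<otimes> b)"
      unfolding e using x pow_ord_eq_1[OF x] pow_ord_eq_1[OF inv_closed[OF x]]
      by (simp_all add: nat_pow_inv flip: pow_eq_id)
  qed
  then have o: "ord (inv a \<otimes> b) = ord (a \<otimes> b)" using ord_mult_swap[OF g] by simp
  have "inv\<^bsub>F\<^esub> A \<otimes>\<^bsub>F\<^esub> B = inv\<^bsub>F\<^esub> (B \<otimes>\<^bsub>F\<^esub> A)" using c i by (simp add: F.inv_mult_group)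
  then have 2: "(inv\<^bsub>F\<^esub> A \<otimes>\<^bsub>F\<^esub> B) [^]\<^bsub>F\<^esub> ord (a \<otimes> b) = \<one>\<^bsub>F\<^esub>" using rel c by (simp add: F.nat_pow_inv)
  have "T = {b, a, inv a}" "b \<noteq> a" "b \<noteq> inv a" using T by auto
  then show ?thesis
    using two_cut_iso[OF gen l(1), of b a "inv a"] T(2) sq cut cut_label_inv[OF cut(1)] n l 1 2 o by simp
qed

section \<open>The types of the theorem, case by case\<close>

text \<open>The steps along the two classes are \<open>s b\<close> and \<open>s' b\<close>, of
  finite orders \<open>n\<close> and \<open>m\<close>. Each gives a dihedral group that contains
  \<open>b\<close>, and the two are glued along \<open>b\<close>.\<close>

lemma case_two_fixed:
  assumes gen: "generate G T = carrier G"
    and T: "T = {b, s, s'}" "b \<noteq> s" "b \<noteq> s'" "s \<noteq> s'" and sq: "b \<otimes> b = \<one>" "s \<otimes> s = \<one>" "s' \<otimes> s' = \<one>"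
    and cut: "cut_label s" "cut_label s'" "\<not> cut_label b" and n: "next_label s = s" "next_label s' = s'"
  shows "\<exists>n>0. \<exists>m>0. is_amalgam G (dihedral n) (cyclic 2) (dihedral m) \<and>
    G \<cong> presented {GenA, GenB, GenC}
      {\<aa> \<^bold>^ 2, \<bb> \<^bold>^ 2, \<cc> \<^bold>^ 2, (\<bb> @ \<aa>) \<^bold>^ n, (\<bb> @ \<cc>) \<^bold>^ m}"
proof -
  define n where "n = ord (s \<otimes> b)"
  define m where "m = ord (s' \<otimes> b)"
  have g: "b \<in> carrier G" "s \<in> carrier G" "s' \<in> carrier G" "b \<noteq> \<one>" using T one_notin_T by auto
  have i: "inv s = s" "inv s' = s'" using inv_equality sq g by auto
  note ex = two_cut_labels[OF T sq(1) cut]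
  have pos: "n > 0" "m > 0"
    using ord_next_pos[OF cut(1) n(1)] ord_next_pos[OF cut(2) n(2)] i ex by (simp_all add: n_def m_def)
  have ord: "(s \<otimes> b) [^] n = \<one>" "(s' \<otimes> b) [^] m = \<one>" using g by (simp_all add: n_def m_def pow_ord_eq_1)
  have ord': "(b \<otimes> s) [^] n = \<one>" "(b \<otimes> s') [^] m = \<one>"
    using pow_mult_swap[OF g(2,1) ord(1)] pow_mult_swap[OF g(3,1) ord(2)] by auto
  have iso: "G \<cong> F" if "three_lift F G \<pi> A B C s b s'" "(B \<otimes>\<^bsub>F\<^esub> A) [^]\<^bsub>F\<^esub> n = \<one>\<^bsub>F\<^esub>" "(B \<otimes>\<^bsub>F\<^esub> C) [^]\<^bsub>F\<^esub> m = \<one>\<^bsub>F\<^esub>"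
    for F :: "gen word set monoid" and \<pi> A B C
    using iso_two_fixed[OF gen T sq cut assms(12,13) that(1)] that(2,3) by (simp add: n_def m_def)
  define R where "R = {\<aa> \<^bold>^ 2, \<bb> \<^bold>^ 2, \<cc> \<^bold>^ 2, (\<bb> @ \<aa>) \<^bold>^ n, (\<bb> @ \<cc>) \<^bold>^ m}"
  have inR: "(\<bb> @ \<aa>) \<^bold>^ n \<in> R" "(\<bb> @ \<cc>) \<^bold>^ m \<in> R" by (simp_all add: R_def)
  let ?P = "presented {GenA, GenB, GenC} R"
  have "G \<cong> ?P"
  proof (rule presented_three_lift[OF is_group g(2,1,3), of R])
    show "R \<subseteq> words {GenA, GenB, GenC}" "{\<aa> \<^bold>^ 2, \<bb> \<^bold>^ 2, \<cc> \<^bold>^ 2} \<subseteq> R" by (auto simp: R_def)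
    show "word_val G (case_gen s b s') r = \<one>" if "r \<in> R" for r
      using that g sq ord' by (auto simp: R_def gen_word_val pow2_eq)
    fix \<pi> A B C
    assume L: "three_lift ?P G \<pi> A B C s b s'"
      and r: "\<And>r. r \<in> R \<Longrightarrow> word_val ?P (case_gen A B C) r = \<one>\<^bsub>?P\<^esub>"
    interpret P: group ?P using L by (simp add: three_lift_def)
    have c: "A \<in> carrier ?P" "B \<in> carrier ?P" "C \<in> carrier ?P" using L by (auto simp: three_lift_def)
    show "G \<cong> ?P"
      using iso[OF L] r[OF inR(1)] r[OF inR(2)] c by (simp add: P.gen_word_val)
  qed
  moreover have "is_amalgam G (dihedral n) (cyclic 2) (dihedral m)"
  proof -
    have bbs: "b \<otimes> (b \<otimes> s) = s" using g sq by (simp flip: m_assoc)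
    have bs: "b \<otimes> s \<in> carrier G" using g by simp
    obtain \<rho> \<tau> f where D: "group (dihedral n)" and \<rho>: "\<rho> \<in> carrier (dihedral n)" and \<tau>: "\<tau> \<in> carrier (dihedral n)"
      and r\<tau>: "\<tau> \<otimes>\<^bsub>dihedral n\<^esub> \<tau> = \<one>\<^bsub>dihedral n\<^esub>" and r\<rho>: "\<rho> [^]\<^bsub>dihedral n\<^esub> n = \<one>\<^bsub>dihedral n\<^esub>"
      and r\<tau>\<rho>: "(\<tau> \<otimes>\<^bsub>dihedral n\<^esub> \<rho>) \<otimes>\<^bsub>dihedral n\<^esub> (\<tau> \<otimes>\<^bsub>dihedral n\<^esub> \<rho>) = \<one>\<^bsub>dihedral n\<^esub>"
      and gD: "carrier (dihedral n) = generate (dihedral n) {\<rho>, \<tau>}"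
      and f: "f \<in> hom (dihedral n) G" "f \<rho> = b \<otimes> s" "f \<tau> = b"
      by (rule dihedral_gens[OF _ is_group bs g(1) sq(1) ord'(1), unfolded bbs, OF _ sq(2)], use pos in simp) (rule that; assumption)
    have q: "f \<tau> \<noteq> \<one>" "(s' \<otimes> f \<tau>) [^] m = \<one>" using f g ord by simp_all
    \<comment> \<open>The first factor holds \<open>b\<close> and \<open>s\<close>, and the
      reflection added by the second one lies over \<open>s'\<close>. So \<open>s\<close> and
      \<open>s'\<close> appear exchanged in this lift.\<close>
    obtain F :: "(gen word set + gen word set) word set monoid" and \<alpha> \<pi> x
      where am: "G \<cong> F \<Longrightarrow> is_amalgam G (dihedral n) (cyclic 2) (dihedral m)"
      and L: "three_lift F G \<pi> x (\<alpha> \<tau>) (\<alpha> (\<tau> \<otimes>\<^bsub>dihedral n\<^esub> \<rho>)) s' b s"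
      and \<alpha>: "group_hom (dihedral n) F \<alpha>" and rel: "(x \<otimes>\<^bsub>F\<^esub> \<alpha> \<tau>) [^]\<^bsub>F\<^esub> m = \<one>\<^bsub>F\<^esub>"
        "\<alpha> \<tau> \<otimes>\<^bsub>F\<^esub> \<alpha> (\<tau> \<otimes>\<^bsub>dihedral n\<^esub> \<rho>) = \<alpha> \<rho>"
      by (rule amalgam_three_lift[OF D is_group f(1) \<rho> \<tau> r\<tau> r\<tau>\<rho> gD g(1,2) sq(1) f(2,3) \<tau> r\<tau> q(1) g(3) sq(3) q(2) pos(2)])
        (rule that; (assumption | blast))
    interpret \<alpha>: group_hom "dihedral n" F \<alpha> by (rule \<alpha>)
    have x: "x \<in> carrier F" using L by (simp add: three_lift_def)
    have "(\<alpha> \<tau> \<otimes>\<^bsub>F\<^esub> \<alpha> (\<tau> \<otimes>\<^bsub>dihedral n\<^esub> \<rho>)) [^]\<^bsub>F\<^esub> n = \<one>\<^bsub>F\<^esub>"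
      unfolding rel(2) using \<alpha>.hom_nat_pow[OF \<rho>, of n] r\<rho> \<alpha>.hom_one by simp
    moreover have "(\<alpha> \<tau> \<otimes>\<^bsub>F\<^esub> x) [^]\<^bsub>F\<^esub> m = \<one>\<^bsub>F\<^esub>"
      using \<alpha>.H.pow_mult_swap[OF x _ rel(1)] \<tau> by simp
    ultimately have "G \<cong> F"
      using iso_two_fixed[OF gen T sq cut assms(12,13) three_lift_swap[OF L]] by (simp add: n_def m_def)
    then show ?thesis by (rule am)
  qed
  ultimately show ?thesis using pos unfolding R_def by blast
qed

text \<open>The glued involution \<open>p\<close> is the reflection \<open>(bc)\<^sup>k b\<close> if \<open>e\<close> holds, and the central rotation
  \<open>(bc)\<^sup>k\<close> of a finite dihedral group otherwise; \<open>N = 0\<close> stands for infinite order of \<open>bc\<close>.\<close>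

lemma is_amalgam_dihedral:
  assumes a: "a \<in> carrier G" "a \<otimes> a = \<one>" and bc: "b \<in> carrier G" "c \<in> carrier G" "b \<otimes> b = \<one>" "c \<otimes> c = \<one>"
    and ord: "(b \<otimes> c) [^] N = \<one>" and p: "p = (b \<otimes> c) [^] (k::nat) \<otimes> (if e then b else \<one>)"
    and ne: "p \<noteq> \<one>" and am: "(a \<otimes> p) [^] m = \<one>" "m > 0" and e: "\<not> e \<Longrightarrow> N = 2 * k"
    and iso: "\<And>(F :: (gen word set + gen word set) word set monoid) \<pi> A B C.
      three_lift F G \<pi> A B C a b c \<Longrightarrow> (B \<otimes>\<^bsub>F\<^esub> C) [^]\<^bsub>F\<^esub> N = \<one>\<^bsub>F\<^esub> \<Longrightarrow>
      (A \<otimes>\<^bsub>F\<^esub> ((B \<otimes>\<^bsub>F\<^esub> C) [^]\<^bsub>F\<^esub> k \<otimes>\<^bsub>F\<^esub> (if e then B else \<one>\<^bsub>F\<^esub>))) [^]\<^bsub>F\<^esub> m = \<one>\<^bsub>F\<^esub> \<Longrightarrow> G \<cong> F"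
  shows "is_amalgam G (if N = 0 then dihedral_inf else dihedral N) (cyclic 2) (dihedral m)"
proof -
  have bbc: "b \<otimes> (b \<otimes> c) = c" using bc by (simp flip: m_assoc)
  have x: "b \<otimes> c \<in> carrier G" using bc by simp
  have main: "is_amalgam G D (cyclic 2) (dihedral m)"
    if D: "group D" and \<rho>: "\<rho> \<in> carrier D" and \<tau>: "\<tau> \<in> carrier D"
      and r\<tau>: "\<tau> \<otimes>\<^bsub>D\<^esub> \<tau> = \<one>\<^bsub>D\<^esub>" and r\<rho>: "\<rho> [^]\<^bsub>D\<^esub> N = \<one>\<^bsub>D\<^esub>"
      and r\<tau>\<rho>: "(\<tau> \<otimes>\<^bsub>D\<^esub> \<rho>) \<otimes>\<^bsub>D\<^esub> (\<tau> \<otimes>\<^bsub>D\<^esub> \<rho>) = \<one>\<^bsub>D\<^esub>"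
      and gD: "carrier D = generate D {\<rho>, \<tau>}" and f: "f \<in> hom D G" "f \<rho> = b \<otimes> c" "f \<tau> = b"
    for D :: "gen word set monoid" and \<rho> \<tau> f
  proof -
    interpret D: group D by (rule D)
    interpret f: group_hom D G f using D is_group f by (simp add: group_hom_def group_hom_axioms_def)
    define q where "q = \<rho> [^]\<^bsub>D\<^esub> k \<otimes>\<^bsub>D\<^esub> (if e then \<tau> else \<one>\<^bsub>D\<^esub>)"
    have q: "q \<in> carrier D" using \<rho> \<tau> by (simp add: q_def)
    have fq: "f q = p" unfolding p q_def using \<rho> \<tau> f f.hom_nat_pow by simp
    \<comment> \<open>A reflection squares to one by the dihedral relations, the rotation because
      \<open>N = 2 * k\<close>.\<close>
    have qq: "q \<otimes>\<^bsub>D\<^esub> q = \<one>\<^bsub>D\<^esub>"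
    proof (cases e)
      case True
      have \<tau>\<rho>: "\<tau> \<otimes>\<^bsub>D\<^esub> \<rho> \<in> carrier D" "\<tau> \<otimes>\<^bsub>D\<^esub> (\<tau> \<otimes>\<^bsub>D\<^esub> \<rho>) = \<rho>" using \<rho> \<tau> r\<tau> by (simp_all flip: D.m_assoc)
      from D.reflection_square[OF \<tau> \<tau>\<rho>(1) r\<tau> r\<tau>\<rho>, of "int k"]
      show ?thesis using True unfolding q_def \<tau>\<rho>(2) by (simp add: int_pow_int)
    next
      case False
      then show ?thesis using e r\<rho> \<rho> by (simp add: q_def D.nat_pow_mult mult_2)
    qed
    have fq1: "f q \<noteq> \<one>" "(a \<otimes> f q) [^] m = \<one>" using ne am(1) fq by simp_all
    obtain F :: "(gen word set + gen word set) word set monoid" and \<alpha> \<pi> x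
      where isam: "G \<cong> F \<Longrightarrow> is_amalgam G D (cyclic 2) (dihedral m)"
      and L: "three_lift F G \<pi> x (\<alpha> \<tau>) (\<alpha> (\<tau> \<otimes>\<^bsub>D\<^esub> \<rho>)) a b c"
      and \<alpha>: "group_hom D F \<alpha>" and rel: "(x \<otimes>\<^bsub>F\<^esub> \<alpha> q) [^]\<^bsub>F\<^esub> m = \<one>\<^bsub>F\<^esub>"
        "\<alpha> \<tau> \<otimes>\<^bsub>F\<^esub> \<alpha> (\<tau> \<otimes>\<^bsub>D\<^esub> \<rho>) = \<alpha> \<rho>"
      by (rule amalgam_three_lift[OF D is_group f(1) \<rho> \<tau> r\<tau> r\<tau>\<rho> gD bc(1,2,3) f(2,3) q qq fq1(1) a fq1(2) am(2)])
        (rule that; (assumption | blast))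
    interpret \<alpha>: group_hom D F \<alpha> by (rule \<alpha>)
    have "G \<cong> F"
    proof (rule iso[OF L])
      show "(\<alpha> \<tau> \<otimes>\<^bsub>F\<^esub> \<alpha> (\<tau> \<otimes>\<^bsub>D\<^esub> \<rho>)) [^]\<^bsub>F\<^esub> N = \<one>\<^bsub>F\<^esub>"
        unfolding rel(2) using \<alpha>.hom_nat_pow[OF \<rho>, of N] r\<rho> \<alpha>.hom_one by simp
      have "\<alpha> q = \<alpha> \<rho> [^]\<^bsub>F\<^esub> k \<otimes>\<^bsub>F\<^esub> (if e then \<alpha> \<tau> else \<one>\<^bsub>F\<^esub>)"
        unfolding q_def using \<rho> \<tau> \<alpha>.hom_nat_pow[OF \<rho>, of k] by simp
      then show "(x \<otimes>\<^bsub>F\<^esub> ((\<alpha> \<tau> \<otimes>\<^bsub>F\<^esub> \<alpha> (\<tau> \<otimes>\<^bsub>D\<^esub> \<rho>)) [^]\<^bsub>F\<^esub> k \<otimes>\<^bsub>F\<^esub> (if e then \<alpha> \<tau> else \<one>\<^bsub>F\<^esub>))) [^]\<^bsub>F\<^esub> m = \<one>\<^bsub>F\<^esub>"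
        unfolding rel(2) using rel(1) by simp
    qed
    then show ?thesis by (rule isam)
  qed
  show ?thesis
    by (rule dihedral_gens[OF HOL.refl is_group x bc(1,3) ord, unfolded bbc, OF bc(4)]) (rule main)
qed

text \<open>The relator \<open>(s b s' b)\<^sup>m\<close> is that of the second presentation in (i), but it presents
  \<open>\<int>\<^sub>2 * D\<^bsub>2m\<^esub>\<close> and not \<open>\<int>\<^sub>m * \<int>\<^sub>2\<close>. The group belongs to type (v) with \<open>n = 1\<close>.\<close>

lemma case_two_swapped:
  assumes gen: "generate G T = carrier G"
    and T: "T = {b, s, s'}" "b \<noteq> s" "b \<noteq> s'" "s \<noteq> s'" and sq: "b \<otimes> b = \<one>" "s \<otimes> s = \<one>" "s' \<otimes> s' = \<one>"
    and cut: "cut_label s" "cut_label s'" "\<not> cut_label b" and n: "next_label s = s'" "next_label s' = s"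
  shows "\<exists>n>0. \<exists>m>0. is_amalgam G dihedral_inf (cyclic 2) (dihedral m) \<and>
    G \<cong> presented {GenA, GenB, GenC} {\<aa> \<^bold>^ 2, \<bb> \<^bold>^ 2, \<cc> \<^bold>^ 2, (\<aa> @ (\<bb> @ \<cc>) \<^bold>^ n @ \<bb>) \<^bold>^ m}"
proof -
  define m where "m = ord (s \<otimes> b \<otimes> (s' \<otimes> b))"
  have g: "b \<in> carrier G" "s \<in> carrier G" "s' \<in> carrier G" "s' \<noteq> \<one>" using T one_notin_T by auto
  have i: "inv s = s" "inv s' = s'" using inv_equality sq g by auto
  note ex = two_cut_labels[OF T sq(1) cut]
  have pos: "m > 0" using ord_next_next_pos[OF cut(1) n] i ex by (simp add: m_def)
  have ord: "(s \<otimes> b \<otimes> (s' \<otimes> b)) [^] m = \<one>"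
    unfolding m_def by (rule pow_ord_eq_1) (use g in simp)
  have "s \<otimes> b \<otimes> (s' \<otimes> b) = s \<otimes> (b \<otimes> s' \<otimes> b)" using g by (simp add: m_assoc)
  then have ord': "(s \<otimes> (b \<otimes> s' \<otimes> b)) [^] m = \<one>" using ord by simp
  define R where "R = {\<aa> \<^bold>^ 2, \<bb> \<^bold>^ 2, \<cc> \<^bold>^ 2, (\<aa> @ (\<bb> @ \<cc>) \<^bold>^ 1 @ \<bb>) \<^bold>^ m}"
  have inR: "(\<aa> @ (\<bb> @ \<cc>) \<^bold>^ 1 @ \<bb>) \<^bold>^ m \<in> R" by (simp_all add: R_def)
  let ?P = "presented {GenA, GenB, GenC} R"
  have "G \<cong> ?P"
  proof (rule presented_three_lift[OF is_group g(2,1,3), of R])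
    show "R \<subseteq> words {GenA, GenB, GenC}" "{\<aa> \<^bold>^ 2, \<bb> \<^bold>^ 2, \<cc> \<^bold>^ 2} \<subseteq> R" by (auto simp: R_def)
    show "word_val G (case_gen s b s') r = \<one>" if "r \<in> R" for r
      using that g sq ord' by (auto simp: R_def gen_word_val pow2_eq)
    fix \<pi> A B C
    assume L: "three_lift ?P G \<pi> A B C s b s'"
      and r: "\<And>r. r \<in> R \<Longrightarrow> word_val ?P (case_gen A B C) r = \<one>\<^bsub>?P\<^esub>"
    interpret P: group ?P using L by (simp add: three_lift_def)
    have c: "A \<in> carrier ?P" "B \<in> carrier ?P" "C \<in> carrier ?P" using L by (auto simp: three_lift_def)
    have "(A \<otimes>\<^bsub>?P\<^esub> (B \<otimes>\<^bsub>?P\<^esub> C \<otimes>\<^bsub>?P\<^esub> B)) [^]\<^bsub>?P\<^esub> m = \<one>\<^bsub>?P\<^esub>"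
      using r[OF inR(1)] c by (simp add: P.gen_word_val)
    then show "G \<cong> ?P"
      using iso_two_swapped[OF gen T sq cut n L] by (simp add: m_def)
  qed
  \<comment> \<open>With the order parameter 0 no relation is imposed on \<open>b s'\<close>, and
    the first factor is the infinite dihedral group.\<close>
  moreover have "is_amalgam G (if 0 = (0::nat) then dihedral_inf else dihedral 0) (cyclic 2) (dihedral m)"
  proof (rule is_amalgam_dihedral[OF g(2) sq(2) g(1,3) sq(1,3), where p = "b \<otimes> s' \<otimes> b" and k = 1 and e = True])
    show "b \<otimes> s' \<otimes> b = (b \<otimes> s') [^] (1::nat) \<otimes> (if True then b else \<one>)" using g by simp
    show "b \<otimes> s' \<otimes> b \<noteq> \<one>"
    proof
      assume "b \<otimes> s' \<otimes> b = \<one>"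
      moreover have "b \<otimes> (b \<otimes> s' \<otimes> b) \<otimes> b = (b \<otimes> b) \<otimes> s' \<otimes> (b \<otimes> b)"
        using g by (simp only: m_assoc m_closed)
      ultimately show False using g sq by simp
    qed
    fix F :: "(gen word set + gen word set) word set monoid" and \<pi> A B C
    assume L: "three_lift F G \<pi> A B C s b s'"
      and r: "(A \<otimes>\<^bsub>F\<^esub> ((B \<otimes>\<^bsub>F\<^esub> C) [^]\<^bsub>F\<^esub> (1::nat) \<otimes>\<^bsub>F\<^esub> (if True then B else \<one>\<^bsub>F\<^esub>))) [^]\<^bsub>F\<^esub> m = \<one>\<^bsub>F\<^esub>"
    interpret F: group F using L by (simp add: three_lift_def)
    have c: "A \<in> carrier F" "B \<in> carrier F" "C \<in> carrier F" using L by (auto simp: three_lift_def)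
    have "(A \<otimes>\<^bsub>F\<^esub> (B \<otimes>\<^bsub>F\<^esub> C \<otimes>\<^bsub>F\<^esub> B)) [^]\<^bsub>F\<^esub> m = \<one>\<^bsub>F\<^esub>" using r c by simp
    then show "G \<cong> F" using iso_two_swapped[OF gen T sq cut n L] by (simp add: m_def)
  qed (use ord' pos in auto)
  ultimately have "is_amalgam G dihedral_inf (cyclic 2) (dihedral m)" "G \<cong> ?P" by simp_all
  then show ?thesis using pos unfolding R_def by blast
qed

text \<open>The exit is an involution in the group generated by \<open>b\<close> and
  \<open>c\<close>. If it is a rotation, it is the half-turn of a finite dihedral group. If it is a
  reflection \<open>(b c)^j b\<close>, the integer \<open>j\<close> still has to be traded for the
  positive exponent that the presentation asks for.\<close>

lemma case_one_dihedral:
  assumes gen: "generate G T = carrier G"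
    and T: "T = {a, b, c}" "a \<noteq> b" "a \<noteq> c" "b \<noteq> c" and sq: "a \<otimes> a = \<one>" "b \<otimes> b = \<one>" "c \<otimes> c = \<one>"
    and cut: "cut_label a" and only: "\<And>t. cut_label t \<Longrightarrow> t = a"
  shows "(\<exists>n>0. \<exists>m>0. is_amalgam G (dihedral (2 * n)) (cyclic 2) (dihedral m) \<and>
        G \<cong> presented {GenA, GenB, GenC}
              {\<aa> \<^bold>^ 2, \<bb> \<^bold>^ 2, \<cc> \<^bold>^ 2, (\<bb> @ \<cc>) \<^bold>^ (2 * n), (\<aa> @ (\<bb> @ \<cc>) \<^bold>^ n) \<^bold>^ m}) \<or>
     (\<exists>n>0. \<exists>m>0. \<exists>k>0. is_amalgam G (dihedral n) (cyclic 2) (dihedral m) \<and>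
        G \<cong> presented {GenA, GenB, GenC}
              {\<aa> \<^bold>^ 2, \<bb> \<^bold>^ 2, \<cc> \<^bold>^ 2, (\<bb> @ \<cc>) \<^bold>^ n, (\<aa> @ (\<bb> @ \<cc>) \<^bold>^ k @ \<bb>) \<^bold>^ m}) \<or>
     (\<exists>n>0. \<exists>m>0. is_amalgam G dihedral_inf (cyclic 2) (dihedral m) \<and>
        G \<cong> presented {GenA, GenB, GenC} {\<aa> \<^bold>^ 2, \<bb> \<^bold>^ 2, \<cc> \<^bold>^ 2, (\<aa> @ (\<bb> @ \<cc>) \<^bold>^ n @ \<bb>) \<^bold>^ m})"
    (is "?even \<or> ?refl \<or> ?inf")
proof -
  note oc = one_cut_label[OF cut only]
  define p where "p = exit_at a"
  have g: "a \<in> carrier G" "b \<in> carrier G" "c \<in> carrier G" using T by auto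
  have pc: "p \<in> carrier G" "p \<noteq> \<one>" "p \<otimes> p = \<one>"
    using exit_at_closed[OF cut] exit_at_ne_one[OF cut] oc by (simp_all add: p_def)
  define m where "m = ord (a \<otimes> p)"
  have m: "m > 0" using ord_next_pos[OF cut] oc by (simp add: m_def p_def)
  have am: "(a \<otimes> p) [^] m = \<one>" unfolding m_def using g pc by (simp add: pow_ord_eq_1)
  have x: "b \<otimes> c \<in> carrier G" using g by simp
  have even: ?even if n: "n > 0" "ord (b \<otimes> c) = 2 * n" and p: "p = (b \<otimes> c) [^] n" for n :: nat
  proof -
    have o: "(b \<otimes> c) [^] (2 * n) = \<one>" using pow_ord_eq_1[OF x] n by simp
    have p': "exit_at a = (b \<otimes> c) [^] n \<otimes> (if False then b else \<one>)" using p x by (simp add: p_def)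
    define R where "R = {\<aa> \<^bold>^ 2, \<bb> \<^bold>^ 2, \<cc> \<^bold>^ 2, (\<bb> @ \<cc>) \<^bold>^ (2 * n), (\<aa> @ (\<bb> @ \<cc>) \<^bold>^ n) \<^bold>^ m}"
    have inR: "(\<bb> @ \<cc>) \<^bold>^ (2 * n) \<in> R" "(\<aa> @ (\<bb> @ \<cc>) \<^bold>^ n) \<^bold>^ m \<in> R" by (simp_all add: R_def)
    let ?P = "presented {GenA, GenB, GenC} R"
    have "G \<cong> ?P"
    proof (rule presented_three_lift[OF is_group g, of R])
      show "R \<subseteq> words {GenA, GenB, GenC}" "{\<aa> \<^bold>^ 2, \<bb> \<^bold>^ 2, \<cc> \<^bold>^ 2} \<subseteq> R" by (auto simp: R_def)
      show "word_val G (case_gen a b c) r = \<one>" if "r \<in> R" for r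
        using that g sq o am p by (auto simp: R_def gen_word_val pow2_eq)
      fix \<pi> A B C
      assume L: "three_lift ?P G \<pi> A B C a b c"
        and r: "\<And>r. r \<in> R \<Longrightarrow> word_val ?P (case_gen A B C) r = \<one>\<^bsub>?P\<^esub>"
      interpret P: group ?P using L by (simp add: three_lift_def)
      have c: "A \<in> carrier ?P" "B \<in> carrier ?P" "C \<in> carrier ?P" using L by (auto simp: three_lift_def)
      show "G \<cong> ?P"
      proof (rule iso_one_dihedral[OF gen T sq cut only p' L])
        show "(B \<otimes>\<^bsub>?P\<^esub> C) [^]\<^bsub>?P\<^esub> ord (b \<otimes> c) = \<one>\<^bsub>?P\<^esub>"
          unfolding n(2) using r[OF inR(1)] c by (simp add: P.gen_word_val)
        show "(A \<otimes>\<^bsub>?P\<^esub> ((B \<otimes>\<^bsub>?P\<^esub> C) [^]\<^bsub>?P\<^esub> n \<otimes>\<^bsub>?P\<^esub> (if False then B else \<one>\<^bsub>?P\<^esub>))) [^]\<^bsub>?P\<^esub> ord (a \<otimes> exit_at a) = \<one>\<^bsub>?P\<^esub>"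
          using r[OF inR(2)] c by (simp add: P.gen_word_val m_def p_def)
      qed
    qed
    moreover have "is_amalgam G (dihedral (2 * n)) (cyclic 2) (dihedral m)"
    proof -
      have "is_amalgam G (if 2 * n = 0 then dihedral_inf else dihedral (2 * n)) (cyclic 2) (dihedral m)"
      proof (rule is_amalgam_dihedral[OF g(1) sq(1) g(2,3) sq(2,3) o _ pc(2) am m, where k = n and e = False])
      fix F :: "(gen word set + gen word set) word set monoid" and \<pi> A B C
      assume L: "three_lift F G \<pi> A B C a b c" and r: "(B \<otimes>\<^bsub>F\<^esub> C) [^]\<^bsub>F\<^esub> (2 * n) = \<one>\<^bsub>F\<^esub>"
        "(A \<otimes>\<^bsub>F\<^esub> ((B \<otimes>\<^bsub>F\<^esub> C) [^]\<^bsub>F\<^esub> n \<otimes>\<^bsub>F\<^esub> (if False then B else \<one>\<^bsub>F\<^esub>))) [^]\<^bsub>F\<^esub> m = \<one>\<^bsub>F\<^esub>"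
      show "G \<cong> F"
        by (rule iso_one_dihedral[OF gen T sq cut only p' L])
          (use r n in \<open>simp_all only: m_def p_def\<close>)
      qed (use p x in auto)
      then show ?thesis using n(1) by simp
    qed
    ultimately show ?even using n m unfolding R_def by blast
  qed
  \<comment> \<open>This is stated for arbitrary \<open>b\<close> and \<open>c\<close>, so that the
    two may be exchanged when the exponent is negative.\<close>
  have refl: "(ord (b \<otimes> c) > 0 \<longrightarrow> ?refl) \<and> (ord (b \<otimes> c) = 0 \<longrightarrow> ?inf)"
    if T: "T = {a, b, c}" "a \<noteq> b" "a \<noteq> c" "b \<noteq> c" and sq: "a \<otimes> a = \<one>" "b \<otimes> b = \<one>" "c \<otimes> c = \<one>"
      and k: "k > 0" and p: "p = (b \<otimes> c) [^] k \<otimes> b" for k :: nat and b c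
  proof -
    have g: "a \<in> carrier G" "b \<in> carrier G" "c \<in> carrier G" using T by auto
    have x: "b \<otimes> c \<in> carrier G" using g by simp
    define n where "n = ord (b \<otimes> c)"
    have o: "(b \<otimes> c) [^] n = \<one>" unfolding n_def using pow_ord_eq_1[OF x] .
    have p': "exit_at a = (b \<otimes> c) [^] k \<otimes> (if True then b else \<one>)" using p x by (simp add: p_def)
    define R where "R = {\<aa> \<^bold>^ 2, \<bb> \<^bold>^ 2, \<cc> \<^bold>^ 2, (\<aa> @ (\<bb> @ \<cc>) \<^bold>^ k @ \<bb>) \<^bold>^ m} \<union>
      (if n = 0 then {} else {(\<bb> @ \<cc>) \<^bold>^ n})"
    let ?P = "presented {GenA, GenB, GenC} R"
    have P: "G \<cong> ?P"
    proof (rule presented_three_lift[OF is_group g, of R])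
      show "R \<subseteq> words {GenA, GenB, GenC}" "{\<aa> \<^bold>^ 2, \<bb> \<^bold>^ 2, \<cc> \<^bold>^ 2} \<subseteq> R" by (auto simp: R_def)
      show "word_val G (case_gen a b c) r = \<one>" if "r \<in> R" for r
        using that g sq o am p by (auto simp: R_def gen_word_val pow2_eq split: if_splits)
      fix \<pi> A B C
      assume L: "three_lift ?P G \<pi> A B C a b c"
        and r: "\<And>r. r \<in> R \<Longrightarrow> word_val ?P (case_gen A B C) r = \<one>\<^bsub>?P\<^esub>"
      interpret P: group ?P using L by (simp add: three_lift_def)
      have c: "A \<in> carrier ?P" "B \<in> carrier ?P" "C \<in> carrier ?P" using L by (auto simp: three_lift_def)
      show "G \<cong> ?P"
      proof (rule iso_one_dihedral[OF gen T sq cut only p' L])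
        show "(B \<otimes>\<^bsub>?P\<^esub> C) [^]\<^bsub>?P\<^esub> ord (b \<otimes> c) = \<one>\<^bsub>?P\<^esub>"
        proof (cases "n = 0")
          case True then show ?thesis by (simp add: n_def)
        next
          case False
          then have "(\<bb> @ \<cc>) \<^bold>^ n \<in> R" by (simp add: R_def)
          from r[OF this] show ?thesis using c by (simp add: P.gen_word_val n_def)
        qed
        have "(\<aa> @ (\<bb> @ \<cc>) \<^bold>^ k @ \<bb>) \<^bold>^ m \<in> R" by (simp add: R_def)
        from r[OF this]
        show "(A \<otimes>\<^bsub>?P\<^esub> ((B \<otimes>\<^bsub>?P\<^esub> C) [^]\<^bsub>?P\<^esub> k \<otimes>\<^bsub>?P\<^esub> (if True then B else \<one>\<^bsub>?P\<^esub>))) [^]\<^bsub>?P\<^esub> ord (a \<otimes> exit_at a) = \<one>\<^bsub>?P\<^esub>"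
          using c by (simp add: P.gen_word_val m_def p_def)
      qed
    qed
    have pp: "p = (b \<otimes> c) [^] k \<otimes> (if True then b else \<one>)" using p by simp
    have iso: "G \<cong> F" if L: "three_lift F G \<pi> A B C a b c" and r: "(B \<otimes>\<^bsub>F\<^esub> C) [^]\<^bsub>F\<^esub> n = \<one>\<^bsub>F\<^esub>"
        "(A \<otimes>\<^bsub>F\<^esub> ((B \<otimes>\<^bsub>F\<^esub> C) [^]\<^bsub>F\<^esub> k \<otimes>\<^bsub>F\<^esub> (if True then B else \<one>\<^bsub>F\<^esub>))) [^]\<^bsub>F\<^esub> m = \<one>\<^bsub>F\<^esub>"
      for F :: "(gen word set + gen word set) word set monoid" and \<pi> A B C
      by (rule iso_one_dihedral[OF gen T sq cut only p' L]) (use r in \<open>simp_all only: m_def p_def n_def\<close>)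
    have "is_amalgam G (if n = 0 then dihedral_inf else dihedral n) (cyclic 2) (dihedral m)"
      by (rule is_amalgam_dihedral[OF g(1) sq(1) g(2,3) sq(2,3) o pp pc(2) am m _ iso]) simp_all
    then have "n > 0 \<Longrightarrow> is_amalgam G (dihedral n) (cyclic 2) (dihedral m)"
      "n = 0 \<Longrightarrow> is_amalgam G dihedral_inf (cyclic 2) (dihedral m)" by simp_all
    moreover have "n > 0 \<Longrightarrow> R = {\<aa> \<^bold>^ 2, \<bb> \<^bold>^ 2, \<cc> \<^bold>^ 2, (\<bb> @ \<cc>) \<^bold>^ n, (\<aa> @ (\<bb> @ \<cc>) \<^bold>^ k @ \<bb>) \<^bold>^ m}"
      "n = 0 \<Longrightarrow> R = {\<aa> \<^bold>^ 2, \<bb> \<^bold>^ 2, \<cc> \<^bold>^ 2, (\<aa> @ (\<bb> @ \<cc>) \<^bold>^ k @ \<bb>) \<^bold>^ m}"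
      by (auto simp: R_def)
    ultimately show ?thesis using P k m unfolding n_def[symmetric] by metis
  qed
  obtain u where u: "set u \<subseteq> T - {a}" "pr u = p" using oc(4) by (auto simp: p_def)
  then have "set u \<subseteq> {b, c}" using T by auto
  then obtain j :: int where j: "p = (b \<otimes> c) [^] j \<or> p = (b \<otimes> c) [^] j \<otimes> b"
    using dihedral_word[OF g(2,3) sq(2,3), of "\<lambda>t. t"] u(2) by blast
  from j show ?thesis
  proof
    assume p: "p = (b \<otimes> c) [^] j"
    obtain n where "n > 0" "ord (b \<otimes> c) = 2 * n" "(b \<otimes> c) [^] j = (b \<otimes> c) [^] n"
      using involution_power[OF x, of j] pc p by auto
    then show ?thesis using even p by metis
  next
    assume p: "p = (b \<otimes> c) [^] j \<otimes> b"
    show ?thesis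
    proof (cases "ord (b \<otimes> c) = 0")
      case False
      \<comment> \<open>Adding the order once more makes \<open>k\<close> positive even when the
        residue is zero.\<close>
      define k where "k = nat (j mod int (ord (b \<otimes> c))) + ord (b \<otimes> c)"
      have "int k = j mod int (ord (b \<otimes> c)) + int (ord (b \<otimes> c))" using False by (simp add: k_def)
      then have "int (ord (b \<otimes> c)) dvd int k - j"
        by (metis dvd_add_triv_right_iff dvd_minus_mod diff_add_eq dvd_minus_iff minus_diff_eq)
      then have "(b \<otimes> c) [^] (int k - j) = \<one>" using int_pow_eq_id[OF x] by simp
      moreover have "(b \<otimes> c) [^] int k = (b \<otimes> c) [^] (int k - j) \<otimes> (b \<otimes> c) [^] j" using x by (simp flip: int_pow_mult)
      ultimately have "(b \<otimes> c) [^] k = (b \<otimes> c) [^] j" using x by (simp add: int_pow_int)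
      then have "p = (b \<otimes> c) [^] k \<otimes> b" using p by simp
      moreover have "k > 0" using False by (simp add: k_def)
      ultimately show ?thesis using refl[OF T sq] False by blast
    next
      case True
      have T': "T = {a, c, b}" "T = {b, a, c}" "T = {c, a, b}" using T(1) by auto
      \<comment> \<open>These rule out the exponents \<open>j = 0\<close> and \<open>j = -1\<close>,
        the only ones that cannot be made positive by exchanging \<open>b\<close> and
        \<open>c\<close>.\<close>
      have "p \<noteq> b" "p \<noteq> c"
        unfolding p_def using one_cut_exit_ne[OF T'(2) _ T(4) T(3) sq(2) cut only]
          one_cut_exit_ne[OF T'(3) _ _ T(2) sq(3) cut only] T by metis+
      have i: "inv (b \<otimes> c) = c \<otimes> b" using inv_equality[OF sq(2)] inv_equality[OF sq(3)] g by (simp add: inv_mult_group)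
      consider "j > 0" | "j = 0" | "j = -1" | "j < -1" by linarith
      then show ?thesis
      proof cases
        case 1
        then have "p = (b \<otimes> c) [^] nat j \<otimes> b" using p by (metis int_nat_eq int_pow_int order_less_imp_le)
        then show ?thesis using refl[OF T sq, of "nat j"] 1 True by simp
      next
        case 2
        then show ?thesis using p \<open>p \<noteq> b\<close> g by simp
      next
        case 3
        then have "p = c \<otimes> b \<otimes> b" using p i x by (simp add: int_pow_neg)
        then have "p = c" using g sq by (simp add: m_assoc)
        then show ?thesis using \<open>p \<noteq> c\<close> by simp
      next
        case 4
        \<comment> \<open>The exponent comes from \<open>(b c)^(-1-k) b = (c b)^k c\<close>.\<close>
        define k where "k = nat (- 1 - j)"
        have k: "j = - int k - 1" "k > 0" using 4 by (simp_all add: k_def)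
        have "(b \<otimes> c) [^] j = (b \<otimes> c) [^] (- int k) \<otimes> (b \<otimes> c) [^] (-1::int)" unfolding k(1) using x by (simp flip: int_pow_mult)
        also have "\<dots> = (c \<otimes> b) [^] k \<otimes> (c \<otimes> b)"
          using x i g by (simp add: int_pow_neg int_pow_int flip: nat_pow_inv)
        finally have "p = (c \<otimes> b) [^] k \<otimes> (c \<otimes> b) \<otimes> b" using p by simp
        then have pk: "p = (c \<otimes> b) [^] k \<otimes> c" using g sq by (simp add: m_assoc)
        have "ord (c \<otimes> b) = 0" using True ord_mult_swap[OF g(2,3)] by simp
        then show ?thesis using refl[OF T'(1) T(3,2) T(4)[symmetric] sq(1,3,2) k(2) pk] by blast
      qed
    qed
  qed
qed

text \<open>The exit is an involution among the powers of \<open>a\<close>. So \<open>a\<close> has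
  even order \<open>2 * n\<close> and the exit is \<open>a^n\<close>; it is glued to one reflection
  of a dihedral group whose other reflection lies over \<open>b\<close>.\<close>

lemma case_one_cyclic:
  assumes gen: "generate G T = carrier G"
    and T: "T = {a, inv a, b}" "a \<noteq> inv a" "a \<noteq> b" "inv a \<noteq> b" and sq: "b \<otimes> b = \<one>"
    and cut: "cut_label b" and only: "\<And>t. cut_label t \<Longrightarrow> t = b"
  shows "\<exists>n>0. \<exists>m>0. is_amalgam G (cyclic (2 * n)) (cyclic 2) (dihedral m) \<and>
    G \<cong> presented {GenA, GenB} {\<bb> \<^bold>^ 2, \<aa> \<^bold>^ (2 * n), (\<bb> @ \<aa> \<^bold>^ n) \<^bold>^ m}"
proof -
  note oc = one_cut_label[OF cut only]
  define p where "p = exit_at b"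
  have g: "a \<in> carrier G" "b \<in> carrier G" "a \<in> T" using T by auto
  have pc: "p \<in> carrier G" "p \<noteq> \<one>" "p \<otimes> p = \<one>"
    using exit_at_closed[OF cut] exit_at_ne_one[OF cut] oc by (simp_all add: p_def)
  define m where "m = ord (b \<otimes> p)"
  have m: "m > 0" using ord_next_pos[OF cut] oc by (simp add: m_def p_def)
  have bm: "(b \<otimes> p) [^] m = \<one>" unfolding m_def using g pc by (simp add: pow_ord_eq_1)
  obtain u where u: "set u \<subseteq> T - {b}" "pr u = p" using oc(4) by (auto simp: p_def)
  then have "set u \<subseteq> {a, inv a}" using T by auto
  then obtain j :: int where j: "p = a [^] j" using letters_power[OF lifting_self[OF gen] g(3)] u(2) by metis
  obtain n where n: "n > 0" "ord a = 2 * n" "p = a [^] n"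
    using involution_power[OF g(1), of j] pc j by metis
  have o: "a [^] (2 * n) = \<one>" using pow_ord_eq_1[OF g(1)] n by simp
  have p': "exit_at b = a [^] n" using n by (simp add: p_def)
  define R where "R = {\<bb> \<^bold>^ 2, \<aa> \<^bold>^ (2 * n), (\<bb> @ \<aa> \<^bold>^ n) \<^bold>^ m}"
  have inR: "\<aa> \<^bold>^ (2 * n) \<in> R" "(\<bb> @ \<aa> \<^bold>^ n) \<^bold>^ m \<in> R" by (simp_all add: R_def)
  let ?P = "presented {GenA, GenB} R"
  have "G \<cong> ?P"
  proof (rule presented_two_lift[OF is_group g(1,2), of R])
    show "R \<subseteq> words {GenA, GenB}" "\<bb> \<^bold>^ 2 \<in> R" by (auto simp: R_def)
    show "word_val G (case_gen a b a) r = \<one>" if "r \<in> R" for r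
      using that g sq o bm n by (auto simp: R_def gen_word_val pow2_eq)
    fix \<pi> A B
    assume L: "two_lift ?P G \<pi> A B a b"
      and r: "\<And>r. r \<in> R \<Longrightarrow> word_val ?P (case_gen A B A) r = \<one>\<^bsub>?P\<^esub>"
    interpret P: group ?P using L by (simp add: two_lift_def)
    have c: "A \<in> carrier ?P" "B \<in> carrier ?P" using L by (auto simp: two_lift_def)
    show "G \<cong> ?P"
    proof (rule iso_one_cyclic[OF gen T sq cut only p' L])
      show "A [^]\<^bsub>?P\<^esub> ord a = \<one>\<^bsub>?P\<^esub>" unfolding n(2) using r[OF inR(1)] c by (simp add: P.gen_word_val)
      show "(B \<otimes>\<^bsub>?P\<^esub> A [^]\<^bsub>?P\<^esub> n) [^]\<^bsub>?P\<^esub> ord (b \<otimes> exit_at b) = \<one>\<^bsub>?P\<^esub>"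
        using r[OF inR(2)] c by (simp add: P.gen_word_val m_def p_def)
    qed
  qed
  moreover have "is_amalgam G (cyclic (2 * n)) (cyclic 2) (dihedral m)"
  proof -
    let ?D = "cyclic (2 * n)"
    interpret D: group ?D by simp
    have n2: "2 * n > 0" using n by simp
    define h where "h = 1 mod int (2 * n)"
    have "1 < int (2 * n)" using n by simp
    then have h1: "h = 1" by (simp add: h_def)
    have h: "h \<in> carrier ?D" "carrier ?D = generate ?D {h}" using cyclic_generator[OF n2] by (simp_all only: h_def)
    define f where "f = (\<lambda>k. a [^] (k::int))"
    have f: "f \<in> hom ?D G" unfolding f_def by (rule cyclic_hom[OF is_group g(1) o n2])
    interpret f: group_hom ?D G f using f is_group by (simp add: group_hom_def group_hom_axioms_def)
    have fh: "f h = a" using g h1 by (simp add: f_def)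
    define q where "q = h [^]\<^bsub>?D\<^esub> n"
    have q: "q \<in> carrier ?D" using D.nat_pow_closed[OF h(1)] by (simp only: q_def)
    have fq: "f q = p" using f.hom_nat_pow[OF h(1), of n] fh n(3) by (simp only: q_def)
    have h2n: "h [^]\<^bsub>?D\<^esub> (2 * n) = \<one>\<^bsub>?D\<^esub>" by simp
    have qq: "q \<otimes>\<^bsub>?D\<^esub> q = \<one>\<^bsub>?D\<^esub>"
      unfolding q_def D.nat_pow_mult[OF h(1)] using h2n by (simp only: mult_2)
    have fq1: "f q \<noteq> \<one>" "(b \<otimes> f q) [^] m = \<one>" using fq pc bm by simp_all
    obtain F :: "(int + gen word set) word set monoid" and \<alpha> x \<pi> where F: "group F"
      and am: "G \<cong> F \<Longrightarrow> is_amalgam G ?D (cyclic 2) (dihedral m)"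
      and \<alpha>: "\<alpha> \<in> hom ?D F" and x: "x \<in> carrier F" "x \<otimes>\<^bsub>F\<^esub> x = \<one>\<^bsub>F\<^esub>" "(x \<otimes>\<^bsub>F\<^esub> \<alpha> q) [^]\<^bsub>F\<^esub> m = \<one>\<^bsub>F\<^esub>"
      and \<pi>: "\<pi> \<in> hom F G" "\<And>y. y \<in> carrier ?D \<Longrightarrow> \<pi> (\<alpha> y) = f y" "\<pi> x = b"
      and genF: "\<And>U. U \<subseteq> carrier F \<Longrightarrow> x \<in> generate F U \<Longrightarrow> \<alpha> ` carrier ?D \<subseteq> generate F U \<Longrightarrow> carrier F \<subseteq> generate F U"
      by (rule amalgam_dihedral[OF D.is_group is_group f q qq fq1(1) g(2) sq fq1(2) m]) (rule that; (assumption | blast))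
    interpret F: group F by (rule F)
    interpret \<alpha>: group_hom ?D F \<alpha> using F \<alpha> by (simp add: group_hom_def group_hom_axioms_def)
    have \<alpha>h: "\<alpha> h \<in> carrier F" by (rule \<alpha>.hom_closed[OF h(1)])
    let ?U = "{\<alpha> h, x}"
    have U: "?U \<subseteq> carrier F" using \<alpha>h x by simp
    have "x \<in> generate F ?U" "\<alpha> ` {h} \<subseteq> generate F ?U" by (auto intro: generate.incl)
    moreover have "\<alpha> ` carrier ?D \<subseteq> generate F ?U"
      by (rule hom_image_generate[OF D.is_group F \<alpha> h(2) _ calculation(2) U]) (use h(1) in simp)
    ultimately have "carrier F \<subseteq> generate F ?U" using genF[OF U] by blast
    then have L: "two_lift F G \<pi> (\<alpha> h) x a b"
      unfolding two_lift_def using F \<pi>(1,3) \<pi>(2)[OF h(1)] \<alpha>h x fh by simp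
    have "\<alpha> h [^]\<^bsub>F\<^esub> (2 * n) = \<one>\<^bsub>F\<^esub>"
      using \<alpha>.hom_nat_pow[OF h(1), of "2 * n"] h2n \<alpha>.hom_one by metis
    moreover have "(x \<otimes>\<^bsub>F\<^esub> \<alpha> h [^]\<^bsub>F\<^esub> n) [^]\<^bsub>F\<^esub> m = \<one>\<^bsub>F\<^esub>"
      using x(3) \<alpha>.hom_nat_pow[OF h(1), of n] by (simp only: q_def)
    ultimately have "G \<cong> F"
      using iso_one_cyclic[OF gen T sq cut only p' L] by (simp add: n(2) m_def p_def)
    then show ?thesis by (rule am)
  qed
  ultimately show ?thesis using n m unfolding R_def by blast
qed

text \<open>A double step along the class reads \<open>a b a^-1 b\<close>. Rotated, it is the
  product of \<open>b\<close> with its conjugate \<open>a^-1 b a\<close>, that is, of the two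
  reflections joined by the stable letter.\<close>

lemma case_directed_fixed:
  assumes gen: "generate G T = carrier G"
    and T: "T = {a, inv a, b}" "a \<noteq> inv a" "a \<noteq> b" "inv a \<noteq> b" and sq: "b \<otimes> b = \<one>"
    and cut: "cut_label a" "\<not> cut_label b" and n: "next_label a = inv a" "next_label (inv a) = a"
    and ex: "exit_at a = b" "exit_at (inv a) = b"
  shows "\<exists>n>0. is_hnn_extension G (dihedral n) (cyclic 2) \<and>
    G \<cong> presented {GenA, GenB} {\<bb> \<^bold>^ 2, (\<bb> @ winv \<aa> @ \<bb> @ \<aa>) \<^bold>^ n}"
proof -
  define n where "n = ord (a \<otimes> b \<otimes> (inv a \<otimes> b))"
  have g: "a \<in> carrier G" "b \<in> carrier G" "b \<noteq> \<one>" using T one_notin_T by auto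
  have pos: "n > 0" using ord_next_next_pos[OF cut(1) assms(9,10)] ex g by (simp add: n_def)
  have "(a \<otimes> b \<otimes> (inv a \<otimes> b)) [^] n = \<one>" unfolding n_def by (rule pow_ord_eq_1) (use g in simp)
  moreover have "a \<otimes> b \<otimes> (inv a \<otimes> b) = a \<otimes> (b \<otimes> inv a \<otimes> b)" using g by (simp add: m_assoc)
  ultimately have "(a \<otimes> (b \<otimes> inv a \<otimes> b)) [^] n = \<one>" by simp
  then have "(b \<otimes> inv a \<otimes> b \<otimes> a) [^] n = \<one>" by (rule pow_mult_swap[rotated 2]) (use g in auto)
  moreover have "b \<otimes> inv a \<otimes> b \<otimes> a = b \<otimes> (inv a \<otimes> b \<otimes> a)" using g by (simp add: m_assoc)
  ultimately have o: "(b \<otimes> (inv a \<otimes> b \<otimes> a)) [^] n = \<one>" by simp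
  define R where "R = {\<bb> \<^bold>^ 2, (\<bb> @ winv \<aa> @ \<bb> @ \<aa>) \<^bold>^ n}"
  have inR: "(\<bb> @ winv \<aa> @ \<bb> @ \<aa>) \<^bold>^ n \<in> R" by (simp_all add: R_def)
  let ?P = "presented {GenA, GenB} R"
  have "G \<cong> ?P"
  proof (rule presented_two_lift[OF is_group g(1,2), of R])
    show "R \<subseteq> words {GenA, GenB}" "\<bb> \<^bold>^ 2 \<in> R" by (auto simp: R_def)
    show "word_val G (case_gen a b a) r = \<one>" if "r \<in> R" for r
      using that g sq o by (auto simp: R_def gen_word_val pow2_eq winv_def m_assoc)
    fix \<pi> A B
    assume L: "two_lift ?P G \<pi> A B a b"
      and r: "\<And>r. r \<in> R \<Longrightarrow> word_val ?P (case_gen A B A) r = \<one>\<^bsub>?P\<^esub>"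
    interpret P: group ?P using L by (simp add: two_lift_def)
    have c: "A \<in> carrier ?P" "B \<in> carrier ?P" using L by (auto simp: two_lift_def)
    have "word_val ?P (case_gen A B A) (\<bb> @ winv \<aa> @ \<bb> @ \<aa>)
      = B \<otimes>\<^bsub>?P\<^esub> (inv\<^bsub>?P\<^esub> A \<otimes>\<^bsub>?P\<^esub> B \<otimes>\<^bsub>?P\<^esub> A)" using c by (simp add: winv_def P.m_assoc)
    then have "(B \<otimes>\<^bsub>?P\<^esub> (inv\<^bsub>?P\<^esub> A \<otimes>\<^bsub>?P\<^esub> B \<otimes>\<^bsub>?P\<^esub> A)) [^]\<^bsub>?P\<^esub> n = \<one>\<^bsub>?P\<^esub>"
      using r[OF inR(1)] P.gen_word_val(3)[OF c c(1)] by metis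
    then show "G \<cong> ?P"
      using iso_directed_fixed[OF gen T sq cut assms(9,10) L] by (simp add: n_def)
  qed
  moreover have "is_hnn_extension G (dihedral n) (cyclic 2)"
  proof (rule hnn_dihedral[OF is_group g(1,2) sq g(3) o pos])
    fix F :: "gen word set option word set monoid" and A B \<pi>
    assume F: "group F" "G \<cong> F \<Longrightarrow> is_hnn_extension G (dihedral n) (cyclic 2)"
      "A \<in> carrier F" "B \<in> carrier F" "B \<otimes>\<^bsub>F\<^esub> B = \<one>\<^bsub>F\<^esub>"
      "(B \<otimes>\<^bsub>F\<^esub> (inv\<^bsub>F\<^esub> A \<otimes>\<^bsub>F\<^esub> B \<otimes>\<^bsub>F\<^esub> A)) [^]\<^bsub>F\<^esub> n = \<one>\<^bsub>F\<^esub>"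
      "\<pi> \<in> hom F G" "\<pi> A = a" "\<pi> B = b" "carrier F \<subseteq> generate F {A, B}"
    then have L: "two_lift F G \<pi> A B a b" by (simp add: two_lift_def)
    have "G \<cong> F" using iso_directed_fixed[OF gen T sq cut assms(9,10) L] F(6) by (simp add: n_def)
    then show ?thesis by (rule F(2))
  qed
  ultimately show ?thesis using pos unfolding R_def by blast
qed

text \<open>A single step reads \<open>a b\<close> and has finite order \<open>n\<close>. The free
  factors are generated by its conjugate \<open>b a\<close> and by the involution
  \<open>b\<close>.\<close>

lemma case_directed_swapped:
  assumes gen: "generate G T = carrier G"
    and T: "T = {a, inv a, b}" "a \<noteq> inv a" "a \<noteq> b" "inv a \<noteq> b" and sq: "b \<otimes> b = \<one>"
    and cut: "cut_label a" "\<not> cut_label b" and n: "next_label a = a" "next_label (inv a) = inv a"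
    and ex: "exit_at (inv a) = b"
  shows "\<exists>n>0. G \<cong> free_product (cyclic n) (cyclic 2) \<and>
    G \<cong> presented {GenA, GenB} {\<bb> \<^bold>^ 2, (\<bb> @ \<aa>) \<^bold>^ n}"
proof -
  define n where "n = ord (a \<otimes> b)"
  have g: "a \<in> carrier G" "b \<in> carrier G" using T by auto
  have pos: "n > 0" using ord_next_pos[OF cut(1) assms(9)] ex by (simp add: n_def)
  have ab: "a \<otimes> b \<in> carrier G" using g by simp
  have o: "(b \<otimes> a) [^] n = \<one>"
    using pow_mult_swap[OF g, of n] pow_ord_eq_1[OF ab] by (simp add: n_def)
  define R where "R = {\<bb> \<^bold>^ 2, (\<bb> @ \<aa>) \<^bold>^ n}"
  have inR: "(\<bb> @ \<aa>) \<^bold>^ n \<in> R" by (simp_all add: R_def)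
  let ?P = "presented {GenA, GenB} R"
  have "G \<cong> ?P"
  proof (rule presented_two_lift[OF is_group g(1,2), of R])
    show "R \<subseteq> words {GenA, GenB}" "\<bb> \<^bold>^ 2 \<in> R" by (auto simp: R_def)
    show "word_val G (case_gen a b a) r = \<one>" if "r \<in> R" for r
      using that g sq o by (auto simp: R_def gen_word_val pow2_eq)
    fix \<pi> A B
    assume L: "two_lift ?P G \<pi> A B a b"
      and r: "\<And>r. r \<in> R \<Longrightarrow> word_val ?P (case_gen A B A) r = \<one>\<^bsub>?P\<^esub>"
    interpret P: group ?P using L by (simp add: two_lift_def)
    have c: "A \<in> carrier ?P" "B \<in> carrier ?P" using L by (auto simp: two_lift_def)
    show "G \<cong> ?P"
      using iso_directed_swapped[OF gen T sq cut assms(9,10) L] r[OF inR(1)] c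
      by (simp add: n_def P.gen_word_val)
  qed
  moreover have "G \<cong> free_product (cyclic n) (cyclic 2)"
  proof (rule free_product_cyclic[OF is_group g sq o pos])
    let ?F = "free_product (cyclic n) (cyclic 2)"
    fix A B \<pi>
    assume F: "group ?F" "A \<in> carrier ?F" "B \<in> carrier ?F" "B \<otimes>\<^bsub>?F\<^esub> B = \<one>\<^bsub>?F\<^esub>"
      "(B \<otimes>\<^bsub>?F\<^esub> A) [^]\<^bsub>?F\<^esub> n = \<one>\<^bsub>?F\<^esub>" "\<pi> \<in> hom ?F G" "\<pi> A = a" "\<pi> B = b" "carrier ?F \<subseteq> generate ?F {A, B}"
    then have L: "two_lift ?F G \<pi> A B a b" by (simp add: two_lift_def)
    show "G \<cong> ?F" using iso_directed_swapped[OF gen T sq cut assms(9,10) L] F(5) by (simp add: n_def)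
  qed
  ultimately show ?thesis using pos unfolding R_def by blast
qed

section \<open>The case distinction\<close>

lemma third_label:
  assumes "x \<in> T" "y \<in> T" "x \<noteq> y"
  obtains z where "T = {x, y, z}" "z \<noteq> x" "z \<noteq> y"
proof -
  have "finite T" using card_T card.infinite by fastforce
  then have "card (T - {x, y}) = 1" using card_T assms by (simp add: card_Diff_subset)
  then obtain z where "T - {x, y} = {z}" using card_1_singletonE by blast
  then show thesis using that[of z] assms by blast
qed

lemma inv_eq_iff_square: "t \<in> T \<Longrightarrow> inv t = t \<Longrightarrow> t \<otimes> t = \<one>"
  by (metis T_in r_inv)

end

text \<open>The division is by whether all labels are involutions or two of them form an inverse
  pair, then by the number of cut labels, and with two cut labels by whether the exits keep or
  exchange them.\<close>

theorem theorem1p1: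
  fixes G :: "('g, 'l) monoid_scheme" and S :: "'g set"
  assumes "group G"
    and "S \<subseteq> carrier G"
    and "generate G S = carrier G"
    and "cubic_graph (carrier G) (cayley_edges G S)"
    and "connectivity_two (carrier G) (cayley_edges G S)"
  shows
    "(\<exists>n>0. G \<cong> free_product (cyclic n) (cyclic 2) \<and>
        (G \<cong> presented {GenA, GenB} {\<bb> \<^bold>^ 2, (\<bb> @ \<aa>) \<^bold>^ n} \<or>
         G \<cong> presented {GenA, GenB, GenC}
               {\<aa> \<^bold>^ 2, \<bb> \<^bold>^ 2, \<cc> \<^bold>^ 2, (\<bb> @ \<cc> @ \<bb> @ \<aa>) \<^bold>^ n})) \<or>
     (\<exists>n>0. is_hnn_extension G (dihedral n) (cyclic 2) \<and>
        G \<cong> presented {GenA, GenB} {\<bb> \<^bold>^ 2, (\<bb> @ winv \<aa> @ \<bb> @ \<aa>) \<^bold>^ n}) \<or>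
     (\<exists>n>0. \<exists>m>0. is_amalgam G (dihedral n) (cyclic 2) (dihedral m) \<and>
        G \<cong> presented {GenA, GenB, GenC}
              {\<aa> \<^bold>^ 2, \<bb> \<^bold>^ 2, \<cc> \<^bold>^ 2, (\<bb> @ \<aa>) \<^bold>^ n, (\<bb> @ \<cc>) \<^bold>^ m}) \<or>
     (\<exists>n>0. \<exists>m>0. is_amalgam G (dihedral (2 * n)) (cyclic 2) (dihedral m) \<and>
        G \<cong> presented {GenA, GenB, GenC}
              {\<aa> \<^bold>^ 2, \<bb> \<^bold>^ 2, \<cc> \<^bold>^ 2, (\<bb> @ \<cc>) \<^bold>^ (2 * n),
               (\<aa> @ (\<bb> @ \<cc>) \<^bold>^ n) \<^bold>^ m}) \<or>
     (\<exists>n>0. \<exists>m>0. \<exists>k>0. is_amalgam G (dihedral n) (cyclic 2) (dihedral m) \<and>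
        G \<cong> presented {GenA, GenB, GenC}
              {\<aa> \<^bold>^ 2, \<bb> \<^bold>^ 2, \<cc> \<^bold>^ 2, (\<bb> @ \<cc>) \<^bold>^ n,
               (\<aa> @ (\<bb> @ \<cc>) \<^bold>^ k @ \<bb>) \<^bold>^ m}) \<or>
     (\<exists>n>0. \<exists>m>0. is_amalgam G (cyclic (2 * n)) (cyclic 2) (dihedral m) \<and>
        G \<cong> presented {GenA, GenB} {\<bb> \<^bold>^ 2, \<aa> \<^bold>^ (2 * n), (\<bb> @ \<aa> \<^bold>^ n) \<^bold>^ m}) \<or>
     (\<exists>n>0. \<exists>m>0. is_amalgam G dihedral_inf (cyclic 2) (dihedral m) \<and>
        G \<cong> presented {GenA, GenB, GenC}
              {\<aa> \<^bold>^ 2, \<bb> \<^bold>^ 2, \<cc> \<^bold>^ 2, (\<aa> @ (\<bb> @ \<cc>) \<^bold>^ n @ \<bb>) \<^bold>^ m})"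
proof -
  obtain T where cc: "cubic_cayley G T" and gen: "generate G T = carrier G"
    and ex: "\<exists>s. cubic_cayley.cut_label G T s"
    by (rule cubic_cayley_of_hyps[OF assms])
  interpret cubic_cayley G T by (rule cc)
  obtain s where s: "cut_label s" using ex by blast
  obtain b where b: "b \<in> T" "\<not> cut_label b" using not_all_cut[OF s] by blast
  have sT: "s \<in> T" "b \<noteq> s" using s b by auto
  show ?thesis
  proof (cases "\<forall>t\<in>T. inv\<^bsub>G\<^esub> t = t")
    case True
    obtain s' where T: "T = {b, s, s'}" "s' \<noteq> b" "s' \<noteq> s" by (rule third_label[OF b(1) sT])
    have sq: "b \<otimes>\<^bsub>G\<^esub> b = \<one>\<^bsub>G\<^esub>" "s \<otimes>\<^bsub>G\<^esub> s = \<one>\<^bsub>G\<^esub>" "s' \<otimes>\<^bsub>G\<^esub> s' = \<one>\<^bsub>G\<^esub>"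
      using inv_eq_iff_square True T(1) by blast+
    have i: "inv\<^bsub>G\<^esub> s = s" "inv\<^bsub>G\<^esub> s' = s'" using True T(1) by blast+
    show ?thesis
    proof (cases "cut_label s'")
      case s': True
      from two_cut_labels(3)[OF T(1) sT(2) T(2)[symmetric] T(3)[symmetric] sq(1) s s' b(2)] show ?thesis
      proof
        assume *: "exit_label s = s \<and> exit_label s' = s'"
        have "next_label s = s" "next_label s' = s'" using * i by simp_all
        from case_two_fixed[OF gen T(1) sT(2) T(2)[symmetric] T(3)[symmetric] sq s s' b(2) this] show ?thesis by (simp only: simp_thms)
      next
        assume *: "exit_label s = s' \<and> exit_label s' = s"
        have "next_label s = s'" "next_label s' = s" using * i by simp_all
        from case_two_swapped[OF gen T(1) sT(2) T(2)[symmetric] T(3)[symmetric] sq s s' b(2) this] show ?thesis by (simp only: simp_thms)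
      qed
    next
      case False
      have T': "T = {s, b, s'}" using T(1) by blast
      have only: "t = s" if "cut_label t" for t using that cut_labelD[OF that] b(2) False T(1) by blast
      show ?thesis
        using case_one_dihedral[OF gen T' sT(2)[symmetric] T(3)[symmetric] T(2)[symmetric] sq(2,1,3) s only] by blast
    qed
  next
    case False
    then obtain a where a: "a \<in> T" "a \<noteq> inv\<^bsub>G\<^esub> a" by metis
    \<comment> \<open>A label that differs from its inverse leaves a single third label, which must
      be its own inverse.\<close>
    obtain d where T: "T = {a, inv\<^bsub>G\<^esub> a, d}" "d \<noteq> a" "d \<noteq> inv\<^bsub>G\<^esub> a"
      by (rule third_label[OF a(1) inv_T[OF a(1)] a(2)])
    have aa: "inv\<^bsub>G\<^esub> (inv\<^bsub>G\<^esub> a) = a" using a by simp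
    have d: "d \<in> T" using T(1) by blast
    have "inv\<^bsub>G\<^esub> d \<noteq> a" "inv\<^bsub>G\<^esub> d \<noteq> inv\<^bsub>G\<^esub> a" using T(2,3) aa T_in[OF d] T_in[OF a(1)] inv_inv by metis+
    then have "inv\<^bsub>G\<^esub> d = d" using inv_T[OF d] T(1) by blast
    then have sq: "d \<otimes>\<^bsub>G\<^esub> d = \<one>\<^bsub>G\<^esub>" by (rule inv_eq_iff_square[OF d])
    show ?thesis
    proof (cases "cut_label a")
      case cut: True
      have cut': "cut_label (inv\<^bsub>G\<^esub> a)" by (rule cut_label_inv[OF cut])
      have nd: "\<not> cut_label d" using b cut cut' T(1) by blast
      have T': "T = {d, a, inv\<^bsub>G\<^esub> a}" using T(1) by blast
      note two = two_cut_labels[OF T' T(2,3) a(2) sq cut cut' nd]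
      from two(3) show ?thesis
      proof
        assume *: "exit_label a = a \<and> exit_label (inv\<^bsub>G\<^esub> a) = inv\<^bsub>G\<^esub> a"
        have "next_label a = inv\<^bsub>G\<^esub> a" "next_label (inv\<^bsub>G\<^esub> a) = a" using * aa by simp_all
        from case_directed_fixed[OF gen T(1) a(2) T(2)[symmetric] T(3)[symmetric] sq cut nd this two(1,2)]
        show ?thesis by (simp only: simp_thms)
      next
        assume *: "exit_label a = inv\<^bsub>G\<^esub> a \<and> exit_label (inv\<^bsub>G\<^esub> a) = a"
        have "next_label a = a" "next_label (inv\<^bsub>G\<^esub> a) = inv\<^bsub>G\<^esub> a" using * aa by simp_all
        from case_directed_swapped[OF gen T(1) a(2) T(2)[symmetric] T(3)[symmetric] sq cut nd this two(2)]
        \<comment> \<open>Of the two presentations in this disjunct, the one on two generators is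
          obtained.\<close>
        show ?thesis by (elim exE conjE, intro disjI1 exI conjI) assumption+
      qed
    next
      case False
      then have ncut': "\<not> cut_label (inv\<^bsub>G\<^esub> a)" using cut_label_inv[of "inv\<^bsub>G\<^esub> a"] aa by auto
      have only: "t = d" if "cut_label t" for t using that cut_labelD[OF that] False ncut' T(1) by blast
      have "cut_label d" using only[OF s] s by simp
      from case_one_cyclic[OF gen T(1) a(2) T(2)[symmetric] T(3)[symmetric] sq this only] show ?thesis by (simp only: simp_thms)
    qed
  qed
qed

end
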